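(* Let the unbounded region $E$ be given as the exterior of a finite collection of bounded domains, with boundary $\Gamma=\partial E$. Suppose that $\operatorname{Im}(k)\ge 0$ and that $(\boldsymbol{u},p)$ is a radiating solution to the oscillatory Stokes equation in $E$ with $\boldsymbol{u}=0$ on the boundary $\Gamma$. Then $\boldsymbol{u}\equiv 0$ in $E$.
   Context: The setting is the plane $\mathbb{R}^2$, $k$ is a complex parameter, and functions may be complex valued. The exterior of a finite collection of bounded domains $\Omega_1,\dots,\Omega_m$ is $E=\mathbb{R}^2\setminus\overline{\Omega}$ with $\Omega=\bigcup_{i=1}^m\Omega_i$. The oscillatory Stokes equation with parameter $k$, for a velocity field $\boldsymbol{u}$ and pressure $p$, is $-\Delta\boldsymbol{u}+\nabla p=k^2\boldsymbol{u}$, $\nabla\cdot\boldsymbol{u}=0$. Solutions are sought in the space $A(E)$ of pairs $(\boldsymbol{u},p)$ with $\boldsymbol{u}\in(C^2(E)\cap C(\overline{E}))^2$ and $p\in C^1(E)\cap C(\overline{E})$. The stress tensor is $\boldsymbol{\sigma}=-p\,\mathbf{I}+2\boldsymbol{e}(\boldsymbol{u})$ with $e_{ij}(\boldsymbol{u})=\frac12(\partial_{x_j}u_i+\partial_{x_i}u_j)$. The pair $(\boldsymbol{u},p)$ is called radiating if $$\lim_{r\to\infty}\sqrt{r}\,|\boldsymbol{t}-ik\boldsymbol{u}|=0$$ uniformly in direction, where $r=|\boldsymbol{x}|$ and $\boldsymbol{t}=\boldsymbol{\sigma}\cdot\boldsymbol{\nu}$ with $\boldsymbol{\nu}=\boldsymbol{x}/|\boldsymbol{x}|$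 is the surface traction on the circle of radius $r$ centered at the origin.
   Formalization: The parameter k is assumed nonzero, since for k = 0 the claim fails (outside the unit disk, p = 0 and u = (1 − 1/|x|²)(−x₂, x₁) is a radiating nonzero solution); "region" is read as saying that E is connected. *)

theory Defs
  imports "HOL-Analysis.Analysis"
begin

definition exterior :: "(nat \<Rightarrow> (real^2) set) \<Rightarrow> nat \<Rightarrow> (real^2) set" where
  "exterior \<Omega> m = - closure (\<Union>i\<in>{1..m}. \<Omega> i)"

text \<open>The functions below are total; only their values on the closure of the exterior domain
  matter. On an open set every derivative at a point of the set depends only on the values in
  the set.\<close>

definition partial :: "2 \<Rightarrow> (real^2 \<Rightarrow> 'b::real_normed_vector) \<Rightarrow> real^2 \<Rightarrow> 'b" where
  "partial j f x = frechet_derivative f (at x) (axis j 1)"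

definition C1_on :: "(real^2) set \<Rightarrow> (real^2 \<Rightarrow> 'b::real_normed_vector) \<Rightarrow> bool" where
  "C1_on S f \<longleftrightarrow>
     (\<forall>x\<in>S. f differentiable (at x)) \<and> (\<forall>j. continuous_on S (partial j f))"

definition C2_on :: "(real^2) set \<Rightarrow> (real^2 \<Rightarrow> 'b::real_normed_vector) \<Rightarrow> bool" where
  "C2_on S f \<longleftrightarrow> C1_on S f \<and> (\<forall>j. C1_on S (partial j f))"

definition laplacian :: "(real^2 \<Rightarrow> 'b::real_normed_vector) \<Rightarrow> real^2 \<Rightarrow> 'b" where
  "laplacian f x = (\<Sum>j\<in>UNIV. partial j (partial j f) x)"

definition grad :: "(real^2 \<Rightarrow> complex) \<Rightarrow> real^2 \<Rightarrow> complex^2" where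
  "grad p x = (\<chi> i. partial i p x)"

definition divergence :: "(real^2 \<Rightarrow> complex^2) \<Rightarrow> real^2 \<Rightarrow> complex" where
  "divergence u x = (\<Sum>j\<in>UNIV. partial j (\<lambda>y. u y $ j) x)"

definition solution_space ::
  "(real^2) set \<Rightarrow> ((real^2 \<Rightarrow> complex^2) \<times> (real^2 \<Rightarrow> complex)) set" where
  "solution_space E =
     {(u, p). C2_on E u \<and> continuous_on (closure E) u \<and>
              C1_on E p \<and> continuous_on (closure E) p}"

definition oscillatory_stokes ::
  "complex \<Rightarrow> (real^2) set \<Rightarrow> (real^2 \<Rightarrow> complex^2) \<Rightarrow> (real^2 \<Rightarrow> complex) \<Rightarrow> bool" where
  "oscillatory_stokes k E u p \<longleftrightarrow>
     (u, p) \<in> solution_space E \<and>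
     (\<forall>x\<in>E. - laplacian u x + grad p x = k\<^sup>2 *s u x) \<and>
     (\<forall>x\<in>E. divergence u x = 0)"

definition strain :: "(real^2 \<Rightarrow> complex^2) \<Rightarrow> real^2 \<Rightarrow> complex^2^2" where
  "strain u x =
     (\<chi> i j. (partial j (\<lambda>y. u y $ i) x + partial i (\<lambda>y. u y $ j) x) / 2)"

definition stress ::
  "(real^2 \<Rightarrow> complex^2) \<Rightarrow> (real^2 \<Rightarrow> complex) \<Rightarrow> real^2 \<Rightarrow> complex^2^2" where
  "stress u p x = mat (- p x) + 2 *\<^sub>R strain u x"

text \<open>Surface traction at \<open>x\<close> on the circle through \<open>x\<close> centred at the origin.\<close>

definition traction ::
  "(real^2 \<Rightarrow> complex^2) \<Rightarrow> (real^2 \<Rightarrow> complex) \<Rightarrow> real^2 \<Rightarrow> complex^2" where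
  "traction u p x = stress u p x *v (\<chi> i. complex_of_real (x $ i / norm x))"

definition radiating ::
  "complex \<Rightarrow> (real^2 \<Rightarrow> complex^2) \<Rightarrow> (real^2 \<Rightarrow> complex) \<Rightarrow> bool" where
  "radiating k u p \<longleftrightarrow>
     uniform_limit (sphere 0 1)
       (\<lambda>r \<nu>. sqrt r * norm (traction u p (r *\<^sub>R \<nu>) - (\<i> * k) *s u (r *\<^sub>R \<nu>)))
       (\<lambda>\<nu>. 0) at_top"

end

theory Submission
  imports Defs
begin

text \<open>
  Energy identity. The boundary carries no regularity, so \<open>-\<Delta>u + \<nabla>p = k\<^sup>2u\<close> is tested with
  \<open>\<eta> h\<^sub>\<epsilon>(|u|\<^sup>2) cnj u\<close>, where \<open>\<eta>\<close> cuts off at radius \<open>R\<close> and \<open>h\<^sub>\<epsilon>\<close> vanishes near 0; this has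
  compact support in \<open>E\<close>. It is not divergence free, but the resulting pressure term is absorbed
  because \<open>s h\<^sub>\<epsilon>'(s)\<close> is bounded and \<open>p\<close> is bounded near the boundary. Hence \<open>\<nabla>u\<close> is locally square
  integrable up to the boundary, and \<open>\<epsilon> \<rightarrow> 0\<close> gives the identity
  \<open>\<integral> \<eta> (2|e(u)|\<^sup>2 - k\<^sup>2|u|\<^sup>2) = \<integral> |\<nabla>\<eta>| t \<cdot> cnj u\<close>. Multiplying by \<open>cnj k\<close>, taking imaginary parts and
  using \<open>2 Im (cnj k t \<cdot> cnj u) = |t|\<^sup>2 + |k|\<^sup>2|u|\<^sup>2 - |t - iku|\<^sup>2\<close>, the radiation condition forces
  \<open>Im k \<integral> \<eta> |u|\<^sup>2 + \<integral> |\<nabla>\<eta>| |u|\<^sup>2 \<rightarrow> 0\<close>. This settles \<open>Im k > 0\<close>.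

  Real \<open>k\<close>. The vorticity \<open>\<omega>\<close> satisfies the Helmholtz equation and the pressure is harmonic. On large
  circles the Fourier modes of \<open>u\<^sub>1 \<plusminus> i u\<^sub>2\<close> are sums of a decaying power of \<open>r\<close> (from the pressure) and a
  first-order expression in a mode of \<open>\<omega>\<close>; by a Rellich argument for Bessel's equation the decay of
  \<open>u\<close> kills all modes of \<open>\<omega>\<close>. Unique continuation, by the same modes on circles in small balls, gives
  \<open>\<omega> = 0\<close> in \<open>E\<close>. Then \<open>u\<close> is harmonic, and the energy identity for \<open>p = 0\<close>, \<open>k = 0\<close> yields \<open>\<nabla>u = 0\<close>.
\<close>

section \<open>Calculus of partial derivatives in the plane\<close>

text \<open>Three obstacles shape the argument. First, \<open>u\<close> and \<open>p\<close> are
  only continuous up to a boundary of arbitrary shape, so neither Green's formula nor integrability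
  of the gradient is available there. Boundary integrals are therefore replaced by solid integrals
  against a cutoff, and the circles of the radiation condition by the gradient of the cutoff, which
  is radial. Second, two momentum fluxes are needed: the gradient, whose truncation term has a
  favourable sign and so yields square integrability, and the stress, whose normal component is the
  traction. Third, \<open>p\<close> and the vorticity are known to be C^1 only, so Laplace's and
  Helmholtz's equations cannot be written for them pointwise. A first-order system for p +
  i\<omega>, p - i\<omega> and the complex velocities replaces both, and its Fourier modes satisfy
  ordinary differential equations, singular only at r = 0. The pressure part of \<open>u\<close>
  decays like a power of r and escapes a Rellich argument; only the vorticity can be removed at
  infinity, and the boundary condition is used a second time to remove the remaining potential
  flow.\<close>

lemma has_derivative_partial:
  assumes "(f has_derivative f') (at x)"
  shows "partial j f x = f' (axis j 1)"
  by (simp add: partial_def frechet_derivative_at[OF assms, symmetric])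

lemma linear_axis_sum:
  fixes f' :: "real^2 \<Rightarrow> 'b::real_normed_vector"
  assumes "linear f'"
  shows "f' h = (\<Sum>j\<in>UNIV. h $ j *\<^sub>R f' (axis j 1))"
proof -
  have "h = (\<Sum>j\<in>UNIV. h $ j *\<^sub>R axis j 1)"
    using basis_expansion[of h] by (simp add: scalar_mult_eq_scaleR)
  then have "f' h = f' (\<Sum>j\<in>UNIV. h $ j *\<^sub>R axis j 1)" by simp
  also have "\<dots> = (\<Sum>j\<in>UNIV. h $ j *\<^sub>R f' (axis j 1))"
    by (simp add: linear_sum[OF assms] linear_scale[OF assms])
  finally show ?thesis .
qed

lemma differentiable_frechet:
  "f differentiable (at x) \<Longrightarrow> (f has_derivative frechet_derivative f (at x)) (at x)"
  by (rule frechet_derivative_works[THEN iffD1])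

lemma differentiable_partial:
  fixes f :: "real^2 \<Rightarrow> 'b::real_normed_vector"
  assumes "f differentiable (at x)"
  shows "(f has_derivative (\<lambda>h. \<Sum>j\<in>UNIV. h $ j *\<^sub>R partial j f x)) (at x)"
proof -
  have D: "(f has_derivative frechet_derivative f (at x)) (at x)"
    by (rule differentiable_frechet[OF assms])
  have "frechet_derivative f (at x) = (\<lambda>h. \<Sum>j\<in>UNIV. h $ j *\<^sub>R partial j f x)"
    unfolding partial_def
    by (rule ext) (rule linear_axis_sum[OF has_derivative_linear[OF D]])
  with D show ?thesis by simp
qed

lemma C1_on_differentiable: "C1_on S f \<Longrightarrow> x \<in> S \<Longrightarrow> f differentiable (at x)"
  and C1_on_partial: "C1_on S f \<Longrightarrow> continuous_on S (partial j f)"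
  by (auto simp: C1_on_def)

lemma C1_on_continuous: "C1_on S f \<Longrightarrow> continuous_on S f"
  by (meson C1_on_def continuous_at_imp_continuous_on differentiable_imp_continuous_within)

lemma C1_onI:
  assumes "\<And>x. x \<in> S \<Longrightarrow> (f has_derivative f' x) (at x)"
    and "\<And>j. continuous_on S (\<lambda>x. f' x (axis j 1))"
  shows "C1_on S f"
  unfolding C1_on_def
proof (intro conjI ballI allI)
  show "f differentiable (at x)" if "x \<in> S" for x
    using assms(1)[OF that] by (auto simp: differentiable_def)
  show "continuous_on S (partial j f)" for j
    using assms(2)[of j] by (rule continuous_on_eq) (simp add: has_derivative_partial[OF assms(1)])
qed

lemma C2_on_imp_C1_on: "C2_on S f \<Longrightarrow> C1_on S f"
  and C2_on_partial: "C2_on S f \<Longrightarrow> C1_on S (partial j f)"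
  by (auto simp: C2_on_def)

lemma partial_bounded_linear:
  assumes "f differentiable (at x)" "bounded_linear L"
  shows "partial j (\<lambda>y. L (f y)) x = L (partial j f x)"
  unfolding partial_def[of j f]
  by (rule has_derivative_partial[OF bounded_linear.has_derivative[OF assms(2) differentiable_frechet[OF assms(1)]]])

lemma partial_add:
  assumes "f differentiable (at x)" "g differentiable (at x)"
  shows "partial j (\<lambda>y. f y + g y) x = partial j f x + partial j g x"
  unfolding partial_def[of j f] partial_def[of j g]
  by (rule has_derivative_partial[OF has_derivative_add[OF assms[THEN differentiable_frechet]]])

lemma partial_diff:
  assumes "f differentiable (at x)" "g differentiable (at x)"
  shows "partial j (\<lambda>y. f y - g y) x = partial j f x - partial j g x"
  unfolding partial_def[of j f] partial_def[of j g]
  by (rule has_derivative_partial[OF has_derivative_diff[OF assms[THEN differentiable_frechet]]])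

lemma partial_mult:
  fixes f g :: "real^2 \<Rightarrow> 'b::real_normed_algebra"
  assumes "f differentiable (at x)" "g differentiable (at x)"
  shows "partial j (\<lambda>y. f y * g y) x = f x * partial j g x + partial j f x * g x"
  unfolding partial_def[of j f] partial_def[of j g]
  by (rule has_derivative_partial[OF has_derivative_mult[OF assms[THEN differentiable_frechet]]])

lemma partial_sum:
  assumes "\<And>i. i \<in> I \<Longrightarrow> f i differentiable (at x)"
  shows "partial j (\<lambda>y. \<Sum>i\<in>I. f i y) x = (\<Sum>i\<in>I. partial j (f i) x)"
  unfolding partial_def[of j "f _"]
  by (rule has_derivative_partial[OF has_derivative_sum]) (use assms differentiable_frechet in auto)

text \<open>\<open>frechet_derivative\<close> chooses from the set of derivatives, and functions
  with the same germ have the same set; the equality thus holds even at points where no derivative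
  exists.\<close>

lemma partial_cong:
  assumes "open S" "x \<in> S" "\<And>y. y \<in> S \<Longrightarrow> f y = g y"
  shows "partial j f x = partial j g x"
proof -
  have "(f has_derivative D) (at x) \<longleftrightarrow> (g has_derivative D) (at x)" for D
  proof
    show "(g has_derivative D) (at x)" if "(f has_derivative D) (at x)"
      by (rule has_derivative_transform_within_open[OF that assms(1,2)]) (simp add: assms(3))
    show "(f has_derivative D) (at x)" if "(g has_derivative D) (at x)"
      by (rule has_derivative_transform_within_open[OF that assms(1,2)]) (simp add: assms(3))
  qed
  then show ?thesis unfolding partial_def frechet_derivative_def by simp
qed

lemma C1_on_cong:
  assumes "open S" "\<And>y. y \<in> S \<Longrightarrow> f y = g y" "C1_on S f"
  shows "C1_on S g"
  unfolding C1_on_def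
proof (intro conjI ballI allI)
  show "g differentiable (at x)" if "x \<in> S" for x
    using has_derivative_transform_within_open[OF differentiable_frechet[OF C1_on_differentiable[OF assms(3) that]] assms(1) that]
      assms(2) by (auto simp: differentiable_def)
  show "continuous_on S (partial j g)" for j
    using C1_on_partial[OF assms(3)] by (rule continuous_on_eq) (rule partial_cong[OF assms(1) _ assms(2)])
qed

lemma C1_on_subset: "C1_on S f \<Longrightarrow> T \<subseteq> S \<Longrightarrow> C1_on T f"
  unfolding C1_on_def using continuous_on_subset by blast

lemma C1_on_bounded_linear:
  assumes "C1_on S f" "bounded_linear L"
  shows "C1_on S (\<lambda>y. L (f y))"
  unfolding C1_on_def
proof (intro conjI ballI allI)
  show "(\<lambda>y. L (f y)) differentiable (at x)" if "x \<in> S" for x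
    using assms that bounded_linear.has_derivative unfolding C1_on_def differentiable_def by blast
  show "continuous_on S (partial j (\<lambda>y. L (f y)))" for j
    using bounded_linear.continuous_on[OF assms(2) C1_on_partial[OF assms(1), of j]]
    by (rule continuous_on_eq)
      (simp add: partial_bounded_linear[OF C1_on_differentiable[OF assms(1)] assms(2)])
qed

lemma C1_on_add:
  assumes "C1_on S f" "C1_on S g"
  shows "C1_on S (\<lambda>y. f y + g y)"
  unfolding C1_on_def
proof (intro conjI ballI allI)
  show "(\<lambda>y. f y + g y) differentiable (at x)" if "x \<in> S" for x
    using assms that by (auto simp: C1_on_def)
  show "continuous_on S (partial j (\<lambda>y. f y + g y))" for j
    by (rule continuous_on_eq[OF continuous_on_add[OF assms[THEN C1_on_partial, of j]]])
       (simp add: partial_add assms[THEN C1_on_differentiable])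
qed

lemma C1_on_mult:
  fixes f g :: "real^2 \<Rightarrow> 'b::real_normed_algebra"
  assumes "C1_on S f" "C1_on S g"
  shows "C1_on S (\<lambda>y. f y * g y)"
  unfolding C1_on_def
proof (intro conjI ballI allI)
  show "(\<lambda>y. f y * g y) differentiable (at x)" if "x \<in> S" for x
    using assms that by (auto simp: C1_on_def)
  have "continuous_on S (\<lambda>x. f x * partial j g x + partial j f x * g x)" for j
    using assms by (intro continuous_intros C1_on_continuous C1_on_partial)
  then show "continuous_on S (partial j (\<lambda>y. f y * g y))" for j
    by (rule continuous_on_eq) (simp add: partial_mult assms[THEN C1_on_differentiable])
qed

lemma C1_on_const: "C1_on S (\<lambda>_. c)"
  by (rule C1_onI[where f'="\<lambda>_ _. 0"]) auto

lemma C1_on_sum: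
  assumes "finite I" "\<And>i. i \<in> I \<Longrightarrow> C1_on S (f i)"
  shows "C1_on S (\<lambda>y. \<Sum>i\<in>I. f i y)"
  using assms by (induction rule: finite_induct) (auto intro: C1_on_add C1_on_const)

lemma C1_on_compose_real:
  fixes f :: "real^2 \<Rightarrow> real" and g :: "real \<Rightarrow> real"
  assumes f: "C1_on S f" and g: "\<And>t. (g has_real_derivative g' t) (at t)" and g': "continuous_on UNIV g'"
  shows "C1_on S (\<lambda>y. g (f y))"
    and "\<And>x. x \<in> S \<Longrightarrow> partial j (\<lambda>y. g (f y)) x = g' (f x) * partial j f x"
proof -
  have D: "((\<lambda>y. g (f y)) has_derivative (\<lambda>h. g' (f x) * frechet_derivative f (at x) h)) (at x)"
    if "x \<in> S" for x
    using has_derivative_compose[OF C1_on_differentiable[OF f that, THEN differentiable_frechet]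
        g[unfolded has_field_derivative_def]] by simp
  show "C1_on S (\<lambda>y. g (f y))"
  proof (rule C1_onI[OF D])
    show "continuous_on S (\<lambda>x. g' (f x) * frechet_derivative f (at x) (axis j 1))" for j
      using continuous_on_mult[OF continuous_on_compose2[OF g' C1_on_continuous[OF f]] C1_on_partial[OF f, of j]]
      by (simp add: partial_def)
  qed
  show "\<And>x. x \<in> S \<Longrightarrow> partial j (\<lambda>y. g (f y)) x = g' (f x) * partial j f x"
    using has_derivative_partial[OF D] by (simp add: partial_def)
qed

text \<open>Both mixed partials are limits of the second difference quotient of \<open>f\<close> on small squares.\<close>

lemma second_difference_mean_value:
  fixes f :: "real^2 \<Rightarrow> real"
  assumes S: "open S" and f: "C2_on S f"
    and h: "0 < h" "\<And>s t. s \<in> {0..h} \<Longrightarrow> t \<in> {0..h} \<Longrightarrow> x + s *\<^sub>R axis i 1 + t *\<^sub>R axis j 1 \<in> S"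
  obtains s t where "s \<in> {0..h}" "t \<in> {0..h}"
    "f (x + h *\<^sub>R axis i 1 + h *\<^sub>R axis j 1) - f (x + h *\<^sub>R axis i 1) - f (x + h *\<^sub>R axis j 1) + f x
      = h * (h * partial j (partial i f) (x + s *\<^sub>R axis i 1 + t *\<^sub>R axis j 1))"
proof -
  have D: "((\<lambda>t. g (y + t *\<^sub>R axis l 1)) has_real_derivative partial l g (y + t *\<^sub>R axis l 1)) (at t)"
    if "g differentiable (at (y + t *\<^sub>R axis l 1))" for y :: "real^2" and g :: "real^2 \<Rightarrow> real" and l t
  proof -
    have "((\<lambda>t. y + t *\<^sub>R axis l 1) has_derivative (\<lambda>t. t *\<^sub>R axis l 1)) (at t)"
      by (auto intro!: derivative_eq_intros)
    from has_derivative_compose[OF this differentiable_frechet[OF that]]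
    show ?thesis
      unfolding has_field_derivative_def partial_def
      by (rule has_derivative_eq_rhs)
        (simp add: fun_eq_iff linear_scale[OF has_derivative_linear[OF differentiable_frechet[OF that]]])
  qed
  let ?G = "\<lambda>s. f (x + h *\<^sub>R axis j 1 + s *\<^sub>R axis i 1) - f (x + s *\<^sub>R axis i 1)"
  have "\<exists>s. s > 0 \<and> s < h \<and> ?G h - ?G 0 = (h - 0) *
    (partial i f (x + h *\<^sub>R axis j 1 + s *\<^sub>R axis i 1) - partial i f (x + s *\<^sub>R axis i 1))"
  proof (rule MVT2[OF h(1)])
    fix s assume s: "0 \<le> s" "s \<le> h"
    have "x + s *\<^sub>R axis i 1 \<in> S" "x + h *\<^sub>R axis j 1 + s *\<^sub>R axis i 1 \<in> S"
      using h(2)[of s 0] h(2)[of s h] s h(1) by (auto simp: add_ac)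
    then show "(?G has_real_derivative partial i f (x + h *\<^sub>R axis j 1 + s *\<^sub>R axis i 1) - partial i f (x + s *\<^sub>R axis i 1)) (at s)"
      using f by (intro DERIV_diff D) (auto simp: C2_on_def C1_on_def)
  qed
  then obtain s where s: "0 < s" "s < h" "?G h - ?G 0 = h *
    (partial i f (x + h *\<^sub>R axis j 1 + s *\<^sub>R axis i 1) - partial i f (x + s *\<^sub>R axis i 1))" by auto
  have "\<exists>t. t > 0 \<and> t < h \<and> partial i f (x + s *\<^sub>R axis i 1 + h *\<^sub>R axis j 1) - partial i f (x + s *\<^sub>R axis i 1 + 0 *\<^sub>R axis j 1)
     = (h - 0) * partial j (partial i f) (x + s *\<^sub>R axis i 1 + t *\<^sub>R axis j 1)"
    using f h(2)[of s] s by (intro MVT2[OF h(1)] D) (auto simp: C2_on_def C1_on_def)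
  then obtain t where "0 < t" "t < h" "partial i f (x + s *\<^sub>R axis i 1 + h *\<^sub>R axis j 1) - partial i f (x + s *\<^sub>R axis i 1)
     = h * partial j (partial i f) (x + s *\<^sub>R axis i 1 + t *\<^sub>R axis j 1)" by auto
  with s show thesis
    by (intro that[of s t]) (simp_all add: add_ac algebra_simps)
qed

lemma partial_commute_real:
  fixes f :: "real^2 \<Rightarrow> real"
  assumes S: "open S" and f: "C2_on S f" and x: "x \<in> S"
  shows "partial i (partial j f) x = partial j (partial i f) x"
proof (rule ccontr)
  assume ne: "partial i (partial j f) x \<noteq> partial j (partial i f) x"
  define e where "e = \<bar>partial i (partial j f) x - partial j (partial i f) x\<bar> / 2"
  have e: "e > 0" using ne by (simp add: e_def)
  have c: "continuous_on S (partial i (partial j f))" "continuous_on S (partial j (partial i f))"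
    using f by (auto simp: C2_on_def C1_on_def)
  obtain d1 where d1: "d1 > 0" "\<And>y. y \<in> S \<Longrightarrow> dist y x < d1 \<Longrightarrow> dist (partial i (partial j f) y) (partial i (partial j f) x) < e"
    using c(1) x e unfolding continuous_on_iff by blast
  obtain d2 where d2: "d2 > 0" "\<And>y. y \<in> S \<Longrightarrow> dist y x < d2 \<Longrightarrow> dist (partial j (partial i f) y) (partial j (partial i f) x) < e"
    using c(2) x e unfolding continuous_on_iff by blast
  obtain d3 where d3: "d3 > 0" "ball x d3 \<subseteq> S" using S x openE by blast
  \<comment> \<open>All points of the square with side \<open>h\<close> lie within 2h of
    \<open>x\<close>; a third of the smallest radius keeps 2h strictly below each of the
    three.\<close>
  define h where "h = min d1 (min d2 d3) / 3"
  have h: "h > 0" "2 * h < d1" "2 * h < d2" "2 * h < d3" using d1 d2 d3 by (auto simp: h_def)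
  have near: "dist (x + s *\<^sub>R axis k 1 + t *\<^sub>R axis l 1) x \<le> 2 * h"
    if "s \<in> {0..h}" "t \<in> {0..h}" for s t k l
  proof -
    have "norm (s *\<^sub>R axis k 1 + t *\<^sub>R axis l (1::real)) \<le> \<bar>s\<bar> * 1 + \<bar>t\<bar> * 1"
      by (rule order_trans[OF norm_triangle_ineq]) (simp add: norm_axis_1)
    then show ?thesis using that by (simp add: dist_norm add.assoc)
  qed
  have inS: "x + s *\<^sub>R axis k 1 + t *\<^sub>R axis l 1 \<in> S" if "s \<in> {0..h}" "t \<in> {0..h}" for s t k l
    using near[OF that, of k l] h d3 by (auto simp: dist_commute subset_iff)
  obtain s t where st: "s \<in> {0..h}" "t \<in> {0..h}"
    "f (x + h *\<^sub>R axis i 1 + h *\<^sub>R axis j 1) - f (x + h *\<^sub>R axis i 1) - f (x + h *\<^sub>R axis j 1) + f x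
      = h * (h * partial j (partial i f) (x + s *\<^sub>R axis i 1 + t *\<^sub>R axis j 1))"
    by (rule second_difference_mean_value[OF S f h(1) inS, of i j])
  obtain s' t' where st': "s' \<in> {0..h}" "t' \<in> {0..h}"
    "f (x + h *\<^sub>R axis j 1 + h *\<^sub>R axis i 1) - f (x + h *\<^sub>R axis j 1) - f (x + h *\<^sub>R axis i 1) + f x
      = h * (h * partial i (partial j f) (x + s' *\<^sub>R axis j 1 + t' *\<^sub>R axis i 1))"
    by (rule second_difference_mean_value[OF S f h(1) inS, of j i])
  \<comment> \<open>The second difference is symmetric in \<open>i\<close> and \<open>j\<close>, so
    the two mean value expressions agree exactly, not just in the limit.\<close>
  have "h * (h * partial j (partial i f) (x + s *\<^sub>R axis i 1 + t *\<^sub>R axis j 1))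
     = h * (h * partial i (partial j f) (x + s' *\<^sub>R axis j 1 + t' *\<^sub>R axis i 1))"
    unfolding st(3)[symmetric] st'(3)[symmetric] by (simp add: add_ac)
  then have eq: "partial j (partial i f) (x + s *\<^sub>R axis i 1 + t *\<^sub>R axis j 1)
     = partial i (partial j f) (x + s' *\<^sub>R axis j 1 + t' *\<^sub>R axis i 1)" using h(1) by simp
  have "dist (partial j (partial i f) (x + s *\<^sub>R axis i 1 + t *\<^sub>R axis j 1)) (partial j (partial i f) x) < e"
    by (rule d2(2)) (use inS near[of s t i j] st h in auto)
  moreover have "dist (partial i (partial j f) (x + s' *\<^sub>R axis j 1 + t' *\<^sub>R axis i 1)) (partial i (partial j f) x) < e"
    by (rule d1(2)) (use inS near[of s' t' j i] st' h in auto)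
  ultimately show False unfolding eq dist_real_def e_def by (simp add: abs_if split: if_splits)
qed

lemma C2_on_bounded_linear:
  assumes "open S" "C2_on S f" "bounded_linear L"
  shows "C2_on S (\<lambda>y. L (f y))"
  unfolding C2_on_def
proof (intro conjI allI)
  show "C1_on S (\<lambda>y. L (f y))" using assms C1_on_bounded_linear C2_on_imp_C1_on by blast
  show "C1_on S (partial j (\<lambda>y. L (f y)))" for j
    by (rule C1_on_cong[OF assms(1) _ C1_on_bounded_linear[OF C2_on_partial[OF assms(2), of j] assms(3)]])
      (simp add: partial_bounded_linear[OF C1_on_differentiable[OF C2_on_imp_C1_on[OF assms(2)]] assms(3)])
qed

lemma partial_partial_bounded_linear:
  assumes "open S" "C2_on S f" "bounded_linear L" "x \<in> S"
  shows "partial i (partial j (\<lambda>y. L (f y))) x = L (partial i (partial j f) x)"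
proof -
  have "partial i (partial j (\<lambda>y. L (f y))) x = partial i (\<lambda>y. L (partial j f y)) x"
    by (rule partial_cong[OF assms(1,4)])
      (simp add: partial_bounded_linear[OF C1_on_differentiable[OF C2_on_imp_C1_on[OF assms(2)]] assms(3)])
  also have "\<dots> = L (partial i (partial j f) x)"
    by (rule partial_bounded_linear[OF C1_on_differentiable[OF C2_on_partial[OF assms(2)] assms(4)] assms(3)])
  finally show ?thesis .
qed

lemma partial_commute:
  fixes f :: "real^2 \<Rightarrow> complex"
  assumes "open S" "C2_on S f" "x \<in> S"
  shows "partial i (partial j f) x = partial j (partial i f) x"
proof -
  have "L (partial i (partial j f) x) = L (partial j (partial i f) x)"
    if "bounded_linear L" for L :: "complex \<Rightarrow> real"
    using partial_commute_real[OF assms(1) C2_on_bounded_linear[OF assms(1,2) that] assms(3)]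
    by (simp add: partial_partial_bounded_linear[OF assms(1,2) that assms(3)])
  from this[OF bounded_linear_Re] this[OF bounded_linear_Im] show ?thesis by (simp add: complex_eqI)
qed

section \<open>Integration by parts\<close>

lemma has_vector_derivative_along_axis:
  fixes F :: "real^2 \<Rightarrow> 'b::real_normed_vector"
  assumes "F differentiable (at (x + t *\<^sub>R axis j 1))"
  shows "((\<lambda>t. F (x + t *\<^sub>R axis j 1)) has_vector_derivative partial j F (x + t *\<^sub>R axis j 1)) (at t)"
proof -
  have "((\<lambda>t. x + t *\<^sub>R axis j 1) has_derivative (\<lambda>t. t *\<^sub>R axis j 1)) (at t)"
    by (auto intro!: derivative_eq_intros)
  from has_derivative_compose[OF this differentiable_frechet[OF assms]]
  show ?thesis
    unfolding has_vector_derivative_def partial_def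
    by (rule has_derivative_eq_rhs)
      (simp add: fun_eq_iff linear_scale[OF has_derivative_linear[OF differentiable_frechet[OF assms]]])
qed

lemma continuous_compact_support_integrable:
  fixes f :: "'a::euclidean_space \<Rightarrow> 'b::euclidean_space"
  assumes "compact K" "continuous_on K f" "\<And>x. x \<notin> K \<Longrightarrow> f x = 0"
  shows "integrable lborel f"
proof -
  have "(\<lambda>x. indicator K x *\<^sub>R f x) = f"
    using assms(3) by (auto simp: fun_eq_iff indicator_def)
  then show ?thesis using borel_integrable_compact[OF assms(1,2)] by simp
qed

text \<open>By translation invariance every difference quotient of \<open>F\<close> has integral 0.
  The mean value theorem bounds the quotients by sup |partial j F|, and dominated convergence passes
  to the derivative.\<close>

lemma integral_partial_UNIV:
  fixes F :: "real^2 \<Rightarrow> complex"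
  assumes F: "C1_on UNIV F" and K: "compact K" and z: "\<And>x. x \<notin> K \<Longrightarrow> F x = 0"
  shows "integral\<^sup>L lborel (partial j F) = 0"
proof -
  let ?e = "axis j 1 :: real^2"
  let ?G = "partial j F"
  have contG: "continuous_on UNIV ?G" using C1_on_partial[OF F] .
  have contF: "continuous_on UNIV F" using C1_on_continuous[OF F] .
  have zG: "?G x = 0" if "x \<notin> K" for x
  proof -
    have "?G x = partial j (\<lambda>_. 0) x"
      by (rule partial_cong[of "- K"]) (use that z K compact_imp_closed in auto)
    also have "\<dots> = 0" by (rule has_derivative_partial) auto
    finally show ?thesis .
  qed
  obtain B where B: "\<And>x. x \<in> K \<Longrightarrow> norm (?G x) \<le> B" "B \<ge> 0"
  proof -
    have "bounded (?G ` K)"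
      using compact_continuous_image[OF continuous_on_subset[OF contG] K] compact_imp_bounded by blast
    then obtain b where "\<forall>y\<in>?G ` K. norm y \<le> b" unfolding bounded_iff by blast
    then show thesis by (intro that[of "max b 0"]) (auto simp: le_max_iff_disj)
  qed
  have B': "norm (?G x) \<le> B" for x using B zG by (cases "x \<in> K") auto
  define h where "h n = 1 / (real n + 1)" for n
  have h: "0 < h n" "h n \<le> 1" for n by (auto simp: h_def)
  \<comment> \<open>The closed 1-neighbourhood of \<open>K\<close> contains the supports of all
    quotients \<open>D n\<close>, because \<open>h n \<le> 1\<close>.\<close>
  define K' where "K' = {x + y |x y. x \<in> K \<and> y \<in> cball 0 1}"
  have K': "compact K'" unfolding K'_def by (rule compact_sums[OF K compact_cball])
  define D where "D n x = (F (x + h n *\<^sub>R ?e) - F x) /\<^sub>R h n" for n x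
  have lip: "norm (F (x + t *\<^sub>R ?e) - F x) \<le> B * t" if "t \<ge> 0" for x t
  proof -
    have "norm (F (x + t *\<^sub>R ?e) - F (x + 0 *\<^sub>R ?e)) \<le> B * norm (t - 0)"
    proof (rule differentiable_bound[where S=UNIV and f="\<lambda>t. F (x + t *\<^sub>R ?e)"])
      show "((\<lambda>t. F (x + t *\<^sub>R ?e)) has_derivative (\<lambda>s. s *\<^sub>R ?G (x + t *\<^sub>R ?e))) (at t within UNIV)" for t
        using has_vector_derivative_along_axis[of F x t j] C1_on_differentiable[OF F]
        by (auto simp: has_vector_derivative_def)
      show "onorm (\<lambda>s. s *\<^sub>R ?G (x + t *\<^sub>R ?e)) \<le> B" for t
        by (rule onorm_le) (use mult_right_mono[OF B', of "\<bar>_\<bar>"] in \<open>simp add: mult.commute\<close>)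
    qed auto
    then show ?thesis using that by simp
  qed
  have "(\<lambda>n. integral\<^sup>L lborel (D n)) \<longlonglongrightarrow> integral\<^sup>L lborel ?G"
  proof (rule integral_dominated_convergence[where w="\<lambda>x. B * indicator K' x"])
    show "?G \<in> borel_measurable lborel" using contG borel_measurable_continuous_onI by simp
    show "D n \<in> borel_measurable lborel" for n
    proof -
      have "continuous_on UNIV (D n)" unfolding D_def
        by (intro continuous_intros continuous_on_compose2[OF contF]) auto
      then show ?thesis using borel_measurable_continuous_onI by simp
    qed
    show "integrable lborel (\<lambda>x. B * indicator K' x)"
      using K' emeasure_bounded_finite[OF compact_imp_bounded[OF K']]
      by (intro integrable_mult_right integrable_real_indicator)
        (auto simp: compact_imp_closed borel_closed top.not_eq_extremum infinity_ennreal_def)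
    show "AE x in lborel. (\<lambda>n. D n x) \<longlonglongrightarrow> ?G x"
    proof (rule AE_I2)
      fix x
      have "((\<lambda>t. F (x + t *\<^sub>R ?e)) has_vector_derivative ?G (x + 0 *\<^sub>R ?e)) (at 0)"
        by (rule has_vector_derivative_along_axis) (use C1_on_differentiable[OF F] in auto)
      then have "((\<lambda>t. norm (F (x + t *\<^sub>R ?e) - F x - t *\<^sub>R ?G x) / norm t) \<longlongrightarrow> 0) (at 0)"
        by (simp add: has_vector_derivative_def has_derivative_at)
      then have "((\<lambda>t. norm ((F (x + t *\<^sub>R ?e) - F x) /\<^sub>R t - ?G x)) \<longlongrightarrow> 0) (at 0)"
      proof (rule Lim_transform_eventually)
        have "norm (F (x + t *\<^sub>R ?e) - F x - t *\<^sub>R ?G x) / norm t = norm ((F (x + t *\<^sub>R ?e) - F x) /\<^sub>R t - ?G x)"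
          if "t \<noteq> 0" for t
        proof -
          have "(F (x + t *\<^sub>R ?e) - F x) /\<^sub>R t - ?G x = (F (x + t *\<^sub>R ?e) - F x - t *\<^sub>R ?G x) /\<^sub>R t"
            using that by (simp add: algebra_simps)
          then show ?thesis by (simp add: divide_inverse mult.commute)
        qed
        then show "\<forall>\<^sub>F t in at 0. norm (F (x + t *\<^sub>R ?e) - F x - t *\<^sub>R ?G x) / norm t
          = norm ((F (x + t *\<^sub>R ?e) - F x) /\<^sub>R t - ?G x)"
          by (auto simp: eventually_at_filter)
      qed
      then have "((\<lambda>t. (F (x + t *\<^sub>R ?e) - F x) /\<^sub>R t) \<longlongrightarrow> ?G x) (at 0)"
        using LIM_zero_iff tendsto_norm_zero_iff by blast
      moreover have "filterlim h (at 0) sequentially"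
        unfolding filterlim_at h_def
        using LIMSEQ_inverse_real_of_nat
        by (auto intro!: always_eventually simp: inverse_eq_divide add.commute)
      ultimately show "(\<lambda>n. D n x) \<longlonglongrightarrow> ?G x"
        unfolding D_def by (rule filterlim_compose)
    qed
    show "AE x in lborel. norm (D n x) \<le> B * indicator K' x" for n
    proof (rule AE_I2)
      fix x
      show "norm (D n x) \<le> B * indicator K' x"
      proof (cases "x \<in> K'")
        case True
        have "norm (D n x) = norm (F (x + h n *\<^sub>R ?e) - F x) / h n"
          using h(1)[of n] by (simp add: D_def divide_inverse_commute)
        then show ?thesis using lip[of "h n" x] h(1)[of n] True by (simp add: pos_divide_le_eq)
      next
        case False
        have "x \<notin> K" using False by (force simp: K'_def)
        moreover have "x + h n *\<^sub>R ?e \<notin> K"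
        proof
          assume a: "x + h n *\<^sub>R ?e \<in> K"
          have "x = (x + h n *\<^sub>R ?e) + (- (h n *\<^sub>R ?e))" by simp
          moreover have "- (h n *\<^sub>R ?e) \<in> cball 0 1" using h[of n] by (simp add: norm_axis_1)
          ultimately have "x \<in> K'" using a unfolding K'_def by blast
          then show False using False by simp
        qed
        ultimately show ?thesis using False z by (simp add: D_def)
      qed
    qed
  qed
  moreover have "integral\<^sup>L lborel (D n) = 0" for n
  proof -
    have i: "integrable lborel F"
      using K contF z by (intro continuous_compact_support_integrable[of K]) (auto intro: continuous_on_subset)
    have d: "distr lborel borel (\<lambda>x. h n *\<^sub>R ?e + x) = lborel" by (rule lborel_distr_plus)
    have m: "(\<lambda>x. h n *\<^sub>R ?e + x) \<in> measurable lborel borel" by measurable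
    have Fm: "F \<in> borel_measurable borel" using contF borel_measurable_continuous_onI by blast
    have i': "integrable lborel (\<lambda>x. F (h n *\<^sub>R ?e + x))"
      using i integrable_distr_eq[OF m Fm] by (simp add: d)
    have "integral\<^sup>L lborel (\<lambda>x. F (h n *\<^sub>R ?e + x)) = integral\<^sup>L lborel F"
      using integral_distr[OF m Fm] by (simp add: d)
    then show ?thesis unfolding D_def using i i' by (simp add: add.commute)
  qed
  ultimately show ?thesis by (simp add: LIMSEQ_unique)
qed

text \<open>Values of \<open>f\<close> off \<open>E\<close> are arbitrary, so \<open>f\<close> is
  first extended by 0. The extension is C^1 on \<open>E\<close> and on the complement of
  \<open>K\<close>, two open sets that cover the plane.\<close>

theorem integral_partial_compact_support:
  fixes f :: "real^2 \<Rightarrow> complex"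
  assumes E: "open E" and f: "C1_on E f" and K: "compact K" "K \<subseteq> E"
    and z: "\<And>x. x \<in> E \<Longrightarrow> x \<notin> K \<Longrightarrow> f x = 0"
  shows "integrable lborel (\<lambda>x. indicator E x *\<^sub>R partial j f x)"
    and "(\<integral>x. indicator E x *\<^sub>R partial j f x \<partial>lborel) = 0"
proof -
  define F where "F x = (if x \<in> E then f x else 0)" for x
  have oK: "open (- K)" using K compact_imp_closed by auto
  have pF: "partial j F x = indicator E x *\<^sub>R partial j f x" for j x
  proof (cases "x \<in> E")
    case True
    then have "partial j F x = partial j f x"
      by (intro partial_cong[OF E]) (auto simp: F_def)
    then show ?thesis using True by simp
  next
    case False
    have "partial j F x = partial j (\<lambda>_. 0) x"
      by (rule partial_cong[OF oK]) (use False K z in \<open>auto simp: F_def\<close>)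
    also have "\<dots> = 0" by (rule has_derivative_partial) auto
    finally show ?thesis using False by simp
  qed
  have C1E: "C1_on E F" by (rule C1_on_cong[OF E _ f]) (simp add: F_def)
  have C1K: "C1_on (- K) F"
    by (rule C1_on_cong[OF oK _ C1_on_const[of _ 0]]) (use z in \<open>auto simp: F_def\<close>)
  have un: "E \<union> - K = UNIV" using K by auto
  have C1: "C1_on UNIV F"
    unfolding C1_on_def
  proof (intro conjI ballI allI)
    show "F differentiable (at x)" for x
      using C1E C1K un C1_on_differentiable by blast
    show "continuous_on UNIV (partial j F)" for j
      using continuous_on_open_Un[OF E oK C1_on_partial[OF C1E] C1_on_partial[OF C1K]] un by simp
  qed
  have z': "F x = 0" if "x \<notin> K" for x using z that by (auto simp: F_def)
  have "integral\<^sup>L lborel (partial j F) = 0"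
    by (rule integral_partial_UNIV[OF C1 K(1) z'])
  then show "(\<integral>x. indicator E x *\<^sub>R partial j f x \<partial>lborel) = 0"
    by (simp add: pF[abs_def])
  have "partial j F x = 0" if "x \<notin> K" for x
  proof -
    have "partial j F x = partial j (\<lambda>_. 0) x"
      by (rule partial_cong[OF oK]) (use that z' in auto)
    also have "\<dots> = 0" by (rule has_derivative_partial) auto
    finally show ?thesis .
  qed
  then have "integrable lborel (partial j F)"
    using C1_on_partial[OF C1] K by (intro continuous_compact_support_integrable[of K])
      (auto intro: continuous_on_subset)
  then show "integrable lborel (\<lambda>x. indicator E x *\<^sub>R partial j f x)"
    by (simp add: pF[abs_def])
qed

section \<open>Cutoff and truncation functions\<close>

text \<open>A C^1 substitute for smooth cutoffs: only first derivatives of cutoff and truncation are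
  ever taken.\<close>

definition possq :: "real \<Rightarrow> real" where "possq t = (max 0 t)\<^sup>2"

lemma possq_derivative: "(possq has_real_derivative 2 * max 0 t) (at t)"
proof -
  consider "t < 0" | "t = 0" | "t > 0" by linarith
  then show ?thesis
  proof cases
    case 1
    have "((\<lambda>_. 0) has_real_derivative 0) (at t)" by simp
    then have "(possq has_real_derivative 0) (at t)"
      by (rule has_field_derivative_transform_within_open[of _ _ _ "{..<0}"])
        (use 1 in \<open>auto simp: possq_def\<close>)
    then show ?thesis using 1 by simp
  next
    case 3
    have "((\<lambda>t. t\<^sup>2) has_real_derivative 2 * t) (at t)" by (auto intro!: derivative_eq_intros)
    then have "(possq has_real_derivative 2 * t) (at t)"
      by (rule has_field_derivative_transform_within_open[of _ _ _ "{0<..}"])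
        (use 3 in \<open>auto simp: possq_def\<close>)
    then show ?thesis using 3 by simp
  next
    case 2
    have "((\<lambda>h. (possq (0 + h) - possq 0) / h) \<longlongrightarrow> 0) (at 0)"
    proof (rule Lim_null_comparison)
      show "\<forall>\<^sub>F h in at 0. norm ((possq (0 + h) - possq 0) / h) \<le> \<bar>h\<bar>"
        by (auto simp: possq_def power2_eq_square max_def intro!: always_eventually)
      show "((\<lambda>h::real. \<bar>h\<bar>) \<longlongrightarrow> 0) (at 0)" by (rule tendsto_rabs_zero) simp
    qed
    then show ?thesis using 2 by (simp add: DERIV_def)
  qed
qed

lemma possq_nonneg: "0 \<le> possq t" by (simp add: possq_def)

text \<open>The cutoff is a square so that its gradient is O(1/R) times its root; Young's inequality
  can then absorb gradient terms into \<open>eta\<close> |grad u|^2. Being a function of |x|^2, it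
  has a gradient parallel to x, which later produces the traction.\<close>

definition eta :: "real \<Rightarrow> real^2 \<Rightarrow> real" where
  "eta R x = possq (1 - (norm x)\<^sup>2 / R\<^sup>2)"

definition eta_root :: "real \<Rightarrow> real^2 \<Rightarrow> real" where
  "eta_root R x = max 0 (1 - (norm x)\<^sup>2 / R\<^sup>2)"

lemma eta_eq: "eta R x = (eta_root R x)\<^sup>2"
  by (simp add: eta_def eta_root_def possq_def)

lemma eta_root_bounds: "0 \<le> eta_root R x" "eta_root R x \<le> 1"
  by (auto simp: eta_root_def)

lemma eta_bounds: "0 \<le> eta R x" "eta R x \<le> 1"
  using eta_root_bounds[of R x] by (auto simp: eta_eq power_le_one)

lemma eta_root_outside: "R > 0 \<Longrightarrow> norm x \<ge> R \<Longrightarrow> eta_root R x = 0"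
  by (simp add: eta_root_def power_mono)

lemma eta_root_inside:
  assumes "R > 0" "2 * norm x \<le> R" shows "eta_root R x \<ge> 3/4"
proof -
  have "(2 * norm x)\<^sup>2 \<le> R\<^sup>2" using assms by (intro power_mono) auto
  then have "(norm x)\<^sup>2 / R\<^sup>2 \<le> 1/4" using assms by (simp add: field_simps power_mult_distrib)
  then have "3 / 4 \<le> 1 - (norm x)\<^sup>2 / R\<^sup>2" by linarith
  then show ?thesis by (simp add: eta_root_def le_max_iff_disj)
qed

lemma norm_sq_C1:
  shows "C1_on UNIV (\<lambda>x::real^2. a - (norm x)\<^sup>2 / c)"
    and "partial j (\<lambda>x::real^2. a - (norm x)\<^sup>2 / c) x = - 2 * x $ j / c"
proof -
  have D: "((\<lambda>x::real^2. a - (norm x)\<^sup>2 / c) has_derivative (\<lambda>h. - 2 * (x \<bullet> h) / c)) (at x)" for x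
    unfolding power2_norm_eq_inner divide_inverse
    by (auto intro!: derivative_eq_intros simp: inner_commute algebra_simps)
  show "C1_on UNIV (\<lambda>x::real^2. a - (norm x)\<^sup>2 / c)"
    by (rule C1_onI[OF D]) (auto simp: divide_inverse intro!: continuous_intros)
  show "partial j (\<lambda>x::real^2. a - (norm x)\<^sup>2 / c) x = - 2 * x $ j / c"
    by (subst has_derivative_partial[OF D]) (simp add: inner_axis)
qed

lemma eta_C1: "C1_on UNIV (eta R)"
  and partial_eta: "partial j (eta R) x = - (4 / R\<^sup>2) * eta_root R x * x $ j"
proof -
  have c: "continuous_on UNIV (\<lambda>t::real. 2 * max 0 t)" by (intro continuous_intros)
  note L = C1_on_compose_real[OF norm_sq_C1(1) possq_derivative c]
  show "C1_on UNIV (eta R)"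
    using L(1) unfolding eta_def[abs_def] .
  show "partial j (eta R) x = - (4 / R\<^sup>2) * eta_root R x * x $ j"
    using L(2)[of x] norm_sq_C1(2) unfolding eta_def[abs_def] eta_root_def by simp
qed

lemma partial_eta_bound:
  assumes "R > 0" shows "\<bar>partial j (eta R) x\<bar> \<le> 4 / R * eta_root R x"
proof (cases "norm x < R")
  case True
  have "\<bar>x $ j\<bar> \<le> R" using component_le_norm_cart[of x j] True by linarith
  then have "\<bar>partial j (eta R) x\<bar> \<le> (4 / R\<^sup>2) * eta_root R x * R"
    unfolding partial_eta abs_mult using eta_root_bounds[of R x] by (intro mult_mono) auto
  also have "\<dots> = 4 / R * eta_root R x" using assms by (simp add: power2_eq_square)
  finally show ?thesis .
next
  case False
  then show ?thesis using eta_root_outside[OF assms, of x] by (simp add: partial_eta)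
qed

text \<open>The truncation satisfies \<open>s trunc' \<epsilon> s \<le> 4\<close> uniformly in \<open>\<epsilon>\<close>; this is what allows
  truncating by \<open>|u|\<^sup>2\<close> although it destroys the divergence-free condition.\<close>

definition trunc :: "real \<Rightarrow> real \<Rightarrow> real" where
  "trunc \<epsilon> s = possq (s - \<epsilon>) / (possq (s - \<epsilon>) + \<epsilon>\<^sup>2)"

definition trunc' :: "real \<Rightarrow> real \<Rightarrow> real" where
  "trunc' \<epsilon> s = 2 * max 0 (s - \<epsilon>) * \<epsilon>\<^sup>2 / (possq (s - \<epsilon>) + \<epsilon>\<^sup>2)\<^sup>2"

context
  fixes \<epsilon> :: real
  assumes \<epsilon>: "\<epsilon> > 0"
begin

lemma trunc_denominator: "possq t + \<epsilon>\<^sup>2 > 0"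
  using \<epsilon> possq_nonneg[of t] by (simp add: add_nonneg_pos)

lemma trunc_derivative: "(trunc \<epsilon> has_real_derivative trunc' \<epsilon> s) (at s)"
proof -
  have "((\<lambda>s. possq (s - \<epsilon>)) has_real_derivative 2 * max 0 (s - \<epsilon>)) (at s)"
  proof -
    have "((\<lambda>s. s - \<epsilon>) has_real_derivative 1) (at s)" by (auto intro!: derivative_eq_intros)
    from DERIV_chain2[OF possq_derivative this] show ?thesis by simp
  qed
  then show ?thesis
    unfolding trunc_def[abs_def] trunc'_def using trunc_denominator[of "s - \<epsilon>"]
    by (auto intro!: derivative_eq_intros simp: power2_eq_square algebra_simps)
qed

lemma continuous_possq: "continuous_on UNIV possq"
  unfolding possq_def[abs_def] by (intro continuous_intros)

lemma trunc'_continuous: "continuous_on UNIV (trunc' \<epsilon>)"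
proof -
  have "(possq (s - \<epsilon>) + \<epsilon>\<^sup>2)\<^sup>2 \<noteq> 0" for s using trunc_denominator[of "s - \<epsilon>"] by simp
  then show ?thesis
    unfolding trunc'_def[abs_def]
    by (intro continuous_intros continuous_on_compose2[OF continuous_possq]) auto
qed

lemma trunc_bounds: "0 \<le> trunc \<epsilon> s" "trunc \<epsilon> s \<le> 1"
  using trunc_denominator[of "s - \<epsilon>"] possq_nonneg[of "s - \<epsilon>"] by (auto simp: trunc_def divide_simps)

lemma trunc_small: "s \<le> \<epsilon> \<Longrightarrow> trunc \<epsilon> s = 0" "s \<le> \<epsilon> \<Longrightarrow> trunc' \<epsilon> s = 0"
  by (auto simp: trunc_def trunc'_def possq_def)

lemma trunc'_nonneg: "0 \<le> trunc' \<epsilon> s"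
  by (simp add: trunc'_def)

lemma trunc'_bound: "s * trunc' \<epsilon> s \<le> 4"
proof (cases "s \<le> \<epsilon>")
  case False
  define m where "m = s - \<epsilon>"
  have m: "m > 0" "s = m + \<epsilon>" using False by (auto simp: m_def)
  \<comment> \<open>With m = s - \<epsilon>, one power of the squared denominator must beat s * 2m =
    2m^2 + 2m\<epsilon>, the other beats \<epsilon>^2.\<close>
  have "2 * (m * \<epsilon>) \<le> m\<^sup>2 + \<epsilon>\<^sup>2" using sum_squares_bound[of m \<epsilon>] by simp
  then have "2 * m\<^sup>2 + 2 * (m * \<epsilon>) \<le> 4 * (m\<^sup>2 + \<epsilon>\<^sup>2)"
    using zero_le_power2[of \<epsilon>] zero_le_power2[of m] unfolding distrib_left by linarith
  moreover have "(m + \<epsilon>) * (2 * m) = 2 * m\<^sup>2 + 2 * (m * \<epsilon>)" by (simp add: power2_eq_square algebra_simps)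
  ultimately have "(m + \<epsilon>) * (2 * m) \<le> 4 * (m\<^sup>2 + \<epsilon>\<^sup>2)" by simp
  then have "(m + \<epsilon>) * (2 * m) * \<epsilon>\<^sup>2 \<le> (4 * (m\<^sup>2 + \<epsilon>\<^sup>2)) * (m\<^sup>2 + \<epsilon>\<^sup>2)"
    by (rule mult_mono) auto
  also have "\<dots> = 4 * (m\<^sup>2 + \<epsilon>\<^sup>2)\<^sup>2" by (simp only: power2_eq_square[of "m\<^sup>2 + \<epsilon>\<^sup>2"] mult.assoc)
  finally have "(m + \<epsilon>) * (2 * m) * \<epsilon>\<^sup>2 \<le> 4 * (m\<^sup>2 + \<epsilon>\<^sup>2)\<^sup>2" .
  moreover have "(m\<^sup>2 + \<epsilon>\<^sup>2)\<^sup>2 > 0" using \<epsilon> m by (simp add: add_pos_pos)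
  ultimately show ?thesis
    unfolding trunc'_def possq_def m(2) using m(1) by (simp add: divide_simps mult.assoc)
qed (simp add: trunc_small)

end

text \<open>Both limits are only pointwise for s > 0; near s = 0 the uniform bound on s
  \<open>trunc'\<close> has to do the work.\<close>

lemma trunc_limits:
  assumes "s > 0"
  shows "(\<lambda>n. trunc (1 / real (Suc n)) s) \<longlonglongrightarrow> 1" "(\<lambda>n. trunc' (1 / real (Suc n)) s) \<longlonglongrightarrow> 0"
proof -
  have e: "(\<lambda>n. 1 / real (Suc n)) \<longlonglongrightarrow> 0"
    using LIMSEQ_inverse_real_of_nat by (simp add: inverse_eq_divide)
  have q: "(\<lambda>n. possq (s - 1 / real (Suc n))) \<longlonglongrightarrow> possq (s - 0)"
    unfolding possq_def by (intro tendsto_intros e)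
  have p: "possq (s - 0) + 0\<^sup>2 > 0" using assms by (simp add: possq_def)
  have "(\<lambda>n. trunc (1 / real (Suc n)) s) \<longlonglongrightarrow> possq (s - 0) / (possq (s - 0) + 0\<^sup>2)"
    unfolding trunc_def using p by (intro tendsto_intros q e) auto
  then show "(\<lambda>n. trunc (1 / real (Suc n)) s) \<longlonglongrightarrow> 1" using p by simp
  have "(\<lambda>n. trunc' (1 / real (Suc n)) s) \<longlonglongrightarrow> 2 * max 0 (s - 0) * 0\<^sup>2 / (possq (s - 0) + 0\<^sup>2)\<^sup>2"
    unfolding trunc'_def using p by (intro tendsto_intros q e) auto
  then show "(\<lambda>n. trunc' (1 / real (Suc n)) s) \<longlonglongrightarrow> 0" by simp
qed

section \<open>Truncated energy identities\<close>

text \<open>The coefficient is a free \<open>\<kappa>\<close> rather than k^2 because the theory is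
  applied twice: to the given flow, and to its velocity with zero pressure and
  \<open>\<kappa> = 0\<close> once the vorticity is gone.\<close>

locale stokes_flow =
  fixes E :: "(real^2) set" and u :: "real^2 \<Rightarrow> complex^2" and p :: "real^2 \<Rightarrow> complex" and \<kappa> :: complex
  assumes open_E: "open E"
    and C2_u: "C2_on E u" and C1_p: "C1_on E p"
    and cont_u: "continuous_on (closure E) u" and cont_p: "continuous_on (closure E) p"
    and momentum: "\<And>x. x \<in> E \<Longrightarrow> - laplacian u x + grad p x = \<kappa> *s u x"
    and div_free: "\<And>x. x \<in> E \<Longrightarrow> divergence u x = 0"
    and dirichlet: "\<And>x. x \<in> frontier E \<Longrightarrow> u x = 0"
begin

definition du :: "2 \<Rightarrow> 2 \<Rightarrow> real^2 \<Rightarrow> complex" where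
  "du i j = partial j (\<lambda>y. u y $ i)"

definition du_norm :: "real^2 \<Rightarrow> real" where
  "du_norm x = sqrt (\<Sum>i\<in>UNIV. \<Sum>j\<in>UNIV. (cmod (du i j x))\<^sup>2)"

text \<open>Energy integrals run over this open set: as \<epsilon> tends to 0,
  \<open>trunc \<epsilon> (|u|^2)\<close> tends to its indicator, so the limit identity says nothing
  about the gradient on the zero set of \<open>u\<close>.\<close>

definition supp_u :: "(real^2) set" where
  "supp_u = {x \<in> E. u x \<noteq> 0}"

lemma bounded_linear_component: "bounded_linear (\<lambda>y::complex^2. y $ i)"
  by (rule bounded_linear_vec_nth)

lemma C2_component: "C2_on E (\<lambda>y. u y $ i)"
  by (rule C2_on_bounded_linear[OF open_E C2_u bounded_linear_component])

lemma C1_component: "C1_on E (\<lambda>y. u y $ i)"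
  using C2_component C2_on_imp_C1_on by blast

lemma C1_du: "C1_on E (du i j)"
  unfolding du_def using C2_component C2_on_partial by blast

lemmas differentiable_component = C1_on_differentiable[OF C1_component]
lemmas differentiable_du = C1_on_differentiable[OF C1_du]
lemmas differentiable_p = C1_on_differentiable[OF C1_p]

lemma div_free_du: "x \<in> E \<Longrightarrow> du 1 1 x + du 2 2 x = 0"
  using div_free[of x] by (simp add: divergence_def sum_2 du_def)

lemma momentum_du:
  assumes "x \<in> E"
  shows "partial 1 (du i 1) x + partial 2 (du i 2) x = partial i p x - \<kappa> * u x $ i"
proof -
  have "laplacian u x $ i = partial 1 (du i 1) x + partial 2 (du i 2) x"
    unfolding laplacian_def du_def
    by (simp add: sum_2 partial_partial_bounded_linear[OF open_E C2_u bounded_linear_component assms, of _ _ i])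
  moreover have "(- laplacian u x + grad p x) $ i = (\<kappa> *s u x) $ i"
    using momentum[OF assms] by simp
  ultimately show ?thesis by (simp add: grad_def algebra_simps)
qed

lemma partial_du_commute: "x \<in> E \<Longrightarrow> partial j (du i l) x = partial l (du i j) x"
  unfolding du_def using partial_commute[OF open_E C2_component] by blast

lemma partial_div_du:
  assumes "x \<in> E"
  shows "partial i (du 1 1) x + partial i (du 2 2) x = 0"
proof -
  have "partial i (du 1 1) x + partial i (du 2 2) x = partial i (\<lambda>x. du 1 1 x + du 2 2 x) x"
    by (rule partial_add[OF differentiable_du[OF assms] differentiable_du[OF assms], symmetric])
  also have "\<dots> = partial i (\<lambda>_. 0) x"
    by (rule partial_cong[OF open_E assms div_free_du])
  also have "\<dots> = 0" by (rule has_derivative_partial) auto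
  finally show ?thesis .
qed

lemma du_le: "cmod (du i j x) \<le> du_norm x"
proof -
  have "(cmod (du i j x))\<^sup>2 \<le> (\<Sum>j\<in>UNIV. (cmod (du i j x))\<^sup>2)"
    by (rule member_le_sum) auto
  also have "\<dots> \<le> (\<Sum>i\<in>UNIV. \<Sum>j\<in>UNIV. (cmod (du i j x))\<^sup>2)"
    by (rule member_le_sum[where f="\<lambda>i. \<Sum>j\<in>UNIV. (cmod (du i j x))\<^sup>2"]) (auto intro: sum_nonneg)
  finally show ?thesis unfolding du_norm_def by (rule real_le_rsqrt)
qed

lemma du_norm_sq: "(du_norm x)\<^sup>2 = (\<Sum>i\<in>UNIV. \<Sum>j\<in>UNIV. (cmod (du i j x))\<^sup>2)"
  unfolding du_norm_def by (intro real_sqrt_pow2 sum_nonneg) auto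

lemma du_norm_nonneg: "0 \<le> du_norm x"
  unfolding du_norm_def by (intro real_sqrt_ge_zero sum_nonneg) auto

lemma component_le: "cmod (u x $ i) \<le> norm (u x)"
  using member_le_L2_set[of UNIV i "\<lambda>i. cmod (u x $ i)"] by (simp add: norm_vec_def)

lemma norm_u_sq: "(norm (u x))\<^sup>2 = (cmod (u x $ 1))\<^sup>2 + (cmod (u x $ 2))\<^sup>2"
  by (simp add: norm_vec_def L2_set_def sum_2)

lemma C1_cnj_component: "C1_on E (\<lambda>y. cnj (u y $ i))"
  by (rule C1_on_bounded_linear[OF C1_component bounded_linear_cnj])

lemma partial_cnj_component: "x \<in> E \<Longrightarrow> partial j (\<lambda>y. cnj (u y $ i)) x = cnj (du i j x)"
  unfolding du_def by (rule partial_bounded_linear[OF differentiable_component bounded_linear_cnj])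

lemma norm_u_sq_Re: "(norm (u x))\<^sup>2 = Re (\<Sum>i\<in>UNIV. u x $ i * cnj (u x $ i))"
  by (simp add: norm_u_sq sum_2 cmod_power2) (simp add: power2_eq_square)

lemma norm_sq_u_C1: "C1_on E (\<lambda>x. (norm (u x))\<^sup>2)"
  and partial_norm_sq_u: "x \<in> E \<Longrightarrow>
    partial j (\<lambda>x. (norm (u x))\<^sup>2) x = 2 * Re (\<Sum>i\<in>UNIV. du i j x * cnj (u x $ i))"
proof -
  let ?f = "\<lambda>x. \<Sum>i\<in>UNIV. u x $ i * cnj (u x $ i)"
  have C: "C1_on E (\<lambda>x. u x $ i * cnj (u x $ i))" for i
    by (intro C1_on_mult C1_component C1_cnj_component)
  have C1: "C1_on E ?f" by (rule C1_on_sum[OF _ C]) simp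
  show "C1_on E (\<lambda>x. (norm (u x))\<^sup>2)"
    unfolding norm_u_sq_Re by (rule C1_on_bounded_linear[OF C1 bounded_linear_Re])
  assume x: "x \<in> E"
  have "partial j (\<lambda>x. (norm (u x))\<^sup>2) x = Re (partial j ?f x)"
    unfolding norm_u_sq_Re by (rule partial_bounded_linear[OF C1_on_differentiable[OF C1 x] bounded_linear_Re])
  also have "partial j ?f x = (\<Sum>i\<in>UNIV. partial j (\<lambda>x. u x $ i * cnj (u x $ i)) x)"
    by (rule partial_sum) (use C1_on_differentiable[OF C x] in auto)
  also have "\<dots> = (\<Sum>i\<in>UNIV. u x $ i * cnj (du i j x) + du i j x * cnj (u x $ i))"
    using x by (simp add: partial_mult differentiable_component C1_on_differentiable[OF C1_cnj_component]
        partial_cnj_component) (simp add: du_def)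
  finally show "partial j (\<lambda>x. (norm (u x))\<^sup>2) x = 2 * Re (\<Sum>i\<in>UNIV. du i j x * cnj (u x $ i))"
    by (simp add: sum_2)
qed

lemma partial_norm_sq_u_bound:
  assumes "x \<in> E"
  shows "\<bar>partial j (\<lambda>x. (norm (u x))\<^sup>2) x\<bar> \<le> 4 * du_norm x * norm (u x)"
proof -
  have "\<bar>Re (\<Sum>i\<in>UNIV. du i j x * cnj (u x $ i))\<bar> \<le> (\<Sum>i\<in>UNIV. cmod (du i j x * cnj (u x $ i)))"
    by (rule order_trans[OF abs_Re_le_cmod norm_sum])
  also have "\<dots> \<le> (\<Sum>i\<in>(UNIV::2 set). du_norm x * norm (u x))"
    by (intro sum_mono) (auto simp: norm_mult intro!: mult_mono du_le component_le du_norm_nonneg)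
  finally show ?thesis using assms by (simp add: partial_norm_sq_u abs_mult mult_ac)
qed

end

text \<open>A momentum flux \<open>S\<close> for the flow: the gradient \<open>\<nabla>u - p I\<close> or the stress \<open>2e(u) - p I\<close>.\<close>

locale momentum_flux = stokes_flow +
  fixes S :: "2 \<Rightarrow> 2 \<Rightarrow> real^2 \<Rightarrow> complex"
  assumes C1_S: "\<And>i j. C1_on E (S i j)"
    and div_S: "\<And>x i. x \<in> E \<Longrightarrow> partial 1 (S i 1) x + partial 2 (S i 2) x = - \<kappa> * u x $ i"
    and S_le: "\<And>x i j. x \<in> E \<Longrightarrow> cmod (S i j x) \<le> 2 * du_norm x + cmod (p x)"
begin

definition T :: "2 \<Rightarrow> real^2 \<Rightarrow> complex" where
  "T j x = (\<Sum>i\<in>UNIV. S i j x * cnj (u x $ i))"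

definition dissipation :: "real^2 \<Rightarrow> complex" where
  "dissipation x = (\<Sum>i\<in>UNIV. \<Sum>j\<in>UNIV. S i j x * cnj (du i j x))"

definition cutoff_flux :: "real \<Rightarrow> real^2 \<Rightarrow> complex" where
  "cutoff_flux R x = (\<Sum>j\<in>UNIV. T j x * of_real (partial j (eta R) x))"

definition trunc_flux :: "real^2 \<Rightarrow> complex" where
  "trunc_flux x = (\<Sum>j\<in>UNIV. T j x * of_real (partial j (\<lambda>x. (norm (u x))\<^sup>2) x))"

text \<open>The divergence of \<open>eta R * trunc \<epsilon> (|u|^2) * T\<close>, expanded by the
  product rule: the derivative falls on \<open>T\<close>, on the cutoff, or on the
  truncation.\<close>

definition energy_density :: "real \<Rightarrow> real \<Rightarrow> real^2 \<Rightarrow> complex" where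
  "energy_density R \<epsilon> x =
    of_real (eta R x * trunc \<epsilon> ((norm (u x))\<^sup>2)) * (dissipation x - \<kappa> * of_real ((norm (u x))\<^sup>2)) +
    of_real (trunc \<epsilon> ((norm (u x))\<^sup>2)) * cutoff_flux R x +
    of_real (eta R x * trunc' \<epsilon> ((norm (u x))\<^sup>2)) * trunc_flux x"

lemma C1_T: "C1_on E (T j)"
  unfolding T_def[abs_def]
  by (rule C1_on_sum) (auto intro: C1_on_mult C1_S C1_cnj_component)

lemma partial_T:
  assumes "x \<in> E"
  shows "partial j (T j) x = (\<Sum>i\<in>UNIV. S i j x * cnj (du i j x) + partial j (S i j) x * cnj (u x $ i))"
proof -
  have "partial j (T j) x = (\<Sum>i\<in>UNIV. partial j (\<lambda>x. S i j x * cnj (u x $ i)) x)"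
    unfolding T_def[abs_def]
    by (rule partial_sum) (use C1_on_differentiable[OF C1_on_mult[OF C1_S C1_cnj_component] assms] in auto)
  also have "\<dots> = (\<Sum>i\<in>UNIV. S i j x * cnj (du i j x) + partial j (S i j) x * cnj (u x $ i))"
    using assms by (simp add: partial_mult C1_on_differentiable[OF C1_S] C1_on_differentiable[OF C1_cnj_component]
        partial_cnj_component)
  finally show ?thesis .
qed

lemma div_T:
  assumes "x \<in> E"
  shows "partial 1 (T 1) x + partial 2 (T 2) x = dissipation x - \<kappa> * of_real ((norm (u x))\<^sup>2)"
proof -
  have "partial 1 (T 1) x + partial 2 (T 2) x
    = dissipation x + (\<Sum>i\<in>UNIV. (partial 1 (S i 1) x + partial 2 (S i 2) x) * cnj (u x $ i))"
    using assms by (simp add: partial_T dissipation_def sum_2 algebra_simps)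
  also have "\<dots> = dissipation x - \<kappa> * (u x $ 1 * cnj (u x $ 1) + u x $ 2 * cnj (u x $ 2))"
    using assms by (simp add: div_S sum_2 algebra_simps)
  also have "u x $ 1 * cnj (u x $ 1) + u x $ 2 * cnj (u x $ 2) = of_real ((norm (u x))\<^sup>2)"
    unfolding norm_u_sq of_real_add complex_norm_square ..
  finally show ?thesis .
qed

text \<open>The density is the divergence of a field supported where |x| \<le> R and |u|^2 \<ge>
  \<epsilon>. The Dirichlet condition keeps this set away from the boundary, whatever the boundary
  looks like.\<close>

lemma energy_density_integral:
  assumes R: "R > 0" and \<epsilon>: "\<epsilon> > 0"
  shows "integrable lborel (\<lambda>x. indicator E x *\<^sub>R energy_density R \<epsilon> x)"
    and "(\<integral>x. indicator E x *\<^sub>R energy_density R \<epsilon> x \<partial>lborel) = 0"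
proof -
  let ?s = "\<lambda>x. (norm (u x))\<^sup>2"
  define \<phi> where "\<phi> x = eta R x * trunc \<epsilon> (?s x)" for x
  have C1e: "C1_on E (eta R)" using eta_C1 C1_on_subset by blast
  note tr = C1_on_compose_real[OF norm_sq_u_C1 trunc_derivative[OF \<epsilon>] trunc'_continuous[OF \<epsilon>]]
  have C1\<phi>: "C1_on E \<phi>" unfolding \<phi>_def[abs_def] by (rule C1_on_mult[OF C1e tr(1)])
  have d\<phi>: "partial j \<phi> x = eta R x * trunc' \<epsilon> (?s x) * partial j ?s x + partial j (eta R) x * trunc \<epsilon> (?s x)"
    if "x \<in> E" for x j
    using partial_mult[OF C1_on_differentiable[OF C1e that] C1_on_differentiable[OF tr(1) that], of j] tr(2)[OF that, of j]
    by (simp add: \<phi>_def[abs_def])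
  have C1\<phi>': "C1_on E (\<lambda>x. complex_of_real (\<phi> x))"
    by (rule C1_on_bounded_linear[OF C1\<phi> bounded_linear_of_real])
  define J where "J j x = of_real (\<phi> x) * T j x" for j x
  have C1J: "C1_on E (J j)" for j unfolding J_def[abs_def] by (rule C1_on_mult[OF C1\<phi>' C1_T])
  have dJ: "partial j (J j) x = of_real (\<phi> x) * partial j (T j) x + of_real (partial j \<phi> x) * T j x"
    if "x \<in> E" for x j
    using partial_mult[OF C1_on_differentiable[OF C1\<phi>' that] C1_on_differentiable[OF C1_T that], of j j]
      partial_bounded_linear[OF C1_on_differentiable[OF C1\<phi> that] bounded_linear_of_real[where 'a=complex], of j]
    by (simp add: J_def[abs_def])
  have divJ: "partial 1 (J 1) x + partial 2 (J 2) x = energy_density R \<epsilon> x" if "x \<in> E" for x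
  proof -
    have "partial 1 (J 1) x + partial 2 (J 2) x = of_real (\<phi> x) * (partial 1 (T 1) x + partial 2 (T 2) x)
      + (of_real (partial 1 \<phi> x) * T 1 x + of_real (partial 2 \<phi> x) * T 2 x)"
      using that by (simp add: dJ algebra_simps)
    also have "\<dots> = energy_density R \<epsilon> x"
      unfolding div_T[OF that] energy_density_def cutoff_flux_def trunc_flux_def d\<phi>[OF that] sum_2 \<phi>_def
      by (simp add: algebra_simps)
    finally show ?thesis .
  qed
  define K where "K = {x \<in> closure E. norm x \<le> R \<and> \<epsilon> \<le> ?s x}"
  have K: "compact K"
  proof -
    have "closed (closure E \<inter> {x. \<epsilon> \<le> ?s x})"
      using continuous_closed_preimage[OF continuous_on_power[OF continuous_on_norm[OF cont_u]] closed_closure closed_atLeast, of 2 \<epsilon>]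
      by (simp add: vimage_def)
    then have "compact (cball 0 R \<inter> (closure E \<inter> {x. \<epsilon> \<le> ?s x}))"
      by (intro compact_Int_closed compact_cball)
    moreover have "K = cball 0 R \<inter> (closure E \<inter> {x. \<epsilon> \<le> ?s x})" by (auto simp: K_def)
    ultimately show ?thesis by simp
  qed
  \<comment> \<open>A point of the closure outside the open set \<open>E\<close> is a frontier
    point, where u = 0 contradicts |u|^2 \<ge> \<epsilon> > 0.\<close>
  have KE: "K \<subseteq> E"
  proof
    fix x assume x: "x \<in> K"
    show "x \<in> E"
    proof (rule ccontr)
      assume "x \<notin> E"
      then have "x \<in> frontier E" using x open_E by (simp add: K_def frontier_def interior_open)
      then show False using x \<epsilon> dirichlet by (simp add: K_def)
    qed
  qed
  have z: "J j x = 0" if "x \<in> E" "x \<notin> K" for j x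
  proof -
    have "x \<in> closure E" using that closure_subset by blast
    then have "norm x \<ge> R \<or> ?s x \<le> \<epsilon>" using that by (auto simp: K_def)
    then have "\<phi> x = 0" using eta_root_outside[OF R, of x] trunc_small[OF \<epsilon>] by (auto simp: \<phi>_def eta_eq)
    then show ?thesis by (simp add: J_def)
  qed
  note I = integral_partial_compact_support[OF open_E C1J K KE z]
  have eq: "indicator E x *\<^sub>R energy_density R \<epsilon> x
     = indicator E x *\<^sub>R partial 1 (J 1) x + indicator E x *\<^sub>R partial 2 (J 2) x" for x
    by (cases "x \<in> E") (auto simp: divJ[symmetric])
  show "integrable lborel (\<lambda>x. indicator E x *\<^sub>R energy_density R \<epsilon> x)"
    unfolding eq by (intro Bochner_Integration.integrable_add I(1))
  show "(\<integral>x. indicator E x *\<^sub>R energy_density R \<epsilon> x \<partial>lborel) = 0"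
    unfolding eq using I by (simp add: Bochner_Integration.integral_add)
qed

end

section \<open>Bounds for the flow and removal of the truncation\<close>

context stokes_flow
begin

lemma open_supp_u: "open supp_u"
proof -
  have "open (E \<inter> u -` (- {0}))"
    by (rule continuous_open_preimage[OF C1_on_continuous[OF C2_on_imp_C1_on[OF C2_u]] open_E]) auto
  moreover have "E \<inter> u -` (- {0}) = supp_u" by (auto simp: supp_u_def)
  ultimately show ?thesis by simp
qed

lemma supp_u_subset: "supp_u \<subseteq> E" by (auto simp: supp_u_def)

lemma cont_du_norm: "continuous_on E du_norm"
  unfolding du_norm_def[abs_def] by (intro continuous_intros C1_on_continuous[OF C1_du])

lemma cont_u_E: "continuous_on E u" and cont_p_E: "continuous_on E p"
  using cont_u cont_p closure_subset continuous_on_subset by blast+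

text \<open>Compactness of the closure of \<open>E\<close> within a disc. For \<open>p\<close> this
  is what controls the pressure work caused by the non-solenoidal test function.\<close>

lemma flow_bounded:
  obtains M where "M \<ge> 1" "\<And>x. x \<in> E \<Longrightarrow> norm x \<le> R \<Longrightarrow> norm (u x) \<le> M \<and> cmod (p x) \<le> M"
proof -
  have K: "compact (closure E \<inter> cball 0 R)" by (intro closed_Int_compact) auto
  have "bounded (u ` (closure E \<inter> cball 0 R))" "bounded (p ` (closure E \<inter> cball 0 R))"
    using cont_u cont_p by (auto intro!: compact_imp_bounded compact_continuous_image[OF _ K] intro: continuous_on_subset)
  then obtain a b where "\<forall>x\<in>closure E \<inter> cball 0 R. norm (u x) \<le> a" "\<forall>x\<in>closure E \<inter> cball 0 R. norm (p x) \<le> b"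
    unfolding bounded_iff by (metis image_eqI)
  then show thesis
    using closure_subset[of E] by (intro that[of "max 1 (max a b)"]) (auto simp: le_max_iff_disj subset_iff)
qed

lemma supp_measurable:
  fixes f :: "real^2 \<Rightarrow> 'b::real_normed_vector"
  assumes "continuous_on E f"
  shows "(\<lambda>x. indicator supp_u x *\<^sub>R f x) \<in> borel_measurable borel"
  by (rule borel_measurable_continuous_on_indicator)
    (use open_supp_u supp_u_subset assms in \<open>auto intro: continuous_on_subset\<close>)

lemma E_measurable:
  fixes f :: "real^2 \<Rightarrow> 'b::real_normed_vector"
  assumes "continuous_on E f"
  shows "(\<lambda>x. indicator E x *\<^sub>R f x) \<in> borel_measurable borel"
  by (rule borel_measurable_continuous_on_indicator) (use open_E assms in auto)

lemma continuous_eta: "continuous_on A (eta R)"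
  using C1_on_continuous[OF eta_C1] continuous_on_subset by blast

end

lemma emeasure_cball_lt_top: "emeasure lborel (cball (0::real^2) R) < \<infinity>"
  by (rule emeasure_bounded_finite) simp

context momentum_flux
begin

lemma T_bound:
  assumes "x \<in> E"
  shows "cmod (T j x) \<le> 2 * (2 * du_norm x + cmod (p x)) * norm (u x)"
proof -
  have "cmod (T j x) \<le> (\<Sum>i\<in>(UNIV::2 set). (2 * du_norm x + cmod (p x)) * norm (u x))"
    unfolding T_def using du_norm_nonneg[of x]
    by (intro sum_norm_le) (auto simp: norm_mult intro!: mult_mono S_le assms component_le add_nonneg_nonneg)
  then show ?thesis by (simp add: algebra_simps)
qed

lemma cutoff_flux_bound:
  assumes "x \<in> E" "R > 0"
  shows "cmod (cutoff_flux R x) \<le> 16 / R * eta_root R x * ((2 * du_norm x + cmod (p x)) * norm (u x))"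
proof -
  have "cmod (T j x * of_real (partial j (eta R) x))
    \<le> (2 * (2 * du_norm x + cmod (p x)) * norm (u x)) * (4 / R * eta_root R x)" for j
    unfolding norm_mult norm_of_real using du_norm_nonneg[of x]
    by (rule_tac mult_mono[OF T_bound[OF assms(1)] partial_eta_bound[OF assms(2)]]) auto
  then have "cmod (cutoff_flux R x) \<le> (\<Sum>j\<in>(UNIV::2 set). (2 * (2 * du_norm x + cmod (p x)) * norm (u x)) * (4 / R * eta_root R x))"
    unfolding cutoff_flux_def by (intro sum_norm_le)
  also have "\<dots> = 16 / R * eta_root R x * ((2 * du_norm x + cmod (p x)) * norm (u x))" by simp
  finally show ?thesis .
qed

lemma trunc_flux_bound:
  assumes "x \<in> E"
  shows "cmod (trunc_flux x) \<le> 16 * (2 * du_norm x + cmod (p x)) * du_norm x * (norm (u x))\<^sup>2"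
proof -
  have "cmod (T j x * of_real (partial j (\<lambda>x. (norm (u x))\<^sup>2) x))
    \<le> (2 * (2 * du_norm x + cmod (p x)) * norm (u x)) * (4 * du_norm x * norm (u x))" for j
    unfolding norm_mult norm_of_real using du_norm_nonneg[of x]
    by (rule_tac mult_mono[OF T_bound[OF assms(1)] partial_norm_sq_u_bound[OF assms(1)]]) auto
  then have "cmod (trunc_flux x) \<le> (\<Sum>j\<in>(UNIV::2 set). (2 * (2 * du_norm x + cmod (p x)) * norm (u x)) * (4 * du_norm x * norm (u x)))"
    unfolding trunc_flux_def by (intro sum_norm_le)
  also have "\<dots> = 16 * (2 * du_norm x + cmod (p x)) * du_norm x * (norm (u x))\<^sup>2" by (simp add: power2_eq_square)
  finally show ?thesis .
qed

lemma dissipation_bound: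
  assumes "x \<in> E"
  shows "cmod (dissipation x) \<le> 4 * (2 * du_norm x + cmod (p x)) * du_norm x"
proof -
  have "cmod (dissipation x) \<le> (\<Sum>i\<in>(UNIV::2 set). \<Sum>j\<in>(UNIV::2 set). (2 * du_norm x + cmod (p x)) * du_norm x)"
    unfolding dissipation_def using du_norm_nonneg[of x]
    by (intro sum_norm_le) (auto simp: norm_mult intro!: mult_mono du_le S_le assms add_nonneg_nonneg)
  then show ?thesis by (simp add: algebra_simps)
qed

lemma continuous_fluxes:
  "continuous_on E dissipation" "continuous_on E (cutoff_flux R)"
proof -
  show "continuous_on E dissipation"
    unfolding dissipation_def[abs_def] by (intro continuous_intros C1_on_continuous[OF C1_du] C1_on_continuous[OF C1_S])
  have "continuous_on E (partial j (eta R))" for j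
    using C1_on_partial[OF eta_C1] continuous_on_subset by blast
  then show "continuous_on E (cutoff_flux R)"
    unfolding cutoff_flux_def[abs_def] by (intro continuous_intros C1_on_continuous[OF C1_T])
qed

text \<open>The limit \<open>\<epsilon> \<rightarrow> 0\<close> in the truncated identity, by dominated convergence: the truncation flux
  carries the factor \<open>|u|\<^sup>2 trunc' \<epsilon> (|u|\<^sup>2)\<close>, which is bounded and tends to 0.\<close>

lemma energy_identity:
  assumes R: "R > 0"
    and L2: "integrable lborel (\<lambda>x. indicator (supp_u \<inter> cball 0 R) x * (du_norm x)\<^sup>2)"
  defines "F \<equiv> \<lambda>x. indicator supp_u x *\<^sub>R
    (of_real (eta R x) * (dissipation x - \<kappa> * of_real ((norm (u x))\<^sup>2)) + cutoff_flux R x)"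
  shows "integrable lborel F" "integral\<^sup>L lborel F = 0"
proof -
  let ?s = "\<lambda>x. (norm (u x))\<^sup>2"
  let ?e = "\<lambda>n. 1 / real (Suc n)"
  obtain M where M: "M \<ge> 1" "\<And>x. x \<in> E \<Longrightarrow> norm x \<le> R \<Longrightarrow> norm (u x) \<le> M \<and> cmod (p x) \<le> M"
    by (rule flow_bounded[of R]) blast
  \<comment> \<open>A generous majorant. The estimate below yields 204 = 3 * (4 + 64) for the
    squared gradient and 68 for M^2 from dissipation and truncation; the 1/R terms come from the
    cutoff flux.\<close>
  define w where "w x = (1000 + 32 / R * M) * (indicator (supp_u \<inter> cball 0 R) x * (du_norm x)\<^sup>2)
    + (1000 * M\<^sup>2 + cmod \<kappa> * M\<^sup>2 + 64 / R * M\<^sup>2) * indicator (cball 0 R) x" for x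
  have w: "integrable lborel w"
    unfolding w_def using L2 emeasure_cball_lt_top[of R]
    by (intro Bochner_Integration.integrable_add integrable_mult_right integrable_real_indicator) auto
  define I where "I n x = indicator E x *\<^sub>R energy_density R (?e n) x" for n x
  have I: "integrable lborel (I n)" "integral\<^sup>L lborel (I n) = 0" for n
    unfolding I_def using energy_density_integral[OF R, of "?e n"] by auto
  have off: "I n x = 0" "F x = 0" if "x \<notin> supp_u" for n x
  proof -
    have "energy_density R (?e n) x = 0" if "u x = 0"
      using trunc_small[of "?e n" 0] that by (simp add: energy_density_def)
    then show "I n x = 0" using that by (auto simp: I_def supp_u_def)
    show "F x = 0" using that by (simp add: F_def)
  qed
  have lim: "(\<lambda>n. I n x) \<longlonglongrightarrow> F x" for x
  proof (cases "x \<in> supp_u")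
    case True
    then have x: "x \<in> E" and s: "?s x > 0" by (auto simp: supp_u_def)
    have "(\<lambda>n. energy_density R (?e n) x) \<longlonglongrightarrow>
      of_real (eta R x * 1) * (dissipation x - \<kappa> * of_real (?s x)) +
      of_real 1 * cutoff_flux R x + of_real (eta R x * 0) * trunc_flux x"
      unfolding energy_density_def by (intro tendsto_intros trunc_limits s)
    then show ?thesis using True x by (simp add: I_def F_def)
  next
    case False
    then show ?thesis using off by simp
  qed
  have bd: "norm (I n x) \<le> w x" for n x
  proof (cases "x \<in> supp_u")
    case False
    have "w x \<ge> 0" unfolding w_def using M R by (intro add_nonneg_nonneg mult_nonneg_nonneg) auto
    then show ?thesis using off[OF False] by simp
  next
    case True
    then have x: "x \<in> E" by (simp add: supp_u_def)
    have e: "?e n > 0" by simp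
    show ?thesis
    proof (cases "norm x \<le> R")
      case False
      then have "eta R x = 0" "cutoff_flux R x = 0"
        using eta_root_outside[OF R, of x] by (auto simp: eta_eq cutoff_flux_def partial_eta)
      then have "I n x = 0" by (simp add: I_def energy_density_def)
      moreover have "w x \<ge> 0" unfolding w_def using M R by (intro add_nonneg_nonneg mult_nonneg_nonneg) auto
      ultimately show ?thesis by simp
    next
      case nx: True
      define g v q where "g = du_norm x" and "v = norm (u x)" and "q = cmod (p x)"
      have b: "0 \<le> g" "0 \<le> v" "v \<le> M" "0 \<le> q" "q \<le> M"
        using M(2)[OF x nx] by (auto simp: g_def v_def q_def du_norm_nonneg)
      have wx: "w x = (1000 + 32 / R * M) * g\<^sup>2 + (1000 * M\<^sup>2 + cmod \<kappa> * M\<^sup>2 + 64 / R * M\<^sup>2)"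
        using True nx by (simp add: w_def g_def)
      let ?t = "trunc (?e n) (v\<^sup>2)" and ?t' = "trunc' (?e n) (v\<^sup>2)"
      have t: "0 \<le> ?t" "?t \<le> 1" "0 \<le> ?t'" "v\<^sup>2 * ?t' \<le> 4"
        using trunc_bounds[OF e] trunc'_nonneg[OF e] trunc'_bound[OF e] by auto
      have n1: "norm (of_real (eta R x * ?t) * (dissipation x - \<kappa> * of_real (v\<^sup>2))) \<le> 4 * (2 * g + q) * g + cmod \<kappa> * v\<^sup>2"
      proof -
        have "norm (of_real (eta R x * ?t) * (dissipation x - \<kappa> * of_real (v\<^sup>2))) \<le> 1 * norm (dissipation x - \<kappa> * of_real (v\<^sup>2))"
          unfolding norm_mult using t eta_bounds[of R x] by (intro mult_right_mono) (auto simp: norm_mult mult_le_one)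
        also have "\<dots> \<le> norm (dissipation x) + norm (\<kappa> * of_real (v\<^sup>2))"
          by (simp only: mult_1 norm_triangle_ineq4)
        also have "\<dots> \<le> 4 * (2 * g + q) * g + cmod \<kappa> * v\<^sup>2"
          using dissipation_bound[OF x] by (auto simp: g_def q_def v_def norm_mult norm_power)
        finally show ?thesis .
      qed
      have n2: "norm (of_real ?t * cutoff_flux R x) \<le> 16 / R * ((2 * g + q) * v)"
      proof -
        have "norm (of_real ?t * cutoff_flux R x) \<le> 1 * norm (cutoff_flux R x)"
          unfolding norm_mult using t by (intro mult_right_mono) auto
        also have "\<dots> \<le> 16 / R * eta_root R x * ((2 * g + q) * v)"
          using cutoff_flux_bound[OF x R] by (simp add: g_def q_def v_def)
        also have "\<dots> \<le> 16 / R * 1 * ((2 * g + q) * v)"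
          using eta_root_bounds[of R x] b R by (intro mult_right_mono mult_left_mono) auto
        finally show ?thesis by simp
      qed
      \<comment> \<open>The factor |u|^2 in \<open>trunc_flux_bound\<close> is spent on
        \<open>v^2 * t' \<le> 4\<close>, which gives 64 = 16 * 4 uniformly in
        \<open>n\<close>.\<close>
      have n3: "norm (of_real (eta R x * ?t') * trunc_flux x) \<le> 64 * (2 * g + q) * g"
      proof -
        have "norm (of_real (eta R x * ?t') * trunc_flux x) = eta R x * (?t' * norm (trunc_flux x))"
          unfolding norm_mult using t eta_bounds[of R x] by (simp add: norm_mult)
        also have "\<dots> \<le> 1 * (?t' * (16 * (2 * g + q) * g * v\<^sup>2))"
          using t eta_bounds[of R x] trunc_flux_bound[OF x]
          by (intro mult_mono mult_left_mono mult_nonneg_nonneg) (auto simp: g_def q_def v_def)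
        also have "\<dots> = (16 * (2 * g + q) * g) * (v\<^sup>2 * ?t')" by simp
        also have "\<dots> \<le> (16 * (2 * g + q) * g) * 4"
          using t b by (intro mult_left_mono) auto
        also have "\<dots> = 64 * (2 * g + q) * g" by (simp only: mult.assoc mult.commute[of _ 4])
        finally show ?thesis .
      qed
      have gq: "(2 * g + q) * g \<le> 3 * g\<^sup>2 + M\<^sup>2"
      proof -
        have "q * g \<le> q\<^sup>2 + g\<^sup>2" using sum_squares_bound[of q g] mult_nonneg_nonneg[OF b(4,1)] by linarith
        moreover have "q\<^sup>2 \<le> M\<^sup>2" using b by (intro power_mono) auto
        ultimately show ?thesis by (simp add: power2_eq_square algebra_simps)
      qed
      have gv: "(2 * g + q) * v \<le> 2 * g\<^sup>2 * M + 3 * M\<^sup>2"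
      proof -
        have "g \<le> g\<^sup>2 + 1" using sum_squares_bound[of g 1] b by simp
        then have "g * v \<le> (g\<^sup>2 + 1) * M" using b by (intro mult_mono) auto
        moreover have "q * v \<le> M * M" using b by (intro mult_mono) auto
        moreover have "M \<le> M * M" using M by simp
        ultimately show ?thesis by (simp add: power2_eq_square algebra_simps)
      qed
      have "I n x = of_real (eta R x * ?t) * (dissipation x - \<kappa> * of_real (v\<^sup>2)) + of_real ?t * cutoff_flux R x
          + of_real (eta R x * ?t') * trunc_flux x"
        unfolding I_def energy_density_def v_def using x by simp
      then have "norm (I n x) \<le> (4 * (2 * g + q) * g + cmod \<kappa> * v\<^sup>2) + 16 / R * ((2 * g + q) * v) + 64 * (2 * g + q) * g"
        by (simp only:) (rule order_trans[OF norm_triangle_ineq add_mono[OF order_trans[OF norm_triangle_ineq add_mono[OF n1 n2]] n3]])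
      also have "\<dots> \<le> 68 * (3 * g\<^sup>2 + M\<^sup>2) + cmod \<kappa> * M\<^sup>2 + 16 / R * (2 * g\<^sup>2 * M + 3 * M\<^sup>2)"
      proof -
        have "cmod \<kappa> * v\<^sup>2 \<le> cmod \<kappa> * M\<^sup>2" using b by (intro mult_left_mono power_mono) auto
        moreover have "16 / R * ((2 * g + q) * v) \<le> 16 / R * (2 * g\<^sup>2 * M + 3 * M\<^sup>2)"
          using gv R by (intro mult_left_mono) auto
        ultimately show ?thesis using gq by (simp add: algebra_simps)
      qed
      also have "\<dots> = 204 * g\<^sup>2 + 68 * M\<^sup>2 + cmod \<kappa> * M\<^sup>2 + 32 / R * M * g\<^sup>2 + 48 / R * M\<^sup>2"
        by (simp add: algebra_simps add_divide_distrib)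
      also have "\<dots> \<le> w x"
      proof -
        have "48 / R * M\<^sup>2 \<le> 64 / R * M\<^sup>2" using R by (intro mult_right_mono divide_right_mono) auto
        then show ?thesis unfolding wx distrib_right using zero_le_power2[of g] zero_le_power2[of M] by linarith
      qed
      finally show ?thesis .
    qed
  qed
  have Fm: "F \<in> borel_measurable lborel"
  proof -
    have "continuous_on E (\<lambda>x. of_real (eta R x) * (dissipation x - \<kappa> * of_real (?s x)) + cutoff_flux R x)"
      by (intro continuous_intros continuous_fluxes continuous_eta cont_u_E)
    from supp_measurable[OF this] show ?thesis by (simp add: F_def)
  qed
  have Im: "\<And>n. I n \<in> borel_measurable lborel" using I(1) by auto
  have *: "AE x in lborel. (\<lambda>n. I n x) \<longlonglongrightarrow> F x" "\<And>n. AE x in lborel. norm (I n x) \<le> w x"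
    using lim bd by auto
  show "integrable lborel F" by (rule integrable_dominated_convergence[OF Fm Im w *])
  have "(\<lambda>n. integral\<^sup>L lborel (I n)) \<longlonglongrightarrow> integral\<^sup>L lborel F"
    by (rule integral_dominated_convergence[OF Fm Im w *])
  then show "integral\<^sup>L lborel F = 0" by (simp add: I(2) LIMSEQ_const_iff)
qed

end

lemma C1_on_diff:
  assumes "C1_on S f" "C1_on S g"
  shows "C1_on S (\<lambda>x. f x - g x)"
  using C1_on_add[OF assms(1) C1_on_bounded_linear[OF assms(2) bounded_linear_minus[OF bounded_linear_ident]]]
  by simp

section \<open>Square integrability of the gradient up to the boundary\<close>

context stokes_flow
begin

text \<open>Its divergence is \<Delta>u - grad p, and its dissipation is the full |grad u|^2, so
  coercivity holds without an inequality of Korn type.\<close>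

definition grad_flux :: "2 \<Rightarrow> 2 \<Rightarrow> real^2 \<Rightarrow> complex" where
  "grad_flux i j = (if i = j then \<lambda>x. du i j x - p x else du i j)"

lemma momentum_flux_grad: "momentum_flux E u p \<kappa> grad_flux"
proof unfold_locales
  show "C1_on E (grad_flux i j)" for i j
    unfolding grad_flux_def by (auto intro!: C1_on_diff C1_du C1_p)
  show "partial 1 (grad_flux i 1) x + partial 2 (grad_flux i 2) x = - \<kappa> * u x $ i" if x: "x \<in> E" for x i
    using momentum_du[OF x, of i] exhaust_2[of i] x
    by (auto simp: grad_flux_def partial_diff differentiable_du differentiable_p algebra_simps)
  show "cmod (grad_flux i j x) \<le> 2 * du_norm x + cmod (p x)" if x: "x \<in> E" for x i j
    using du_le[of i j x] du_norm_nonneg[of x] norm_triangle_ineq4[of "du i j x" "p x"]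
    by (auto simp: grad_flux_def intro: order_trans)
qed

lemma grad_dissipation:
  assumes "x \<in> E"
  shows "momentum_flux.dissipation u grad_flux x = of_real ((du_norm x)\<^sup>2)"
proof -
  interpret G: momentum_flux E u p \<kappa> grad_flux by (rule momentum_flux_grad)
  have "G.dissipation x = (\<Sum>i\<in>UNIV. \<Sum>j\<in>UNIV. du i j x * cnj (du i j x)) - p x * cnj (du 1 1 x + du 2 2 x)"
    by (simp add: G.dissipation_def grad_flux_def sum_2 algebra_simps)
  then show ?thesis
    unfolding du_norm_sq of_real_sum complex_norm_square by (simp add: div_free_du[OF assms])
qed

text \<open>In the truncated identity the dissipation is nonnegative, the cutoff flux costs half of
  it, and the truncation flux is bounded below by a constant. The truncated energies are thus
  bounded uniformly in \<epsilon>, and Fatou's lemma removes the truncation.\<close>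

lemma grad_L2_eta:
  assumes R: "R > 0"
  shows "integrable lborel (\<lambda>x. indicator supp_u x * (eta R x * (du_norm x)\<^sup>2))"
proof -
  interpret G: momentum_flux E u p \<kappa> grad_flux by (rule momentum_flux_grad)
  let ?s = "\<lambda>x. (norm (u x))\<^sup>2"
  let ?e = "\<lambda>n. 1 / real (Suc n)"
  obtain M where M: "M \<ge> 1" "\<And>x. x \<in> E \<Longrightarrow> norm x \<le> R \<Longrightarrow> norm (u x) \<le> M \<and> cmod (p x) \<le> M"
    by (rule flow_bounded[of R]) blast
  \<comment> \<open>The summands are the costs, in this order, of the zeroth-order term, of the
    gradient part and the pressure part of the cutoff flux, and of the pressure in the truncation
    flux.\<close>
  define C where "C = cmod \<kappa> * M\<^sup>2 + 512 * M\<^sup>2 / R\<^sup>2 + 16 / R * M\<^sup>2 + 2 * M\<^sup>2"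
  have C: "C \<ge> 0" unfolding C_def using R by (intro add_nonneg_nonneg) auto
  define I where "I n x = indicator E x *\<^sub>R G.energy_density R (?e n) x" for n x
  have I: "integrable lborel (I n)" "integral\<^sup>L lborel (I n) = 0" for n
    unfolding I_def using G.energy_density_integral[OF R, of "?e n"] by auto
  define f where "f n x = indicator E x * (1/2 * eta R x * trunc (?e n) (?s x) * (du_norm x)\<^sup>2)" for n x
  have f0: "f n x \<ge> 0" for n x
    unfolding f_def using eta_bounds[of R x] trunc_bounds[of "?e n" "?s x"] by auto
  have fle: "f n x \<le> Re (I n x) + C * indicator (cball 0 R) x" for n x
  proof (cases "x \<in> E \<and> norm x \<le> R")
    case False
    then consider "x \<notin> E" | "norm x \<ge> R" "x \<in> E" "x \<notin> cball 0 R"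
      by (cases "x \<in> E") (auto simp: not_le less_imp_le)
    then show ?thesis
    proof cases
      case 1
      then show ?thesis using C by (simp add: f_def I_def)
    next
      case 2
      then have "eta R x = 0" "G.cutoff_flux R x = 0"
        using eta_root_outside[OF R, of x] by (auto simp: eta_eq G.cutoff_flux_def partial_eta)
      then show ?thesis using C by (simp add: f_def I_def G.energy_density_def)
    qed
  next
    case True
    then have x: "x \<in> E" and nx: "norm x \<le> R" by auto
    have e: "?e n > 0" by simp
    define g v q m where "g = du_norm x" and "v = norm (u x)" and "q = cmod (p x)" and "m = eta_root R x"
    have b: "0 \<le> g" "0 \<le> v" "v \<le> M" "0 \<le> q" "q \<le> M" "0 \<le> m" "m \<le> 1"
      using M(2)[OF x nx] eta_root_bounds by (auto simp: g_def v_def q_def m_def du_norm_nonneg)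
    define t t' where "t = trunc (?e n) (v\<^sup>2)" and "t' = trunc' (?e n) (v\<^sup>2)"
    have t: "0 \<le> t" "t \<le> 1" "0 \<le> t'" "v\<^sup>2 * t' \<le> 4"
      using trunc_bounds[OF e] trunc'_nonneg[OF e] trunc'_bound[OF e] by (auto simp: t_def t'_def)
    have M2: "v\<^sup>2 \<le> M\<^sup>2" "q\<^sup>2 \<le> M\<^sup>2" "q * v \<le> M\<^sup>2"
      using b M(1) by (auto intro!: power_mono mult_mono simp: power2_eq_square)
    have dis: "G.dissipation x = of_real (g\<^sup>2)"
      using grad_dissipation[OF x] by (simp add: g_def)
    define d where "d j = partial j (\<lambda>x. (norm (u x))\<^sup>2) x" for j
    \<comment> \<open>Re T_j equals half the j-th derivative d of |u|^2 minus a pressure term z.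
      Hence Re T_j * d = d^2/2 - z d \<ge> -z^2/2: the dangerous quadratic part has a good sign and
      only the bounded pressure is left.\<close>
    have tr: "Re (G.trunc_flux x) \<ge> - (1/2 * q\<^sup>2 * v\<^sup>2)"
    proof -
      have Tj: "Re (G.T j x) = d j / 2 - Re (p x * cnj (u x $ j))" for j
        using exhaust_2[of j] unfolding d_def partial_norm_sq_u[OF x] G.T_def grad_flux_def
        by (auto simp: sum_2 algebra_simps)
      have "Re (G.T j x * of_real (d j)) \<ge> - (1/2 * q\<^sup>2 * (cmod (u x $ j))\<^sup>2)" for j
      proof -
        define z where "z = Re (p x * cnj (u x $ j))"
        have "\<bar>z\<bar> \<le> q * cmod (u x $ j)"
          using abs_Re_le_cmod[of "p x * cnj (u x $ j)"] by (simp add: z_def q_def norm_mult)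
        then have "z\<^sup>2 \<le> q\<^sup>2 * (cmod (u x $ j))\<^sup>2"
          using power_mono[of "\<bar>z\<bar>" "q * cmod (u x $ j)" 2] by (simp add: power_mult_distrib)
        moreover have "(d j / 2 - z) * d j \<ge> - (1/2 * z\<^sup>2)"
          using zero_le_power2[of "d j - z"] by (simp add: power2_eq_square algebra_simps)
        moreover have "Re (G.T j x * of_real (d j)) = (d j / 2 - z) * d j"
          by (simp add: Tj z_def)
        ultimately show ?thesis by linarith
      qed
      from this[of 1] this[of 2] show ?thesis
        by (simp add: G.trunc_flux_def sum_2 d_def v_def norm_u_sq algebra_simps)
    qed
    have r3: "Re (of_real (eta R x * t') * G.trunc_flux x) \<ge> - (2 * M\<^sup>2)"
    proof -
      have "1/2 * q\<^sup>2 * (v\<^sup>2 * t') \<le> 1/2 * M\<^sup>2 * 4"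
        using M2 t b by (intro mult_mono mult_left_mono) auto
      then have A: "t' * (1/2 * q\<^sup>2 * v\<^sup>2) \<le> 2 * M\<^sup>2" by (simp add: algebra_simps)
      have "eta R x * (t' * (1/2 * q\<^sup>2 * v\<^sup>2)) \<le> 1 * (2 * M\<^sup>2)"
        by (rule mult_mono[OF eta_bounds(2) A]) (use t in auto)
      moreover have "(eta R x * t') * Re (G.trunc_flux x) \<ge> (eta R x * t') * (- (1/2 * q\<^sup>2 * v\<^sup>2))"
        using tr t eta_bounds[of R x] by (intro mult_left_mono) auto
      ultimately show ?thesis by (simp add: algebra_simps)
    qed
    \<comment> \<open>Young's inequality with weight 1/2: 32 * 32 / 2 = 512, and half of the
      dissipation remains.\<close>
    have r2: "Re (of_real t * G.cutoff_flux R x) \<ge> - (1/2 * (m\<^sup>2 * t * g\<^sup>2)) - 512 * M\<^sup>2 / R\<^sup>2 - 16 / R * M\<^sup>2"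
    proof -
      have "cmod (G.cutoff_flux R x) \<le> 16 / R * m * ((2 * g + q) * v)"
        using G.cutoff_flux_bound[OF x R] by (simp add: g_def q_def v_def m_def)
      also have "\<dots> = (m * g) * (32 * v / R) + (16 / R * m) * (q * v)" by (simp add: algebra_simps add_divide_distrib)
      also have "\<dots> \<le> (m\<^sup>2 * g\<^sup>2 / 2 + 512 * M\<^sup>2 / R\<^sup>2) + 16 / R * M\<^sup>2"
      proof (rule add_mono)
        have "2 * (m * g) * (32 * v / R) \<le> (m * g)\<^sup>2 + (32 * v / R)\<^sup>2" by (rule sum_squares_bound)
        also have "(32 * v / R)\<^sup>2 = 1024 * (v\<^sup>2 / R\<^sup>2)" by (simp add: power_mult_distrib power_divide)
        also have "v\<^sup>2 / R\<^sup>2 \<le> M\<^sup>2 / R\<^sup>2" using M2 by (intro divide_right_mono) auto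
        finally show "(m * g) * (32 * v / R) \<le> m\<^sup>2 * g\<^sup>2 / 2 + 512 * M\<^sup>2 / R\<^sup>2"
          by (simp add: power_mult_distrib)
        have "16 / R * m \<le> 16 / R * 1" using b R by (intro mult_left_mono) auto
        then show "(16 / R * m) * (q * v) \<le> 16 / R * M\<^sup>2"
          using M2 b R by (intro mult_mono) auto
      qed
      finally have c: "cmod (G.cutoff_flux R x) \<le> m\<^sup>2 * g\<^sup>2 / 2 + 512 * M\<^sup>2 / R\<^sup>2 + 16 / R * M\<^sup>2" .
      have "- Re (of_real t * G.cutoff_flux R x) \<le> t * cmod (G.cutoff_flux R x)"
        using abs_Re_le_cmod[of "of_real t * G.cutoff_flux R x"] t by (simp add: norm_mult)
      also have "\<dots> \<le> t * (m\<^sup>2 * g\<^sup>2 / 2 + 512 * M\<^sup>2 / R\<^sup>2 + 16 / R * M\<^sup>2)"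
        using c t by (intro mult_left_mono) auto
      also have "\<dots> = 1/2 * (m\<^sup>2 * t * g\<^sup>2) + t * (512 * M\<^sup>2 / R\<^sup>2 + 16 / R * M\<^sup>2)" by (simp add: algebra_simps)
      also have "t * (512 * M\<^sup>2 / R\<^sup>2 + 16 / R * M\<^sup>2) \<le> 1 * (512 * M\<^sup>2 / R\<^sup>2 + 16 / R * M\<^sup>2)"
        using t R by (intro mult_right_mono add_nonneg_nonneg) auto
      finally show ?thesis by simp
    qed
    have r1: "Re (of_real (eta R x * t) * (G.dissipation x - \<kappa> * of_real (v\<^sup>2))) \<ge> m\<^sup>2 * t * g\<^sup>2 - cmod \<kappa> * M\<^sup>2"
    proof -
      have "Re \<kappa> * v\<^sup>2 \<le> cmod \<kappa> * M\<^sup>2"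
        using complex_Re_le_cmod[of \<kappa>] M2 by (intro mult_mono) auto
      moreover have "(m\<^sup>2 * t) * (cmod \<kappa> * M\<^sup>2) \<le> 1 * (cmod \<kappa> * M\<^sup>2)"
        using t b by (intro mult_right_mono) (auto simp: mult_le_one power_le_one)
      ultimately have "(m\<^sup>2 * t) * (Re \<kappa> * v\<^sup>2) \<le> cmod \<kappa> * M\<^sup>2"
        using t by (smt (verit, best) mult_left_mono mult_nonneg_nonneg zero_le_power2)
      then show ?thesis unfolding dis eta_eq m_def[symmetric] by (simp add: algebra_simps)
    qed
    have "I n x = of_real (eta R x * t) * (G.dissipation x - \<kappa> * of_real (v\<^sup>2)) + of_real t * G.cutoff_flux R x
        + of_real (eta R x * t') * G.trunc_flux x"
      unfolding I_def G.energy_density_def v_def t_def t'_def using x by simp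
    then have "Re (I n x) \<ge> (m\<^sup>2 * t * g\<^sup>2 - cmod \<kappa> * M\<^sup>2) + (- (1/2 * (m\<^sup>2 * t * g\<^sup>2)) - 512 * M\<^sup>2 / R\<^sup>2 - 16 / R * M\<^sup>2) + (- (2 * M\<^sup>2))"
      using add_mono[OF add_mono[OF r1 r2] r3] by (simp only: plus_complex.sel)
    moreover have "f n x = 1/2 * (m\<^sup>2 * t * g\<^sup>2)"
      using x by (simp add: f_def eta_eq m_def v_def t_def g_def)
    ultimately have "f n x \<le> Re (I n x) + C" unfolding C_def by linarith
    then show ?thesis using nx by simp
  qed
  \<comment> \<open>The bound does not involve \<open>n\<close>, since each \<open>I n\<close>
    integrates to 0; this is the input for Fatou's lemma.\<close>
  have intf: "(\<integral>\<^sup>+x. ennreal (f n x) \<partial>lborel) \<le> ennreal (C * measure lborel (cball (0::real^2) R))" for n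
  proof -
    have iC: "integrable lborel (\<lambda>x::real^2. C * indicator (cball 0 R) x)"
      using emeasure_cball_lt_top[of R] by (intro integrable_mult_right integrable_real_indicator) auto
    have iR: "integrable lborel (\<lambda>x. Re (I n x))" using I(1) by (rule integrable_Re)
    have int: "integrable lborel (\<lambda>x. Re (I n x) + C * indicator (cball 0 R) x)"
      by (intro Bochner_Integration.integrable_add iR iC)
    have "(\<integral>\<^sup>+x. ennreal (f n x) \<partial>lborel) \<le> (\<integral>\<^sup>+x. ennreal (Re (I n x) + C * indicator (cball 0 R) x) \<partial>lborel)"
      by (intro nn_integral_mono ennreal_leI fle)
    also have "\<dots> = ennreal (\<integral>x. Re (I n x) + C * indicator (cball 0 R) x \<partial>lborel)"
      using order_trans[OF f0 fle] by (intro nn_integral_eq_integral int) auto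
    also have "(\<integral>x. Re (I n x) + C * indicator (cball 0 R) x \<partial>lborel) = C * measure lborel (cball (0::real^2) R)"
      using iR iC I(1)[of n] I(2)[of n] by (simp add: Bochner_Integration.integral_add)
    finally show ?thesis .
  qed
  have fm: "f n \<in> borel_measurable lborel" for n
  proof -
    have "continuous_on E (\<lambda>x. trunc (?e n) (?s x))"
      by (rule C1_on_continuous[OF C1_on_compose_real(1)[OF norm_sq_u_C1 trunc_derivative trunc'_continuous]]) auto
    then have "continuous_on E (\<lambda>x. 1/2 * eta R x * trunc (?e n) (?s x) * (du_norm x)\<^sup>2)"
      by (intro continuous_intros continuous_eta cont_du_norm)
    from E_measurable[OF this] show ?thesis by (simp add: f_def[abs_def])
  qed
  define F where "F x = indicator supp_u x * (1/2 * (eta R x * (du_norm x)\<^sup>2))" for x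
  have F0: "F x \<ge> 0" for x unfolding F_def using eta_bounds[of R x] by auto
  have lim: "(\<lambda>n. ennreal (f n x)) \<longlonglongrightarrow> ennreal (F x)" if "x \<in> supp_u" for x
  proof -
    have "x \<in> E" "?s x > 0" using that by (auto simp: supp_u_def)
    then have "(\<lambda>n. f n x) \<longlonglongrightarrow> 1 * (1/2 * eta R x * 1 * (du_norm x)\<^sup>2)"
      unfolding f_def by (intro tendsto_intros trunc_limits) auto
    then show ?thesis using that by (intro tendsto_ennrealI) (simp add: F_def)
  qed
  have "(\<integral>\<^sup>+x. ennreal (F x) \<partial>lborel) \<le> (\<integral>\<^sup>+x. liminf (\<lambda>n. ennreal (f n x)) \<partial>lborel)"
  proof (rule nn_integral_mono)
    fix x
    show "ennreal (F x) \<le> liminf (\<lambda>n. ennreal (f n x))"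
    proof (cases "x \<in> supp_u")
      case True
      then show ?thesis using lim_imp_Liminf[OF _ lim[OF True]] by simp
    qed (simp add: F_def)
  qed
  also have "\<dots> \<le> liminf (\<lambda>n. \<integral>\<^sup>+x. ennreal (f n x) \<partial>lborel)"
    using fm by (intro nn_integral_liminf) auto
  also have "\<dots> \<le> liminf (\<lambda>n. ennreal (C * measure lborel (cball (0::real^2) R)))"
    by (intro Liminf_mono always_eventually allI intf)
  also have "\<dots> < \<infinity>" by (simp add: Liminf_const)
  finally have fin: "(\<integral>\<^sup>+x. ennreal (F x) \<partial>lborel) < \<infinity>" .
  have Fm: "F \<in> borel_measurable lborel"
  proof -
    have "continuous_on E (\<lambda>x. 1/2 * (eta R x * (du_norm x)\<^sup>2))"
      by (intro continuous_intros continuous_eta cont_du_norm)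
    from supp_measurable[OF this] show ?thesis by (simp add: F_def[abs_def])
  qed
  have "integrable lborel F"
    using Fm fin F0 by (intro integrableI_nonneg) auto
  then have "integrable lborel (\<lambda>x. 2 * F x)" by simp
  moreover have "(\<lambda>x. 2 * F x) = (\<lambda>x. indicator supp_u x * (eta R x * (du_norm x)\<^sup>2))"
    by (simp add: F_def fun_eq_iff)
  ultimately show ?thesis by simp
qed

text \<open>On the half-radius disc \<open>eta\<close> is at least (3/4)^2, whence the factor
  16/9.\<close>

lemma grad_L2: "integrable lborel (\<lambda>x. indicator (supp_u \<inter> cball 0 R) x * (du_norm x)\<^sup>2)"
proof -
  define R' where "R' = 2 * max R 1"
  have R': "R' > 0" "norm x \<le> R \<Longrightarrow> 2 * norm x \<le> R'" for x :: "real^2" by (auto simp: R'_def)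
  have m: "(\<lambda>x. indicator (supp_u \<inter> cball 0 R) x * (du_norm x)\<^sup>2) \<in> borel_measurable lborel"
  proof -
    have "(\<lambda>x. indicator (cball 0 R) x * (indicator supp_u x *\<^sub>R (du_norm x)\<^sup>2)) \<in> borel_measurable borel"
      using cont_du_norm by (intro borel_measurable_times borel_measurable_indicator supp_measurable continuous_intros) auto
    then show ?thesis by (simp add: indicator_inter_arith mult.commute mult.left_commute)
  qed
  show ?thesis
  proof (rule Bochner_Integration.integrable_bound[OF integrable_mult_right[OF grad_L2_eta[OF R'(1)], of "16/9"] m], rule AE_I2)
    fix x
    show "norm (indicator (supp_u \<inter> cball 0 R) x * (du_norm x)\<^sup>2)
      \<le> norm (16/9 * (indicator supp_u x * (eta R' x * (du_norm x)\<^sup>2)))"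
    proof (cases "x \<in> supp_u \<and> norm x \<le> R")
      case True
      then have "3/4 \<le> eta_root R' x" using eta_root_inside[OF R'(1)] R'(2) by blast
      then have "(3/4)\<^sup>2 \<le> eta R' x" unfolding eta_eq by (intro power_mono) auto
      then have "1 \<le> 16/9 * eta R' x" by (simp add: power2_eq_square)
      then have "1 * (du_norm x)\<^sup>2 \<le> 16/9 * eta R' x * (du_norm x)\<^sup>2" by (intro mult_right_mono) auto
      then show ?thesis using True eta_bounds[of R' x] by simp
    qed auto
  qed
qed

end

section \<open>Radiation\<close>

lemma measure_cball_plane: "R \<ge> 0 \<Longrightarrow> measure lborel (cball (0::real^2) R) = pi * R\<^sup>2"
  using content_cball[of R "0::real^2"] by (simp add: unit_ball_vol_2)

lemma norm_sq_vec2: "(norm (v :: complex^2))\<^sup>2 = (cmod (v $ 1))\<^sup>2 + (cmod (v $ 2))\<^sup>2"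
  by (simp add: norm_vec_def L2_set_def sum_2)

text \<open>A complex scalar \<open>a\<close> is traded for a boundary term by \<open>|t - a u|\<^sup>2 = |t|\<^sup>2 + |a|\<^sup>2|u|\<^sup>2 - 2 Re (t \<cdot> cnj (a u))\<close>
  with \<open>a = i k\<close>.\<close>

lemma cmod_sq_diff_ik:
  "(cmod (t - \<i> * k * v))\<^sup>2 = (cmod t)\<^sup>2 + (cmod k)\<^sup>2 * (cmod v)\<^sup>2 - 2 * Im (cnj k * (t * cnj v))"
  unfolding cmod_power2 by (simp add: power2_eq_square algebra_simps)

context stokes_flow
begin

definition stress_flux :: "2 \<Rightarrow> 2 \<Rightarrow> real^2 \<Rightarrow> complex" where
  "stress_flux i j = (if i = j then (\<lambda>x. 2 * du i j x - p x) else (\<lambda>x. du i j x + du j i x))"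

text \<open>This is 2|e(u)|^2 written out: the off-diagonal strain appears twice and carries the
  factor 1/2. Only its nonnegativity matters later.\<close>

definition strain_sq :: "real^2 \<Rightarrow> real" where
  "strain_sq x = 2 * (cmod (du 1 1 x))\<^sup>2 + 2 * (cmod (du 2 2 x))\<^sup>2 + (cmod (du 1 2 x + du 2 1 x))\<^sup>2"

lemma C1_2du: "C1_on E (\<lambda>x. 2 * du i j x)"
  by (rule C1_on_mult[OF C1_on_const C1_du])

lemma partial_2du: "x \<in> E \<Longrightarrow> partial l (\<lambda>x. 2 * du i j x) x = 2 * partial l (du i j) x"
  by (rule partial_bounded_linear[OF differentiable_du bounded_linear_mult_right])

text \<open>Compared with \<Delta>u - grad p the divergence has the additional term grad (div u),
  which vanishes after the mixed partials are interchanged.\<close>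

lemma momentum_flux_stress: "momentum_flux E u p \<kappa> stress_flux"
proof unfold_locales
  show "C1_on E (stress_flux i j)" for i j
    unfolding stress_flux_def by (auto intro!: C1_on_diff C1_on_add C1_du C1_2du C1_p)
  show "partial 1 (stress_flux i 1) x + partial 2 (stress_flux i 2) x = - \<kappa> * u x $ i" if x: "x \<in> E" for x i
  proof -
    note c = momentum_du[OF x, of 2] momentum_du[OF x, of 1] partial_du_commute[OF x, of 2 2 1]
      partial_du_commute[OF x, of 1 1 2] partial_div_du[OF x, of 1] partial_div_du[OF x, of 2]
    have "i = 1 \<or> i = 2" by (rule exhaust_2)
    then show ?thesis
    proof
      assume i: "i = 1"
      have "partial 1 (stress_flux i 1) x + partial 2 (stress_flux i 2) x
        = 2 * partial 1 (du 1 1) x - partial 1 p x + (partial 2 (du 1 2) x + partial 2 (du 2 1) x)"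
        using x by (simp add: i stress_flux_def partial_diff partial_add partial_2du differentiable_du differentiable_p
            C1_on_differentiable[OF C1_2du])
      also have "\<dots> = (partial 1 (du 1 1) x + partial 2 (du 1 2) x) + (partial 1 (du 1 1) x + partial 1 (du 2 2) x) - partial 1 p x"
        by (simp add: c(3))
      finally show ?thesis unfolding c by (simp add: i)
    next
      assume i: "i = 2"
      have "partial 1 (stress_flux i 1) x + partial 2 (stress_flux i 2) x
        = (partial 1 (du 2 1) x + partial 1 (du 1 2) x) + (2 * partial 2 (du 2 2) x - partial 2 p x)"
        using x by (simp add: i stress_flux_def partial_diff partial_add partial_2du differentiable_du differentiable_p
            C1_on_differentiable[OF C1_2du])
      also have "\<dots> = (partial 1 (du 2 1) x + partial 2 (du 2 2) x) + (partial 2 (du 1 1) x + partial 2 (du 2 2) x) - partial 2 p x"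
        by (simp add: c(4))
      finally show ?thesis unfolding c by (simp add: i)
    qed
  qed
  show "cmod (stress_flux i j x) \<le> 2 * du_norm x + cmod (p x)" if x: "x \<in> E" for x i j
  proof (cases "i = j")
    case True
    have "cmod (2 * du i j x - p x) \<le> cmod (2 * du i j x) + cmod (p x)" by (rule norm_triangle_ineq4)
    then show ?thesis using True du_le[of i j x] by (simp add: stress_flux_def norm_mult)
  next
    case False
    have "cmod (du i j x + du j i x) \<le> 2 * du_norm x + cmod (p x)"
      using norm_triangle_ineq[of "du i j x" "du j i x"] du_le[of i j x] du_le[of j i x] norm_ge_zero[of "p x"]
      by linarith
    then show ?thesis using False by (simp add: stress_flux_def)
  qed
qed

lemma stress_component: "stress u p x $ i $ j = stress_flux i j x"
  by (simp add: stress_def strain_def stress_flux_def mat_def du_def scaleR_conv_of_real)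

definition work :: "real^2 \<Rightarrow> complex" where
  "work x = (\<Sum>i\<in>UNIV. traction u p x $ i * cnj (u x $ i))"

lemma traction_component:
  "traction u p x $ i = stress_flux i 1 x * of_real (x $ 1 / norm x) + stress_flux i 2 x * of_real (x $ 2 / norm x)"
  by (simp add: traction_def matrix_vector_mult_def sum_2 stress_component)

text \<open>The gradient of \<open>eta\<close> is -4 \<open>eta_root\<close> x / R^2, so the flux
  across it is |x| times the flux in direction x/|x|, that is, the traction on the circle through
  x.\<close>

lemma stress_cutoff_flux:
  "momentum_flux.cutoff_flux u stress_flux R x = - of_real (4 * eta_root R x * norm x / R\<^sup>2) * work x"
proof -
  interpret Q: momentum_flux E u p \<kappa> stress_flux by (rule momentum_flux_stress)
  \<comment> \<open>Multiplying by |x| makes the formula valid at the origin too, where division by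
    zero gives traction 0.\<close>
  have t: "of_real (norm x) * traction u p x $ i = stress_flux i 1 x * of_real (x $ 1) + stress_flux i 2 x * of_real (x $ 2)" for i
    unfolding traction_component by (cases "x = 0") (auto simp: algebra_simps)
  have "of_real (norm x) * work x = (of_real (norm x) * traction u p x $ 1) * cnj (u x $ 1)
      + (of_real (norm x) * traction u p x $ 2) * cnj (u x $ 2)"
    by (simp add: work_def sum_2 algebra_simps)
  also have "\<dots> = Q.T 1 x * of_real (x $ 1) + Q.T 2 x * of_real (x $ 2)"
    unfolding t by (simp add: Q.T_def sum_2 algebra_simps)
  finally have "of_real (norm x) * work x = Q.T 1 x * of_real (x $ 1) + Q.T 2 x * of_real (x $ 2)" .
  then have "- of_real (4 * eta_root R x / R\<^sup>2) * (of_real (norm x) * work x)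
     = - of_real (4 * eta_root R x / R\<^sup>2) * (Q.T 1 x * of_real (x $ 1) + Q.T 2 x * of_real (x $ 2))" by simp
  then show ?thesis
    by (simp add: Q.cutoff_flux_def sum_2 partial_eta algebra_simps)
qed

lemma stress_dissipation:
  assumes "x \<in> E"
  shows "momentum_flux.dissipation u stress_flux x = of_real (strain_sq x)"
proof -
  interpret Q: momentum_flux E u p \<kappa> stress_flux by (rule momentum_flux_stress)
  have "Q.dissipation x = 2 * (du 1 1 x * cnj (du 1 1 x)) + 2 * (du 2 2 x * cnj (du 2 2 x))
     + (du 1 2 x + du 2 1 x) * cnj (du 1 2 x + du 2 1 x) - p x * cnj (du 1 1 x + du 2 2 x)"
    by (simp add: Q.dissipation_def stress_flux_def sum_2 algebra_simps)
  also have "\<dots> = of_real (strain_sq x)"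
    unfolding div_free_du[OF assms] strain_sq_def of_real_add of_real_mult complex_norm_square by simp
  finally show ?thesis .
qed

text \<open>An inequality is enough: the squared traction and the strain dissipation enter with a
  good sign when Im k \<ge> 0 and are dropped, leaving |u|^2 on one side and the radiation defect on
  the other.\<close>

lemma radiation_balance:
  assumes k: "\<kappa> = k\<^sup>2" "Im k \<ge> 0" and R: "R > 0"
  defines "rad \<equiv> \<lambda>x. (norm (traction u p x - (\<i> * k) *s u x))\<^sup>2"
  defines "L \<equiv> \<lambda>x. indicator supp_u x * ((2 * Im k * eta R x + 4 * eta_root R x * norm x / R\<^sup>2) * ((cmod k)\<^sup>2 * (norm (u x))\<^sup>2))"
  shows "integrable lborel L"
    and "integrable lborel (\<lambda>x. indicator (supp_u \<inter> cball 0 r) x * rad x)"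
    and "integral\<^sup>L lborel L \<le> (\<integral>x. indicator (supp_u \<inter> cball 0 R) x * (4 * eta_root R x * norm x / R\<^sup>2 * rad x) \<partial>lborel)"
    and "integrable lborel (\<lambda>x. indicator (supp_u \<inter> cball 0 R) x * (4 * eta_root R x * norm x / R\<^sup>2 * rad x))"
proof -
  interpret Q: momentum_flux E u p \<kappa> stress_flux by (rule momentum_flux_stress)
  have cont_root: "continuous_on A (eta_root R)" for A unfolding eta_root_def[abs_def] by (intro continuous_intros) (use R in auto)
  show iL: "integrable lborel L"
  proof -
    obtain M where M: "M \<ge> 1" "\<And>x. x \<in> E \<Longrightarrow> norm x \<le> R \<Longrightarrow> norm (u x) \<le> M \<and> cmod (p x) \<le> M"
      by (rule flow_bounded[of R]) blast
    let ?B = "(2 * Im k + 4 * R / R\<^sup>2) * ((cmod k)\<^sup>2 * M\<^sup>2)"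
    have "continuous_on E (\<lambda>x. (2 * Im k * eta R x + 4 * eta_root R x * norm x / R\<^sup>2) * ((cmod k)\<^sup>2 * (norm (u x))\<^sup>2))"
      by (intro continuous_intros continuous_eta cont_root cont_u_E) (use R in auto)
    from supp_measurable[OF this] have m: "L \<in> borel_measurable lborel" by (simp add: L_def)
    have iB: "integrable lborel (\<lambda>x::real^2. ?B * indicator (cball 0 R) x)"
      using emeasure_cball_lt_top[of R] by (intro integrable_mult_right integrable_real_indicator) auto
    show ?thesis
    proof (rule Bochner_Integration.integrable_bound[OF iB m], rule AE_I2)
      fix x
      have c: "0 \<le> 2 * Im k * eta R x + 4 * eta_root R x * norm x / R\<^sup>2"
        using k eta_bounds[of R x] eta_root_bounds[of R x] by (intro add_nonneg_nonneg) auto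
      show "norm (L x) \<le> norm (?B * indicator (cball 0 R) x)"
      proof (cases "x \<in> supp_u \<and> norm x \<le> R")
        case True
        then have x: "x \<in> E" by (simp add: supp_u_def)
        have "2 * Im k * eta R x + 4 * eta_root R x * norm x / R\<^sup>2 \<le> 2 * Im k * 1 + 4 * 1 * R / R\<^sup>2"
          using True k eta_bounds[of R x] eta_root_bounds[of R x] R
          by (intro add_mono mult_left_mono divide_right_mono mult_mono) auto
        moreover have "(cmod k)\<^sup>2 * (norm (u x))\<^sup>2 \<le> (cmod k)\<^sup>2 * M\<^sup>2"
          using M(2)[OF x] True by (intro mult_left_mono power_mono) auto
        ultimately have "(2 * Im k * eta R x + 4 * eta_root R x * norm x / R\<^sup>2) * ((cmod k)\<^sup>2 * (norm (u x))\<^sup>2)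
            \<le> (2 * Im k * 1 + 4 * 1 * R / R\<^sup>2) * ((cmod k)\<^sup>2 * M\<^sup>2)"
          by (rule mult_mono) (use k R in \<open>auto intro!: add_nonneg_nonneg\<close>)
        then have "L x \<le> ?B" using True by (simp add: L_def)
        moreover have "L x \<ge> 0" using c by (simp add: L_def)
        ultimately show ?thesis using True by simp
      next
        case False
        then have "L x = 0" using eta_root_outside[OF R, of x] by (auto simp: L_def eta_eq)
        then show ?thesis by simp
      qed
    qed
  qed
  \<comment> \<open>Near the boundary the defect is as singular as the gradient, so its
    integrability rests on \<open>grad_L2\<close>. The constants come from 2(a+b+c)^2 \<le>
    6(a^2+b^2+c^2) with a = 4|grad u| and b = 2|p|.\<close>
  have rad_le: "rad x \<le> 96 * (du_norm x)\<^sup>2 + 24 * (cmod (p x))\<^sup>2 + 6 * (cmod k)\<^sup>2 * (norm (u x))\<^sup>2" if x: "x \<in> E" for x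
  proof -
    define a where "a = 4 * du_norm x" define b where "b = 2 * cmod (p x)" define c where "c = cmod k * norm (u x)"
    have "cmod ((traction u p x - (\<i> * k) *s u x) $ i) \<le> a + b + c" for i
    proof -
      have q: "cmod (stress_flux i j x * of_real (x $ j / norm x)) \<le> (2 * du_norm x + cmod (p x)) * 1" for j
        unfolding norm_mult norm_of_real
      proof (rule mult_mono[OF Q.S_le[OF x]])
        show "\<bar>x $ j / norm x\<bar> \<le> 1" using component_le_norm_cart[of x j] by (cases "x = 0") (auto simp: divide_simps)
      qed (use du_norm_nonneg[of x] in auto)
      have "cmod (traction u p x $ i) \<le> (2 * du_norm x + cmod (p x)) * 1 + (2 * du_norm x + cmod (p x)) * 1"
        unfolding traction_component by (rule order_trans[OF norm_triangle_ineq add_mono[OF q q]])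
      moreover have "cmod (\<i> * k * u x $ i) \<le> c"
        using component_le[of x i] by (auto simp: norm_mult c_def intro: mult_left_mono)
      ultimately show ?thesis
        using norm_triangle_ineq4[of "traction u p x $ i" "\<i> * k * u x $ i"] by (simp add: a_def b_def)
    qed
    then have "(cmod ((traction u p x - (\<i> * k) *s u x) $ i))\<^sup>2 \<le> (a + b + c)\<^sup>2" for i
      by (intro power_mono) auto
    from add_mono[OF this[of 1] this[of 2]] have "rad x \<le> 2 * (a + b + c)\<^sup>2"
      by (simp add: rad_def norm_sq_vec2)
    also have "\<dots> \<le> 6 * a\<^sup>2 + 6 * b\<^sup>2 + 6 * c\<^sup>2"
      using zero_le_power2[of "a - b"] zero_le_power2[of "a - c"] zero_le_power2[of "b - c"]
      by (simp add: power2_eq_square algebra_simps)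
    finally show ?thesis by (simp add: a_def b_def c_def power_mult_distrib mult.assoc)
  qed
  \<comment> \<open>The direction x/|x| is discontinuous at the origin, which may lie in
    \<open>E\<close>; that single point is split off.\<close>
  have rad_m: "(\<lambda>x. indicator supp_u x * rad x) \<in> borel_measurable borel"
  proof -
    have cs: "continuous_on (E - {0}) (stress_flux i j)" for i j
      using C1_on_continuous[OF Q.C1_S] continuous_on_subset by blast
    have cu: "continuous_on (E - {0}) (\<lambda>x. u x $ i)" for i
      using C1_on_continuous[OF C1_component] continuous_on_subset by blast
    have cx: "continuous_on (E - {0}) (\<lambda>x::real^2. complex_of_real (x $ j / norm x))" for j
      by (intro continuous_on_of_real continuous_on_divide continuous_on_component continuous_on_norm continuous_on_id) auto
    have ct: "continuous_on (E - {0}) (\<lambda>x. traction u p x $ i)" for i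
      unfolding traction_component by (intro continuous_on_add continuous_on_mult cs cx)
    have "rad x = (cmod (traction u p x $ 1 - \<i> * k * u x $ 1))\<^sup>2 + (cmod (traction u p x $ 2 - \<i> * k * u x $ 2))\<^sup>2" for x
      by (simp add: rad_def norm_sq_vec2)
    moreover have "continuous_on (E - {0}) (\<lambda>x. (cmod (traction u p x $ 1 - \<i> * k * u x $ 1))\<^sup>2 + (cmod (traction u p x $ 2 - \<i> * k * u x $ 2))\<^sup>2)"
      by (intro continuous_on_add continuous_on_power continuous_on_norm continuous_on_diff continuous_on_mult ct cu continuous_on_const)
    ultimately have "continuous_on (E - {0}) rad" by (simp cong: continuous_on_cong)
    then have "continuous_on (supp_u - {0}) rad" using supp_u_subset by (elim continuous_on_subset) auto
    then have "(\<lambda>x. indicator (supp_u - {0}) x *\<^sub>R rad x) \<in> borel_measurable borel"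
      using open_supp_u by (intro borel_measurable_continuous_on_indicator) auto
    moreover have "(\<lambda>x. indicator (supp_u \<inter> {0}) x *\<^sub>R rad 0) \<in> borel_measurable borel"
      using open_supp_u by (intro borel_measurable_scaleR borel_measurable_indicator borel_measurable_const sets.Int[OF borel_open borel_closed]) auto
    ultimately have "(\<lambda>x. indicator (supp_u - {0}) x *\<^sub>R rad x + indicator (supp_u \<inter> {0}) x *\<^sub>R rad 0) \<in> borel_measurable borel"
      by (rule borel_measurable_add)
    moreover have "(\<lambda>x. indicator (supp_u - {0}) x *\<^sub>R rad x + indicator (supp_u \<inter> {0}) x *\<^sub>R rad 0) = (\<lambda>x. indicator supp_u x * rad x)"
      by (auto simp: fun_eq_iff indicator_def)
    ultimately show ?thesis by simp
  qed
  show irad: "integrable lborel (\<lambda>x. indicator (supp_u \<inter> cball 0 r) x * rad x)" for r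
  proof -
    obtain M where M: "M \<ge> 1" "\<And>x. x \<in> E \<Longrightarrow> norm x \<le> r \<Longrightarrow> norm (u x) \<le> M \<and> cmod (p x) \<le> M"
      by (rule flow_bounded[of r]) blast
    have "(\<lambda>x. indicator (cball 0 r) x * (indicator supp_u x * rad x)) \<in> borel_measurable borel"
      by (intro borel_measurable_times borel_measurable_indicator rad_m) auto
    then have m: "(\<lambda>x. indicator (supp_u \<inter> cball 0 r) x * rad x) \<in> borel_measurable lborel"
      by (simp add: indicator_inter_arith mult.commute mult.left_commute)
    let ?w = "\<lambda>x. 96 * (indicator (supp_u \<inter> cball 0 r) x * (du_norm x)\<^sup>2)
       + (24 * M\<^sup>2 + 6 * (cmod k)\<^sup>2 * M\<^sup>2) * indicator (cball 0 r) x"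
    have w: "integrable lborel ?w"
      using grad_L2[of r] emeasure_cball_lt_top[of r]
      by (intro Bochner_Integration.integrable_add integrable_mult_right integrable_real_indicator) auto
    show ?thesis
    proof (rule Bochner_Integration.integrable_bound[OF w m], rule AE_I2)
      fix x
      show "norm (indicator (supp_u \<inter> cball 0 r) x * rad x) \<le> norm (?w x)"
      proof (cases "x \<in> supp_u \<and> norm x \<le> r")
        case True
        then have x: "x \<in> E" by (simp add: supp_u_def)
        have "(cmod (p x))\<^sup>2 \<le> M\<^sup>2" "(cmod k)\<^sup>2 * (norm (u x))\<^sup>2 \<le> (cmod k)\<^sup>2 * M\<^sup>2"
          using M(2)[OF x] True by (auto intro!: power_mono mult_left_mono)
        then have "rad x \<le> ?w x" using rad_le[OF x] True by simp
        moreover have "0 \<le> rad x" by (simp add: rad_def)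
        ultimately show ?thesis using True by simp
      qed auto
    qed
  qed
  define X where "X x = indicator (supp_u \<inter> cball 0 R) x * (4 * eta_root R x * norm x / R\<^sup>2 * rad x)" for x
  have iX: "integrable lborel X"
  proof -
    have "(\<lambda>x. 4 * eta_root R x * norm x / R\<^sup>2) \<in> borel_measurable borel"
      by (intro borel_measurable_continuous_onI continuous_intros cont_root) (use R in auto)
    then have "(\<lambda>x. 4 * eta_root R x * norm x / R\<^sup>2) \<in> borel_measurable lborel" by simp
    from borel_measurable_times[OF this borel_measurable_integrable[OF irad[of R]]]
    have m: "X \<in> borel_measurable lborel" by (simp add: X_def[abs_def] mult.left_commute)
    show ?thesis
    proof (rule Bochner_Integration.integrable_bound[OF integrable_mult_right[OF irad[of R], of "4 * R / R\<^sup>2"] m], rule AE_I2)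
      fix x
      show "norm (X x) \<le> norm (4 * R / R\<^sup>2 * (indicator (supp_u \<inter> cball 0 R) x * rad x))"
      proof (cases "x \<in> supp_u \<and> norm x \<le> R")
        case True
        have "4 * eta_root R x * norm x / R\<^sup>2 \<le> 4 * 1 * R / R\<^sup>2"
          using True eta_root_bounds[of R x] R by (intro divide_right_mono mult_mono) auto
        then have "4 * eta_root R x * norm x / R\<^sup>2 * rad x \<le> 4 * R / R\<^sup>2 * rad x"
          by (intro mult_right_mono) (auto simp: rad_def)
        moreover have "0 \<le> 4 * eta_root R x * norm x / R\<^sup>2 * rad x"
          using eta_root_bounds[of R x] by (auto simp: rad_def)
        ultimately have "\<bar>4 * eta_root R x * norm x / R\<^sup>2 * rad x\<bar> \<le> \<bar>4 * R / R\<^sup>2 * rad x\<bar>" by linarith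
        moreover have "indicator (supp_u \<inter> cball 0 R) x = (1::real)" using True by simp
        ultimately show ?thesis by (simp only: X_def real_norm_def mult_1)
      qed (auto simp: X_def)
    qed
  qed
  then show "integrable lborel (\<lambda>x. indicator (supp_u \<inter> cball 0 R) x * (4 * eta_root R x * norm x / R\<^sup>2 * rad x))"
    by (simp add: X_def[abs_def])
  define F where "F x = indicator supp_u x *\<^sub>R
    (of_real (eta R x) * (Q.dissipation x - \<kappa> * of_real ((norm (u x))\<^sup>2)) + Q.cutoff_flux R x)" for x
  have F: "integrable lborel F" "integral\<^sup>L lborel F = 0"
    using Q.energy_identity[OF R grad_L2] by (simp_all add: F_def[abs_def])
  have iF: "integrable lborel (\<lambda>x. Im (cnj k * F x))"
    by (intro integrable_Im integrable_mult_right F)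
  have zF: "(\<integral>x. Im (cnj k * F x) \<partial>lborel) = 0"
    using F by (simp add: integral_Im[OF integrable_mult_right[OF F(1)]])
  have pt: "L x \<le> X x - 2 * Im (cnj k * F x)" for x
  proof (cases "x \<in> supp_u")
    case False
    then show ?thesis by (simp add: L_def X_def F_def)
  next
    case True
    then have x: "x \<in> E" by (simp add: supp_u_def)
    define s where "s = (norm (u x))\<^sup>2"
    define c where "c = 4 * eta_root R x * norm x / R\<^sup>2"
    have c: "c \<ge> 0" using eta_root_bounds[of R x] by (simp add: c_def)
    have rd: "rad x = (norm (traction u p x))\<^sup>2 + (cmod k)\<^sup>2 * s - 2 * Im (cnj k * work x)"
    proof -
      have "(traction u p x - (\<i> * k) *s u x) $ i = traction u p x $ i - \<i> * k * u x $ i" for i by simp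
      then show ?thesis
        unfolding rad_def norm_sq_vec2 s_def work_def sum_2 by (simp only: cmod_sq_diff_ik distrib_left plus_complex.sel)
    qed
    have Fx: "F x = of_real (eta R x) * (of_real (strain_sq x) - k\<^sup>2 * of_real s) - of_real c * work x"
      using True x by (simp add: F_def stress_dissipation stress_cutoff_flux k s_def c_def)
    \<comment> \<open>The reason for multiplying by the conjugate of k: the strain term gets the
      factor cnj k and the mass term -|k|^2 k, so both imaginary parts are the same negative
      multiple of Im k.\<close>
    have kk: "cnj k * k\<^sup>2 = of_real ((cmod k)\<^sup>2) * k"
      by (simp only: power2_eq_square[of k] complex_norm_square mult_ac)
    have "cnj k * F x = of_real (eta R x) * (of_real (strain_sq x) * cnj k - of_real ((cmod k)\<^sup>2 * s) * k) - of_real c * (cnj k * work x)"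
      unfolding Fx using kk by (simp add: algebra_simps)
    then have ImF: "Im (cnj k * F x) = - (eta R x * Im k * (strain_sq x + (cmod k)\<^sup>2 * s)) - c * Im (cnj k * work x)"
      by (simp only: ) (simp add: algebra_simps)
    have Xx: "X x = c * rad x"
    proof (cases "norm x \<le> R")
      case False
      then show ?thesis using eta_root_outside[OF R, of x] by (simp add: X_def c_def)
    qed (use True in \<open>simp add: X_def c_def\<close>)
    have "X x - 2 * Im (cnj k * F x) = c * (norm (traction u p x))\<^sup>2 + c * ((cmod k)\<^sup>2 * s)
        + 2 * (eta R x * Im k * strain_sq x) + 2 * eta R x * Im k * ((cmod k)\<^sup>2 * s)"
      unfolding Xx rd ImF by (simp add: algebra_simps)
    moreover have "0 \<le> c * (norm (traction u p x))\<^sup>2" "0 \<le> 2 * (eta R x * Im k * strain_sq x)"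
      using c k eta_bounds[of R x] by (auto simp: strain_sq_def intro!: mult_nonneg_nonneg)
    moreover have "L x = c * ((cmod k)\<^sup>2 * s) + 2 * eta R x * Im k * ((cmod k)\<^sup>2 * s)"
      using True by (simp add: L_def c_def s_def algebra_simps)
    ultimately show ?thesis by linarith
  qed
  have "integral\<^sup>L lborel L \<le> (\<integral>x. X x - 2 * Im (cnj k * F x) \<partial>lborel)"
    by (intro integral_mono iL Bochner_Integration.integrable_diff iX integrable_mult_right iF pt)
  also have "\<dots> = integral\<^sup>L lborel X"
    by (simp only: Bochner_Integration.integral_diff[OF iX integrable_mult_right[OF iF]] integral_mult_right_zero zF mult_zero_right diff_zero)
  finally show "integral\<^sup>L lborel L \<le> (\<integral>x. indicator (supp_u \<inter> cball 0 R) x * (4 * eta_root R x * norm x / R\<^sup>2 * rad x) \<partial>lborel)"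
    by (simp add: X_def[abs_def])
qed

end

lemma vanishing_integral_open:
  fixes f :: "'a::euclidean_space \<Rightarrow> real"
  assumes U: "open U" and f: "continuous_on U f" "\<And>x. x \<in> U \<Longrightarrow> f x \<ge> 0"
    and int: "integrable lborel (\<lambda>x. indicator U x * f x)"
    and le: "(\<integral>x. indicator U x * f x \<partial>lborel) \<le> 0"
    and x: "x \<in> U"
  shows "f x = 0"
proof (rule ccontr)
  assume ne: "f x \<noteq> 0"
  have nn: "0 \<le> indicator U x * f x" for x using f(2) by (cases "x \<in> U") auto
  have "(\<integral>x. indicator U x * f x \<partial>lborel) = 0"
    using le integral_nonneg_AE[of "\<lambda>x. indicator U x * f x" lborel] nn by (simp add: order_antisym)
  then have "AE x in lborel. indicator U x * f x = 0"
    using integral_nonneg_eq_0_iff_AE[OF int] nn by simp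
  then have ae: "AE x in lborel. x \<notin> U \<inter> f -` (- {0})" by eventually_elim auto
  have W: "open (U \<inter> f -` (- {0}))" by (rule continuous_open_preimage[OF f(1) U]) auto
  have "U \<inter> f -` (- {0}) \<in> null_sets lborel"
    using ae W AE_iff_null_sets[of "U \<inter> f -` (- {0})" lborel] by auto
  then have "negligible (U \<inter> f -` (- {0}))"
    by (simp add: negligible_iff_null_sets null_sets_completionI)
  then show False using open_not_negligible[OF W] ne x by auto
qed

context stokes_flow
begin

lemma supp_cball_integrable:
  fixes c :: "real^2 \<Rightarrow> real"
  assumes c: "continuous_on UNIV c"
  shows "integrable lborel (\<lambda>x. indicator (supp_u \<inter> cball 0 R) x * (c x * (norm (u x))\<^sup>2))"
proof -
  obtain M where M: "M \<ge> 1" "\<And>x. x \<in> E \<Longrightarrow> norm x \<le> R \<Longrightarrow> norm (u x) \<le> M \<and> cmod (p x) \<le> M"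
    by (rule flow_bounded[of R]) blast
  have "bounded (c ` cball 0 R)"
    by (intro compact_imp_bounded compact_continuous_image continuous_on_subset[OF c]) auto
  then obtain B where "\<forall>y\<in>c ` cball 0 R. norm y \<le> B" unfolding bounded_iff by blast
  then have B: "\<bar>c x\<bar> \<le> B" if "norm x \<le> R" for x using that by auto
  have "continuous_on E (\<lambda>x. c x * (norm (u x))\<^sup>2)"
    by (intro continuous_on_mult continuous_on_power continuous_on_norm cont_u_E continuous_on_subset[OF c]) auto
  from supp_measurable[OF this]
  have "(\<lambda>x. indicator (cball 0 R) x * (indicator supp_u x *\<^sub>R (c x * (norm (u x))\<^sup>2))) \<in> borel_measurable borel"
    by (intro borel_measurable_times borel_measurable_indicator) auto
  then have m: "(\<lambda>x. indicator (supp_u \<inter> cball 0 R) x * (c x * (norm (u x))\<^sup>2)) \<in> borel_measurable lborel"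
    by (simp add: indicator_inter_arith mult.commute mult.left_commute)
  have i: "integrable lborel (\<lambda>x::real^2. (B * M\<^sup>2) * indicator (cball 0 R) x)"
    using emeasure_cball_lt_top[of R] by (intro integrable_mult_right integrable_real_indicator) auto
  show ?thesis
  proof (rule Bochner_Integration.integrable_bound[OF i m], rule AE_I2)
    fix x
    show "norm (indicator (supp_u \<inter> cball 0 R) x * (c x * (norm (u x))\<^sup>2)) \<le> norm ((B * M\<^sup>2) * indicator (cball 0 R) x)"
    proof (cases "x \<in> supp_u \<and> norm x \<le> R")
      case True
      then have "\<bar>c x\<bar> \<le> B" "norm (u x) \<le> M" using B M(2)[of x] by (auto simp: supp_u_def)
      then have "\<bar>c x\<bar> * (norm (u x))\<^sup>2 \<le> B * M\<^sup>2" by (intro mult_mono power_mono) auto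
      then have "\<bar>c x\<bar> * (norm (u x))\<^sup>2 \<le> \<bar>B * M\<^sup>2\<bar>" by linarith
      then show ?thesis using True by (simp add: abs_mult)
    qed (auto simp: indicator_def)
  qed
qed

definition radiated :: "complex \<Rightarrow> real \<Rightarrow> real" where
  "radiated k R = (\<integral>x. indicator supp_u x *
    ((2 * Im k * eta R x + 4 * eta_root R x * norm x / R\<^sup>2) * ((cmod k)\<^sup>2 * (norm (u x))\<^sup>2)) \<partial>lborel)"

text \<open>The weight of the defect is at most 4|x|/R^2, and |x| times the defect is small far out
  by the radiation condition; over a disc of area \<pi>R^2 this stays small. The inner part is a
  fixed integral divided by R^2.\<close>

lemma radiated_tendsto_0:
  assumes k: "\<kappa> = k\<^sup>2" "Im k \<ge> 0" and rad: "radiating k u p"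
  shows "(radiated k \<longlongrightarrow> 0) at_top"
proof (rule tendstoI)
  fix \<delta> :: real assume \<delta>: "\<delta> > 0"
  \<comment> \<open>Chosen so that the far region contributes 4\<pi>e^2 = \<delta>/4.\<close>
  define e where "e = sqrt (\<delta> / (16 * pi))"
  have e: "e > 0" "4 * pi * e\<^sup>2 = \<delta> / 4" using \<delta> by (auto simp: e_def real_sqrt_pow2)
  let ?rad = "\<lambda>x. (norm (traction u p x - (\<i> * k) *s u x))\<^sup>2"
  obtain r0 where r0: "r0 > 0" "\<And>x. norm x \<ge> r0 \<Longrightarrow> norm x * ?rad x \<le> e\<^sup>2"
  proof -
    obtain N where N: "\<And>r \<nu>. r \<ge> N \<Longrightarrow> \<nu> \<in> sphere 0 1 \<Longrightarrow>
        dist (sqrt r * norm (traction u p (r *\<^sub>R \<nu>) - (\<i> * k) *s u (r *\<^sub>R \<nu>))) 0 < e"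
      using rad e(1) unfolding radiating_def uniform_limit_iff eventually_at_top_linorder by metis
    show thesis
    proof (rule that[of "max N 1"])
      fix x :: "real^2" assume x: "norm x \<ge> max N 1"
      have nz: "norm x > 0" using x by linarith
      have "inverse (norm x) *\<^sub>R x \<in> sphere 0 1" "norm x *\<^sub>R (inverse (norm x) *\<^sub>R x) = x" using nz by auto
      then have "sqrt (norm x) * norm (traction u p x - (\<i> * k) *s u x) < e"
        using N[of "norm x" "inverse (norm x) *\<^sub>R x"] x by (simp add: abs_mult)
      then have "(sqrt (norm x) * norm (traction u p x - (\<i> * k) *s u x))\<^sup>2 \<le> e\<^sup>2"
        by (intro power_mono) auto
      then show "norm x * ?rad x \<le> e\<^sup>2" by (simp add: power_mult_distrib)
    qed simp
  qed
  \<comment> \<open>The defect inside \<open>r0\<close> is finite but not small; \<open>R0\<close>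
    is taken so large that 4 r0 J / R^2 \<le> \<delta>/4.\<close>
  define J where "J = (\<integral>x. indicator (supp_u \<inter> cball 0 r0) x * ?rad x \<partial>lborel)"
  have J: "J \<ge> 0" unfolding J_def by (intro integral_nonneg_AE) auto
  define R0 where "R0 = max 1 (16 * r0 * J / \<delta>)"
  have "dist (radiated k R) 0 < \<delta>" if "R \<ge> R0" for R
  proof -
    have R: "R \<ge> 1" "16 * r0 * J / \<delta> \<le> R" using that by (auto simp: R0_def)
    then have R': "R > 0" by simp
    note B = radiation_balance[OF k R']
    have "radiated k R \<le> (\<integral>x. indicator (supp_u \<inter> cball 0 R) x * (4 * eta_root R x * norm x / R\<^sup>2 * ?rad x) \<partial>lborel)"
      unfolding radiated_def by (rule B(3))
    also have "\<dots> \<le> (\<integral>x. (4 * e\<^sup>2 / R\<^sup>2) * indicator (cball 0 R) x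
        + (4 * r0 / R\<^sup>2) * (indicator (supp_u \<inter> cball 0 r0) x * ?rad x) \<partial>lborel)"
    proof (rule integral_mono[OF B(4)])
      show "integrable lborel (\<lambda>x. (4 * e\<^sup>2 / R\<^sup>2) * indicator (cball 0 R) x
        + (4 * r0 / R\<^sup>2) * (indicator (supp_u \<inter> cball 0 r0) x * ?rad x))"
        using B(2)[of r0] emeasure_cball_lt_top[of R]
        by (intro Bochner_Integration.integrable_add integrable_mult_right integrable_real_indicator) auto
      fix x
      show "indicator (supp_u \<inter> cball 0 R) x * (4 * eta_root R x * norm x / R\<^sup>2 * ?rad x)
        \<le> (4 * e\<^sup>2 / R\<^sup>2) * indicator (cball 0 R) x + (4 * r0 / R\<^sup>2) * (indicator (supp_u \<inter> cball 0 r0) x * ?rad x)"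
      proof (cases "x \<in> supp_u \<and> norm x \<le> R")
        case True
        have "4 * eta_root R x * norm x / R\<^sup>2 * ?rad x = eta_root R x * (4 / R\<^sup>2 * (norm x * ?rad x))"
          by simp
        also have "\<dots> \<le> 1 * (4 / R\<^sup>2 * (norm x * ?rad x))"
          using eta_root_bounds[of R x] by (intro mult_right_mono) auto
        finally have a: "4 * eta_root R x * norm x / R\<^sup>2 * ?rad x \<le> 4 / R\<^sup>2 * (norm x * ?rad x)" by simp
        show ?thesis
        proof (cases "norm x \<ge> r0")
          case far: True
          have "4 / R\<^sup>2 * (norm x * ?rad x) \<le> 4 / R\<^sup>2 * e\<^sup>2"
            using r0(2)[OF far] by (intro mult_left_mono) auto
          moreover have "0 \<le> (4 * r0 / R\<^sup>2) * (indicator (supp_u \<inter> cball 0 r0) x * ?rad x)" using r0 by simp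
          ultimately show ?thesis using a True by simp
        next
          case False
          have "4 / R\<^sup>2 * (norm x * ?rad x) \<le> 4 / R\<^sup>2 * (r0 * ?rad x)"
            using False by (intro mult_left_mono mult_right_mono) auto
          then have "4 * eta_root R x * norm x / R\<^sup>2 * ?rad x \<le> 4 * r0 / R\<^sup>2 * ?rad x"
            using a by simp
          moreover have "0 \<le> 4 * e\<^sup>2 / R\<^sup>2" by simp
          ultimately have "4 * eta_root R x * norm x / R\<^sup>2 * ?rad x \<le> 4 * e\<^sup>2 / R\<^sup>2 + 4 * r0 / R\<^sup>2 * ?rad x"
            by linarith
          then show ?thesis using True False by simp
        qed
      next
        case False
        then have "indicator (supp_u \<inter> cball 0 R) x = (0::real)" by auto
        then show ?thesis using r0 by (simp add: add_nonneg_nonneg)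
      qed
    qed
    also have "\<dots> = (4 * e\<^sup>2 / R\<^sup>2) * (pi * R\<^sup>2) + (4 * r0 / R\<^sup>2) * J"
      using B(2)[of r0] emeasure_cball_lt_top[of R] R'
      by (subst Bochner_Integration.integral_add) (auto simp: J_def measure_cball_plane)
    also have "\<dots> = \<delta> / 4 + 4 * r0 * J / R\<^sup>2" using e(2) R' by (simp add: mult_ac)
    also have "4 * r0 * J / R\<^sup>2 \<le> \<delta> / 4"
    proof -
      have "16 * r0 * J \<le> R * \<delta>" using R(2) \<delta> by (simp add: pos_divide_le_eq)
      also have "\<dots> \<le> R\<^sup>2 * \<delta>" using R(1) \<delta> by (intro mult_right_mono) (auto simp: power2_eq_square)
      finally show ?thesis using R' by (simp add: divide_le_eq mult_ac)
    qed
    finally have "radiated k R < \<delta>" using \<delta> by simp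
    moreover have "radiated k R \<ge> 0"
      unfolding radiated_def using k eta_bounds[of R] eta_root_bounds[of R]
      by (intro integral_nonneg_AE AE_I2 mult_nonneg_nonneg add_nonneg_nonneg divide_nonneg_nonneg) auto
    ultimately show ?thesis by simp
  qed
  then show "\<forall>\<^sub>F R in at_top. dist (radiated k R) 0 < \<delta>"
    unfolding eventually_at_top_linorder by blast
qed

text \<open>On a fixed disc the term 2 Im k \<open>eta\<close> is at least 2 * (9/16) Im k once R is
  twice its radius, so the mass of \<open>u\<close> there is bounded by a quantity tending to
  0.\<close>

lemma radiating_dissipative_zero:
  assumes k: "\<kappa> = k\<^sup>2" "Im k > 0" and rad: "radiating k u p"
  shows "supp_u = {}"
proof (rule ccontr)
  assume "supp_u \<noteq> {}"
  then obtain x0 where x0: "x0 \<in> supp_u" by blast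
  define r where "r = norm x0 + 1"
  have r: "r > 0" by (simp add: r_def add_nonneg_pos)
  define c where "c = 9 / 8 * Im k * (cmod k)\<^sup>2"
  have "k \<noteq> 0" using k by auto
  then have c: "c > 0" using k by (simp add: c_def)
  let ?I = "\<integral>x. indicator (supp_u \<inter> cball 0 r) x * (1 * (norm (u x))\<^sup>2) \<partial>lborel"
  have int: "integrable lborel (\<lambda>x. indicator (supp_u \<inter> cball 0 r) x * (1 * (norm (u x))\<^sup>2))"
    by (rule supp_cball_integrable) simp
  have "c * ?I \<le> radiated k R" if "R \<ge> 2 * r" for R
  proof -
    have R: "R > 0" using that r by simp
    have "c * ?I = (\<integral>x. c * (indicator (supp_u \<inter> cball 0 r) x * (1 * (norm (u x))\<^sup>2)) \<partial>lborel)" by simp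
    also have "\<dots> \<le> radiated k R"
      unfolding radiated_def
    proof (rule integral_mono)
      show "integrable lborel (\<lambda>x. c * (indicator (supp_u \<inter> cball 0 r) x * (1 * (norm (u x))\<^sup>2)))"
        using int by (rule integrable_mult_right)
      show "integrable lborel (\<lambda>x. indicator supp_u x *
          ((2 * Im k * eta R x + 4 * eta_root R x * norm x / R\<^sup>2) * ((cmod k)\<^sup>2 * (norm (u x))\<^sup>2)))"
        using radiation_balance(1)[OF k(1) _ R] k by simp
      fix x
      have nn: "0 \<le> 4 * eta_root R x * norm x / R\<^sup>2" using eta_root_bounds[of R x] by simp
      have nn': "0 \<le> 2 * Im k * eta R x" using k eta_bounds[of R x] by simp
      show "c * (indicator (supp_u \<inter> cball 0 r) x * (1 * (norm (u x))\<^sup>2)) \<le> indicator supp_u x *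
          ((2 * Im k * eta R x + 4 * eta_root R x * norm x / R\<^sup>2) * ((cmod k)\<^sup>2 * (norm (u x))\<^sup>2))"
      proof (cases "x \<in> supp_u \<and> norm x \<le> r")
        case True
        then have "3/4 \<le> eta_root R x" using eta_root_inside[OF R, of x] that by simp
        then have "(3/4)\<^sup>2 \<le> eta R x" unfolding eta_eq by (intro power_mono) auto
        then have "9 / 16 \<le> eta R x" by (simp add: power2_eq_square)
        then have "2 * Im k * (9/16) \<le> 2 * Im k * eta R x" using k by (intro mult_left_mono) auto
        then have "9/8 * Im k \<le> 2 * Im k * eta R x + 4 * eta_root R x * norm x / R\<^sup>2" using nn by linarith
        then have "9/8 * Im k * ((cmod k)\<^sup>2 * (norm (u x))\<^sup>2)
          \<le> (2 * Im k * eta R x + 4 * eta_root R x * norm x / R\<^sup>2) * ((cmod k)\<^sup>2 * (norm (u x))\<^sup>2)"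
          by (intro mult_right_mono) auto
        then show ?thesis using True by (simp add: c_def)
      next
        case False
        then have "indicator (supp_u \<inter> cball 0 r) x = (0::real)" by auto
        then show ?thesis using nn nn' by simp
      qed
    qed
    finally show ?thesis .
  qed
  then have "\<forall>\<^sub>F R in at_top. c * ?I \<le> radiated k R"
    unfolding eventually_at_top_linorder by blast
  then have "c * ?I \<le> 0"
    using tendsto_lowerbound[OF radiated_tendsto_0[OF k(1) _ rad]] k by simp
  then have I0: "?I \<le> 0" using c by (simp add: mult_le_0_iff)
  have op: "open (supp_u \<inter> ball 0 r)" using open_supp_u by auto
  have int': "integrable lborel (\<lambda>x. indicator (supp_u \<inter> ball 0 r) x * (norm (u x))\<^sup>2)"
  proof (rule Bochner_Integration.integrable_bound[OF int])
    have "continuous_on E (\<lambda>x. (norm (u x))\<^sup>2)" by (intro continuous_intros cont_u_E)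
    from supp_measurable[OF this]
    have "(\<lambda>x. indicator (ball 0 r) x * (indicator supp_u x *\<^sub>R (norm (u x))\<^sup>2)) \<in> borel_measurable borel"
      by (intro borel_measurable_times borel_measurable_indicator) auto
    then show "(\<lambda>x. indicator (supp_u \<inter> ball 0 r) x * (norm (u x))\<^sup>2) \<in> borel_measurable lborel"
      by (simp add: indicator_inter_arith mult.commute mult.left_commute)
  qed (auto simp: indicator_def)
  have "(\<integral>x. indicator (supp_u \<inter> ball 0 r) x * (norm (u x))\<^sup>2 \<partial>lborel) \<le> ?I"
    by (rule integral_mono[OF int' int]) (auto simp: indicator_def)
  with I0 have "(\<integral>x. indicator (supp_u \<inter> ball 0 r) x * (norm (u x))\<^sup>2 \<partial>lborel) \<le> 0" by simp
  moreover have "continuous_on (supp_u \<inter> ball 0 r) (\<lambda>x. (norm (u x))\<^sup>2)"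
    using supp_u_subset by (intro continuous_on_power continuous_on_norm continuous_on_subset[OF cont_u_E]) auto
  moreover have "x0 \<in> supp_u \<inter> ball 0 r" using x0 by (simp add: r_def)
  ultimately have "(norm (u x0))\<^sup>2 = 0"
    using int' by (intro vanishing_integral_open[OF op]) auto
  then show False using x0 by (simp add: supp_u_def)
qed

text \<open>For real k only the annular weight |x|/R^2 survives, so decay is known merely on average
  over radii: the integrals of |u|^2 over circles tend to 0 in mean. The cutoff at 2R gives 4/(2R)^2
  = 1/R^2, and its root is at least 3/4 on the disc of radius R.\<close>

lemma radiating_decay:
  assumes k: "\<kappa> = k\<^sup>2" "Im k = 0" "k \<noteq> 0" and rad: "radiating k u p"
  shows "((\<lambda>R. (\<integral>x. indicator (supp_u \<inter> cball 0 R) x * (norm x * (norm (u x))\<^sup>2) \<partial>lborel) / R\<^sup>2) \<longlongrightarrow> 0) at_top"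
proof -
  let ?I = "\<lambda>R. \<integral>x. indicator (supp_u \<inter> cball 0 R) x * (norm x * (norm (u x))\<^sup>2) \<partial>lborel"
  define c where "c = 3/4 * (cmod k)\<^sup>2"
  have c: "c > 0" using k by (simp add: c_def)
  have le: "?I R / R\<^sup>2 \<le> radiated k (2 * R) / c" if R: "R > 0" for R
  proof -
    have "(c / R\<^sup>2) * ?I R = (\<integral>x. (c / R\<^sup>2) * (indicator (supp_u \<inter> cball 0 R) x * (norm x * (norm (u x))\<^sup>2)) \<partial>lborel)" by simp
    also have "\<dots> \<le> radiated k (2 * R)"
      unfolding radiated_def
    proof (rule integral_mono)
      show "integrable lborel (\<lambda>x. (c / R\<^sup>2) * (indicator (supp_u \<inter> cball 0 R) x * (norm x * (norm (u x))\<^sup>2)))"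
        by (intro integrable_mult_right supp_cball_integrable continuous_intros)
      show "integrable lborel (\<lambda>x. indicator supp_u x *
          ((2 * Im k * eta (2 * R) x + 4 * eta_root (2 * R) x * norm x / (2 * R)\<^sup>2) * ((cmod k)\<^sup>2 * (norm (u x))\<^sup>2)))"
        using radiation_balance(1)[OF k(1), of "2 * R"] k R by simp
      fix x
      show "(c / R\<^sup>2) * (indicator (supp_u \<inter> cball 0 R) x * (norm x * (norm (u x))\<^sup>2)) \<le> indicator supp_u x *
          ((2 * Im k * eta (2 * R) x + 4 * eta_root (2 * R) x * norm x / (2 * R)\<^sup>2) * ((cmod k)\<^sup>2 * (norm (u x))\<^sup>2))"
      proof (cases "x \<in> supp_u \<and> norm x \<le> R")
        case True
        then have "3/4 \<le> eta_root (2 * R) x" using eta_root_inside[of "2 * R" x] R by simp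
        then have "3/4 * (norm x / R\<^sup>2 * ((cmod k)\<^sup>2 * (norm (u x))\<^sup>2)) \<le> eta_root (2 * R) x * (norm x / R\<^sup>2 * ((cmod k)\<^sup>2 * (norm (u x))\<^sup>2))"
          by (intro mult_right_mono) auto
        then show ?thesis using True k by (simp add: c_def power_mult_distrib mult_ac)
      next
        case False
        then have "indicator (supp_u \<inter> cball 0 R) x = (0::real)" by auto
        then show ?thesis using k eta_root_bounds[of "2 * R" x] by simp
      qed
    qed
    finally show ?thesis using c by (simp add: field_simps)
  qed
  have "((\<lambda>R. radiated k (2 * R)) \<longlongrightarrow> 0) at_top"
    by (rule filterlim_compose[OF radiated_tendsto_0[OF k(1) _ rad]])
      (use k in \<open>auto intro!: filterlim_tendsto_pos_mult_at_top[OF tendsto_const] filterlim_ident\<close>)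
  then have lim: "((\<lambda>R. radiated k (2 * R) / c) \<longlongrightarrow> 0) at_top"
    using tendsto_divide[OF _ tendsto_const, of "\<lambda>R. radiated k (2 * R)" 0 at_top c] c by simp
  show ?thesis
  proof (rule tendsto_sandwich[OF _ _ tendsto_const lim])
    show "\<forall>\<^sub>F R in at_top. 0 \<le> ?I R / R\<^sup>2"
      by (intro always_eventually allI divide_nonneg_nonneg integral_nonneg_AE AE_I2) auto
    show "\<forall>\<^sub>F R in at_top. ?I R / R\<^sup>2 \<le> radiated k (2 * R) / c"
      using eventually_gt_at_top[of "0::real"] by eventually_elim (rule le)
  qed
qed

text \<open>A Liouville argument: the energy identity without pressure and mass term gives a
  Caccioppoli inequality, whose right side vanishes as R grows. Then |u| is constant on
  \<open>E\<close>, and decay, not the boundary value, identifies the constant; the boundary may be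
  empty.\<close>

lemma potential_flow_zero:
  assumes conn: "connected E" and far: "\<And>x. norm x \<ge> \<rho> \<Longrightarrow> x \<in> E"
    and zero: "\<kappa> = 0" "\<And>x. p x = 0"
    and decay: "((\<lambda>R. (\<integral>x. indicator (supp_u \<inter> cball 0 R) x * (norm (u x))\<^sup>2 \<partial>lborel) / R\<^sup>2) \<longlongrightarrow> 0) at_top"
  shows "supp_u = {}"
proof -
  interpret G: momentum_flux E u p \<kappa> grad_flux by (rule momentum_flux_grad)
  define D where "D R = (\<integral>x. indicator (supp_u \<inter> cball 0 R) x * (norm (u x))\<^sup>2 \<partial>lborel) / R\<^sup>2" for R
  have intu: "integrable lborel (\<lambda>x. indicator (supp_u \<inter> cball 0 R) x * (norm (u x))\<^sup>2)" for R
    using supp_cball_integrable[of "\<lambda>_. 1"] by simp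
  \<comment> \<open>Half of the gradient term is absorbed; doubling the remaining 512 v^2/R^2 gives
    1024.\<close>
  have caccioppoli: "(\<integral>x. indicator supp_u x * (eta R x * (du_norm x)\<^sup>2) \<partial>lborel) \<le> 1024 * D R" if R: "R > 0" for R
  proof -
    define F where "F x = indicator supp_u x *\<^sub>R
      (of_real (eta R x) * (G.dissipation x - \<kappa> * of_real ((norm (u x))\<^sup>2)) + G.cutoff_flux R x)" for x
    have F: "integrable lborel F" "integral\<^sup>L lborel F = 0"
      using G.energy_identity[OF R grad_L2] by (simp_all add: F_def[abs_def])
    have pt: "indicator supp_u x * (eta R x * (du_norm x)\<^sup>2)
      \<le> 2 * Re (F x) + (1024 / R\<^sup>2) * (indicator (supp_u \<inter> cball 0 R) x * (norm (u x))\<^sup>2)" for x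
    proof (cases "x \<in> supp_u")
      case True
      then have x: "x \<in> E" by (simp add: supp_u_def)
      define g v m where "g = du_norm x" and "v = norm (u x)" and "m = eta_root R x"
      have Fx: "Re (F x) = m\<^sup>2 * g\<^sup>2 + Re (G.cutoff_flux R x)"
        using True by (simp add: F_def grad_dissipation[OF x] zero eta_eq m_def g_def)
      show ?thesis
      proof (cases "norm x \<le> R")
        case nx: True
        have "cmod (G.cutoff_flux R x) \<le> (m * g) * (32 * v / R)"
          using G.cutoff_flux_bound[OF x R] by (simp add: g_def v_def m_def zero mult_ac)
        also have "\<dots> \<le> m\<^sup>2 * g\<^sup>2 / 2 + 512 / R\<^sup>2 * v\<^sup>2"
          using sum_squares_bound[of "m * g" "32 * v / R"] by (simp add: power_mult_distrib power_divide)
        finally have "m\<^sup>2 * g\<^sup>2 \<le> 2 * Re (F x) + 1024 / R\<^sup>2 * v\<^sup>2"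
          using abs_Re_le_cmod[of "G.cutoff_flux R x"] unfolding Fx distrib_left abs_le_iff by linarith
        then show ?thesis using True nx by (simp add: eta_eq m_def g_def v_def)
      next
        case False
        then have "m = 0" "G.cutoff_flux R x = 0"
          using eta_root_outside[OF R, of x] by (auto simp: m_def G.cutoff_flux_def partial_eta)
        then show ?thesis using False Fx by (simp add: eta_eq m_def)
      qed
    qed (simp add: F_def)
    have iF: "integrable lborel (\<lambda>x. 2 * Re (F x))" by (intro integrable_mult_right integrable_Re F)
    have "(\<integral>x. indicator supp_u x * (eta R x * (du_norm x)\<^sup>2) \<partial>lborel)
      \<le> (\<integral>x. 2 * Re (F x) + (1024 / R\<^sup>2) * (indicator (supp_u \<inter> cball 0 R) x * (norm (u x))\<^sup>2) \<partial>lborel)"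
      by (intro integral_mono grad_L2_eta R Bochner_Integration.integrable_add iF integrable_mult_right intu pt)
    also have "\<dots> = 1024 * D R"
      unfolding Bochner_Integration.integral_add[OF iF integrable_mult_right[OF intu]] integral_mult_right_zero
      using F by (simp add: D_def)
    finally show ?thesis .
  qed
  have du0: "du_norm x = 0" if x: "x \<in> supp_u" for x
  proof -
    define r where "r = norm x + 1"
    have r: "r > 0" by (simp add: r_def add_nonneg_pos)
    have intb: "integrable lborel (\<lambda>x. indicator (supp_u \<inter> ball 0 r) x * (du_norm x)\<^sup>2)"
    proof (rule Bochner_Integration.integrable_bound[OF grad_L2[of r]])
      have "continuous_on E (\<lambda>x. (du_norm x)\<^sup>2)" by (intro continuous_on_power cont_du_norm)
      from supp_measurable[OF this]
      have "(\<lambda>x. indicator (ball 0 r) x * (indicator supp_u x *\<^sub>R (du_norm x)\<^sup>2)) \<in> borel_measurable borel"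
        by (intro borel_measurable_times borel_measurable_indicator) auto
      then show "(\<lambda>x. indicator (supp_u \<inter> ball 0 r) x * (du_norm x)\<^sup>2) \<in> borel_measurable lborel"
        by (simp add: indicator_inter_arith mult.commute mult.left_commute)
    qed (auto simp: indicator_def)
    have le: "(\<integral>x. indicator (supp_u \<inter> ball 0 r) x * (du_norm x)\<^sup>2 \<partial>lborel) \<le> 16/9 * 1024 * D R" if "R \<ge> 2 * r" for R
    proof -
      have R: "R > 0" using that r by simp
      have "(\<integral>x. indicator (supp_u \<inter> ball 0 r) x * (du_norm x)\<^sup>2 \<partial>lborel)
        \<le> (\<integral>x. 16/9 * (indicator supp_u x * (eta R x * (du_norm x)\<^sup>2)) \<partial>lborel)"
      proof (rule integral_mono[OF intb integrable_mult_right[OF grad_L2_eta[OF R]]])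
        fix x
        show "indicator (supp_u \<inter> ball 0 r) x * (du_norm x)\<^sup>2 \<le> 16/9 * (indicator supp_u x * (eta R x * (du_norm x)\<^sup>2))"
        proof (cases "x \<in> supp_u \<and> norm x < r")
          case True
          then have "3/4 \<le> eta_root R x" using eta_root_inside[OF R, of x] that by simp
          then have "(3/4)\<^sup>2 \<le> eta R x" unfolding eta_eq by (intro power_mono) auto
          then have "1 \<le> 16/9 * eta R x" by (simp add: power2_eq_square)
          then have "1 * (du_norm x)\<^sup>2 \<le> 16/9 * eta R x * (du_norm x)\<^sup>2" by (intro mult_right_mono) auto
          then show ?thesis using True by simp
        next
          case False
          then have "indicator (supp_u \<inter> ball 0 r) x = (0::real)" by auto
          then show ?thesis using eta_bounds[of R x] by simp
        qed
      qed
      then show ?thesis using caccioppoli[OF R] by simp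
    qed
    have "((\<lambda>R. 16/9 * 1024 * D R) \<longlongrightarrow> 16/9 * 1024 * 0) at_top"
      using decay by (intro tendsto_mult tendsto_const) (simp add: D_def[abs_def])
    moreover have "\<forall>\<^sub>F R in at_top. (\<integral>x. indicator (supp_u \<inter> ball 0 r) x * (du_norm x)\<^sup>2 \<partial>lborel) \<le> 16/9 * 1024 * D R"
      unfolding eventually_at_top_linorder using le by blast
    ultimately have "(\<integral>x. indicator (supp_u \<inter> ball 0 r) x * (du_norm x)\<^sup>2 \<partial>lborel) \<le> 16/9 * 1024 * 0"
      by (rule tendsto_lowerbound) simp
    then have "(du_norm x)\<^sup>2 = 0"
      using x open_supp_u supp_u_subset intb
      by (intro vanishing_integral_open[where U="supp_u \<inter> ball 0 r" and f="\<lambda>x. (du_norm x)\<^sup>2"])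
        (auto simp: r_def intro!: continuous_on_power continuous_on_subset[OF cont_du_norm])
    then show ?thesis by simp
  qed
  \<comment> \<open>At zeros of \<open>u\<close> nothing is known about the gradient, but the
    derivative of |u|^2 carries a factor |u|. This is why |u|^2 is shown to be constant rather than
    \<open>u\<close>.\<close>
  have ds: "((\<lambda>x. (norm (u x))\<^sup>2) has_derivative (\<lambda>h. 0)) (at x)" if x: "x \<in> E" for x
  proof -
    have "partial j (\<lambda>x. (norm (u x))\<^sup>2) x = 0" for j
    proof (cases "x \<in> supp_u")
      case True
      then have "\<bar>partial j (\<lambda>x. (norm (u x))\<^sup>2) x\<bar> \<le> 0" using partial_norm_sq_u_bound[OF x, of j] du0 by simp
      then show ?thesis by simp
    next
      case False
      then show ?thesis using x partial_norm_sq_u_bound[OF x, of j] by (simp add: supp_u_def)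
    qed
    then show ?thesis using differentiable_partial[OF C1_on_differentiable[OF norm_sq_u_C1 x]] by simp
  qed
  define c where "c = (norm (u (max \<rho> 0 *\<^sub>R axis 1 1)))\<^sup>2"
  have "max \<rho> 0 *\<^sub>R axis 1 1 \<in> E" by (rule far) simp
  then have c: "(norm (u x))\<^sup>2 = c" if "x \<in> E" for x
    unfolding c_def using has_derivative_zero_unique_connected[OF open_E conn ds that] by simp
  have "c = 0"
  proof (rule ccontr)
    assume c0: "c \<noteq> 0"
    define a where "a = max \<rho> 0"
    have "c \<ge> 0" by (simp add: c_def)
    then have cp: "c > 0" using c0 by simp
    have SE: "supp_u = E" using c c0 by (force simp: supp_u_def)
    \<comment> \<open>If |u|^2 = c > 0, the integral over \<open>E\<close> within radius R is at
      least c times the area of the annulus from \<open>a\<close> to \<open>R\<close>, which is of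
      order R^2.\<close>
    have lb: "c * pi - c * pi * a\<^sup>2 / R\<^sup>2 \<le> D R" if R: "R > a" for R
    proof -
      have R0: "R > 0" using R by (simp add: a_def)
      have "c * indicator (cball 0 R) x - c * indicator (cball 0 a) x \<le> indicator (supp_u \<inter> cball 0 R) x * (norm (u x))\<^sup>2" for x :: "real^2"
      proof (cases "x \<in> E")
        case False
        then have "norm x < \<rho>" using far by (meson not_le)
        then show ?thesis using cp False R unfolding SE by (auto simp: indicator_def a_def)
      qed (use cp c R in \<open>auto simp: SE indicator_def\<close>)
      then have "(\<integral>x. c * indicator (cball 0 R) x - c * indicator (cball (0::real^2) a) x \<partial>lborel) \<le> (\<integral>x. indicator (supp_u \<inter> cball 0 R) x * (norm (u x))\<^sup>2 \<partial>lborel)"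
        using emeasure_cball_lt_top
        by (intro integral_mono intu Bochner_Integration.integrable_diff integrable_mult_right integrable_real_indicator) auto
      also have "(\<integral>x. c * indicator (cball 0 R) x - c * indicator (cball (0::real^2) a) x \<partial>lborel) = c * (pi * R\<^sup>2) - c * (pi * a\<^sup>2)"
        using emeasure_cball_lt_top R0
        by (subst Bochner_Integration.integral_diff) (auto simp: measure_cball_plane a_def intro!: integrable_mult_right integrable_real_indicator)
      finally have "(c * (pi * R\<^sup>2) - c * (pi * a\<^sup>2)) / R\<^sup>2 \<le> D R"
        unfolding D_def by (rule divide_right_mono) simp
      then show ?thesis using R0 by (simp add: diff_divide_distrib mult_ac)
    qed
    have "((\<lambda>R. c * pi - c * pi * a\<^sup>2 / R\<^sup>2) \<longlongrightarrow> c * pi - 0) at_top"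
      by (intro tendsto_diff tendsto_const tendsto_divide_0[OF tendsto_const] filterlim_at_top_imp_at_infinity filterlim_pow_at_top filterlim_ident) auto
    moreover have "(D \<longlongrightarrow> 0) at_top" using decay by (simp add: D_def[abs_def])
    moreover have "\<forall>\<^sub>F R in at_top. c * pi - c * pi * a\<^sup>2 / R\<^sup>2 \<le> D R"
      using eventually_gt_at_top[of a] by eventually_elim (rule lb)
    ultimately have "c * pi - 0 \<le> 0" by (intro tendsto_le[OF trivial_limit_at_top_linorder])
    then show False using cp pi_gt_zero by (simp add: mult_le_0_iff)
  qed
  then show ?thesis using c by (auto simp: supp_u_def)
qed

end

section \<open>Radial ordinary differential equations\<close>

lemma DERIV_inner:
  fixes f g :: "real \<Rightarrow> 'a::real_inner"
  assumes "(f has_vector_derivative f') (at r)" "(g has_vector_derivative g') (at r)"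
  shows "((\<lambda>r. f r \<bullet> g r) has_real_derivative (f' \<bullet> g r + f r \<bullet> g')) (at r)"
  using has_derivative_inner[OF assms[unfolded has_vector_derivative_def]]
  unfolding has_field_derivative_def
  by (rule has_derivative_eq_rhs) (simp add: fun_eq_iff algebra_simps)

text \<open>The derivative of |W|^2 + |g|^2 is at most 2C(|W| + |g|)^2, hence at most 4C times that
  sum; this is the rate in the exponential.\<close>

lemma gronwall_zero:
  fixes W g :: "real \<Rightarrow> 'a::real_inner"
  assumes dW: "\<And>r. a \<le> r \<Longrightarrow> r \<le> b \<Longrightarrow> (W has_vector_derivative W' r) (at r)"
    and dg: "\<And>r. a \<le> r \<Longrightarrow> r \<le> b \<Longrightarrow> (g has_vector_derivative g' r) (at r)"
    and bd: "\<And>r. a \<le> r \<Longrightarrow> r \<le> b \<Longrightarrow> norm (W' r) \<le> C * (norm (W r) + norm (g r))"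
      "\<And>r. a \<le> r \<Longrightarrow> r \<le> b \<Longrightarrow> norm (g' r) \<le> C * (norm (W r) + norm (g r))"
    and C: "C \<ge> 0" and init: "W a = 0" "g a = 0" and ab: "a \<le> b"
  shows "W b = 0"
proof -
  define \<Phi> where "\<Phi> r = W r \<bullet> W r + g r \<bullet> g r" for r
  have d: "((\<lambda>r. \<Phi> r * exp (- (4 * C * r))) has_real_derivative
      (2 * (W' r \<bullet> W r) + 2 * (g' r \<bullet> g r) - 4 * C * \<Phi> r) * exp (- (4 * C * r))) (at r)"
    if "a \<le> r" "r \<le> b" for r
  proof -
    have "(\<Phi> has_real_derivative (2 * (W' r \<bullet> W r) + 2 * (g' r \<bullet> g r))) (at r)"
      unfolding \<Phi>_def[abs_def]
      using DERIV_add[OF DERIV_inner[OF dW[OF that] dW[OF that]] DERIV_inner[OF dg[OF that] dg[OF that]]]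
      by (simp add: inner_commute)
    then show ?thesis by (auto intro!: derivative_eq_intros simp: algebra_simps)
  qed
  have neg: "2 * (W' r \<bullet> W r) + 2 * (g' r \<bullet> g r) - 4 * C * \<Phi> r \<le> 0" if r: "a \<le> r" "r \<le> b" for r
  proof -
    define w v where "w = norm (W r)" and "v = norm (g r)"
    have "W' r \<bullet> W r \<le> norm (W' r) * norm (W r)" by (rule norm_cauchy_schwarz)
    also have "\<dots> \<le> C * (w + v) * w" using bd(1)[OF r] by (simp add: w_def v_def mult_right_mono)
    finally have 1: "W' r \<bullet> W r \<le> C * (w + v) * w" .
    have "g' r \<bullet> g r \<le> norm (g' r) * norm (g r)" by (rule norm_cauchy_schwarz)
    also have "\<dots> \<le> C * (w + v) * v" using bd(2)[OF r] by (simp add: w_def v_def mult_right_mono)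
    finally have 2: "g' r \<bullet> g r \<le> C * (w + v) * v" .
    have "C * (w + v) * w + C * (w + v) * v = C * (w + v)\<^sup>2" by (simp add: power2_eq_square algebra_simps)
    also have "\<dots> \<le> C * (2 * (w\<^sup>2 + v\<^sup>2))"
      using zero_le_power2[of "w - v"] by (intro mult_left_mono C) (simp add: power2_eq_square algebra_simps)
    also have "\<dots> = 2 * C * \<Phi> r" by (simp add: \<Phi>_def w_def v_def power2_norm_eq_inner)
    finally have "C * (w + v) * w + C * (w + v) * v \<le> 2 * C * \<Phi> r" .
    then show ?thesis using 1 2 by linarith
  qed
  have "\<Phi> b * exp (- (4 * C * b)) \<le> \<Phi> a * exp (- (4 * C * a))"
  proof (rule DERIV_nonpos_imp_nonincreasing[OF ab])
    fix r assume r: "a \<le> r" "r \<le> b"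
    show "\<exists>y. ((\<lambda>r. \<Phi> r * exp (- (4 * C * r))) has_real_derivative y) (at r) \<and> y \<le> 0"
      using d[OF r] mult_nonpos_nonneg[OF neg[OF r], of "exp (- (4 * C * r))"] by auto
  qed
  then have "\<Phi> b \<le> 0" using init by (simp add: \<Phi>_def mult_le_0_iff)
  moreover have "0 \<le> W b \<bullet> W b" "0 \<le> g b \<bullet> g b" by auto
  ultimately have "W b \<bullet> W b = 0" unfolding \<Phi>_def by linarith
  then show ?thesis by simp
qed

text \<open>The radial part of Rellich's lemma. The energy \<open>r (|g|\<^sup>2 + K |W|\<^sup>2)\<close>, corrected by a lower order
  cross term, has an integrable logarithmic derivative, so it is bounded below unless it vanishes;
  equipartition of the two parts then contradicts the decay of \<open>g\<close> in the mean.\<close>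

lemma bessel_rellich:
  fixes W g :: "real \<Rightarrow> 'a::real_inner" and n K :: real
  assumes dW: "\<And>r. r > r1 \<Longrightarrow> (W has_vector_derivative ((n / r) *\<^sub>R W r + g r)) (at r)"
    and dg: "\<And>r. r > r1 \<Longrightarrow> (g has_vector_derivative (- ((n + 1) / r) *\<^sub>R g r - K *\<^sub>R W r)) (at r)"
    and n: "n \<ge> 0" and K: "K > 0" and r1: "r1 \<ge> 0"
    and decay: "((\<lambda>R. integral {R..2*R} (\<lambda>r. r * (norm (g r))\<^sup>2) / R) \<longlongrightarrow> 0) at_top"
    and s: "s > r1" "s \<ge> (2 * n + 1) / sqrt K"
  shows "W s = 0"
proof -
  define F where "F r = r * (g r \<bullet> g r + K * (W r \<bullet> W r))" for r
  define P where "P r = r * (W r \<bullet> g r)" for r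
  \<comment> \<open>F' = (2n+1)(K|W|^2 - |g|^2) and P' = r(|g|^2 - K|W|^2), so adding (2n+1)/r times
    P cancels F' and leaves only the derivative of the coefficient, of order P/r^2.\<close>
  define H where "H r = F r + (2 * n + 1) / r * P r" for r
  define c where "c = (2 * n + 1) / sqrt K"
  have c: "c \<ge> 0" using n K by (simp add: c_def)
  have s0: "s > 0" using s(1) r1 by simp
  have pos: "r > 0" "r > r1" if "r \<ge> s" for r using that s0 s(1) by auto
  have F0: "F r \<ge> 0" if "r \<ge> s" for r using pos[OF that] K by (simp add: F_def add_nonneg_nonneg)
  have PF: "\<bar>P r\<bar> \<le> F r / (2 * sqrt K)" if r: "r \<ge> s" for r
  proof -
    have "\<bar>W r \<bullet> g r\<bar> \<le> norm (W r) * norm (g r)" by (rule Cauchy_Schwarz_ineq2)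
    then have "2 * sqrt K * \<bar>W r \<bullet> g r\<bar> \<le> 2 * sqrt K * (norm (W r) * norm (g r))"
      using K by (intro mult_left_mono) auto
    also have "\<dots> = 2 * norm (g r) * (sqrt K * norm (W r))" by simp
    also have "\<dots> \<le> (norm (g r))\<^sup>2 + (sqrt K * norm (W r))\<^sup>2" by (rule sum_squares_bound)
    also have "\<dots> = g r \<bullet> g r + K * (W r \<bullet> W r)" using K by (simp add: power_mult_distrib power2_norm_eq_inner)
    finally have "r * (2 * sqrt K * \<bar>W r \<bullet> g r\<bar>) \<le> F r"
      unfolding F_def using pos[OF r] by (intro mult_left_mono) auto
    then show ?thesis using K pos[OF r] by (simp add: P_def abs_mult field_simps)
  qed
  \<comment> \<open>Here the lower bound (2n+1)/sqrt K for \<open>s\<close> enters: beyond this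
    radius the correction is at most half of \<open>F\<close>, so \<open>H\<close> and
    \<open>F\<close> are comparable.\<close>
  have PH: "\<bar>(2 * n + 1) / r * P r\<bar> \<le> F r / 2" if r: "r \<ge> s" for r
  proof -
    have "\<bar>(2 * n + 1) / r * P r\<bar> = (2 * n + 1) / r * \<bar>P r\<bar>" using n pos[OF r] by (simp add: abs_mult)
    also have "\<dots> \<le> (2 * n + 1) / r * (F r / (2 * sqrt K))"
      using PF[OF r] n pos[OF r] by (intro mult_left_mono) auto
    also have "\<dots> = (c / r) * (F r / 2)" by (simp add: c_def)
    also have "\<dots> \<le> 1 * (F r / 2)"
      using s(2) r F0[OF r] pos[OF r] by (intro mult_right_mono) (auto simp: c_def[symmetric])
    finally show ?thesis by simp
  qed
  have HF: "F r / 2 \<le> H r" "H r \<le> 3/2 * F r" if "r \<ge> s" for r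
    using PH[OF that] unfolding H_def abs_le_iff by linarith+
  have dP: "(P has_real_derivative r * (g r \<bullet> g r - K * (W r \<bullet> W r))) (at r)" if r: "r \<ge> s" for r
  proof -
    note D = DERIV_inner[OF dW[OF pos(2)[OF r]] dg[OF pos(2)[OF r]]]
    show ?thesis
      unfolding P_def[abs_def] using pos(1)[OF r]
      by (rule_tac DERIV_cong[OF DERIV_mult[OF DERIV_ident D]])
        (simp add: inner_simps algebra_simps inner_commute add_divide_distrib)
  qed
  have dF: "(F has_real_derivative (2 * n + 1) * (K * (W r \<bullet> W r) - g r \<bullet> g r)) (at r)" if r: "r \<ge> s" for r
  proof -
    note D1 = DERIV_inner[OF dW[OF pos(2)[OF r]] dW[OF pos(2)[OF r]]]
    note D2 = DERIV_inner[OF dg[OF pos(2)[OF r]] dg[OF pos(2)[OF r]]]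
    show ?thesis
      unfolding F_def[abs_def] using pos(1)[OF r]
      by (rule_tac DERIV_cong[OF DERIV_mult[OF DERIV_ident DERIV_add[OF D2 DERIV_cmult[OF D1, of K]]]])
        (simp add: inner_simps algebra_simps inner_commute add_divide_distrib)
  qed
  have dH: "(H has_real_derivative - ((2 * n + 1) / r\<^sup>2 * P r)) (at r)" if r: "r \<ge> s" for r
  proof -
    have D: "((\<lambda>r. (2 * n + 1) / r) has_real_derivative - ((2 * n + 1) / r\<^sup>2)) (at r)"
      using pos[OF r] by (auto intro!: derivative_eq_intros simp: power2_eq_square minus_divide_left)
    show ?thesis
      unfolding H_def[abs_def]
      by (rule DERIV_cong[OF DERIV_add[OF dF[OF r] DERIV_mult[OF D dP[OF r]]]])
        (use pos[OF r] in \<open>simp add: field_simps power2_eq_square\<close>)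
  qed
  have H'le: "\<bar>(2 * n + 1) / r\<^sup>2 * P r\<bar> \<le> c / r\<^sup>2 * H r" if r: "r \<ge> s" for r
  proof -
    have "\<bar>(2 * n + 1) / r\<^sup>2 * P r\<bar> = (2 * n + 1) / r\<^sup>2 * \<bar>P r\<bar>" using n by (simp add: abs_mult)
    also have "\<dots> \<le> (2 * n + 1) / r\<^sup>2 * (F r / (2 * sqrt K))"
      using PF[OF r] n by (intro mult_left_mono) auto
    also have "\<dots> = c / r\<^sup>2 * (F r / 2)" by (simp add: c_def)
    also have "\<dots> \<le> c / r\<^sup>2 * H r" using HF[OF r] c by (intro mult_left_mono) auto
    finally show ?thesis .
  qed
  \<comment> \<open>From |H'| \<le> (c/r^2) H, the choices \<sigma> = 1 and \<sigma> = -1 give a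
    nonincreasing and a nondecreasing quantity. As c/r is bounded, \<open>H\<close> is pinned
    between multiples of its value at \<open>s\<close>.\<close>
  have dexp: "((\<lambda>r. H r * exp (\<sigma> * (c / r))) has_real_derivative
      (- ((2 * n + 1) / r\<^sup>2 * P r) - \<sigma> * (c / r\<^sup>2 * H r)) * exp (\<sigma> * (c / r))) (at r)" if r: "r \<ge> s" for r \<sigma>
  proof -
    have "((\<lambda>r. exp (\<sigma> * (c / r))) has_real_derivative - (\<sigma> * (c / r\<^sup>2)) * exp (\<sigma> * (c / r))) (at r)"
      using pos[OF r] by (auto intro!: derivative_eq_intros simp: power2_eq_square)
    from DERIV_mult[OF dH[OF r] this] show ?thesis
      by (rule DERIV_cong) (simp add: algebra_simps)
  qed
  have up: "H r * exp (c / r) \<le> H s * exp (c / s)" if r: "r \<ge> s" for r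
  proof (rule DERIV_nonpos_imp_nonincreasing[OF r])
    fix t assume t: "s \<le> t" "t \<le> r"
    have "- ((2 * n + 1) / t\<^sup>2 * P t) - c / t\<^sup>2 * H t \<le> 0" using H'le[OF t(1)] by linarith
    then show "\<exists>y. ((\<lambda>r. H r * exp (c / r)) has_real_derivative y) (at t) \<and> y \<le> 0"
      using dexp[OF t(1), of 1] mult_nonpos_nonneg[OF _ exp_ge_zero[of "c / t"]] by (auto intro!: exI)
  qed
  have low: "H s * exp (- (c / s)) \<le> H r * exp (- (c / r))" if r: "r \<ge> s" for r
  proof (rule DERIV_nonneg_imp_nondecreasing[OF r])
    fix t assume t: "s \<le> t" "t \<le> r"
    have "- ((2 * n + 1) / t\<^sup>2 * P t) + c / t\<^sup>2 * H t \<ge> 0" using H'le[OF t(1)] by linarith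
    then show "\<exists>y. ((\<lambda>r. H r * exp (- (c / r))) has_real_derivative y) (at t) \<and> y \<ge> 0"
      using dexp[OF t(1), of "-1"] mult_nonneg_nonneg[OF _ exp_ge_zero[of "- (c / t)"]] by (auto intro!: exI)
  qed
  define h M where "h = H s * exp (- (c / s))" and "M = H s * exp (c / s)"
  have H0: "H r \<ge> 0" if "r \<ge> s" for r using HF(1)[OF that] F0[OF that] by linarith
  have hF: "2/3 * h \<le> F r" if r: "r \<ge> s" for r
  proof -
    have "H r * exp (- (c / r)) \<le> H r * 1" using H0[OF r] c pos[OF r] by (intro mult_left_mono) auto
    then have "h \<le> H r" using low[OF r] by (simp add: h_def)
    then show ?thesis using HF(2)[OF r] by linarith
  qed
  have MF: "F r \<le> 2 * M" if r: "r \<ge> s" for r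
  proof -
    have "H r * 1 \<le> H r * exp (c / r)" using H0[OF r] c pos[OF r] by (intro mult_left_mono) auto
    then have "H r \<le> M" using up[OF r] by (simp add: M_def)
    then show ?thesis using HF(1)[OF r] by linarith
  qed
  \<comment> \<open>Equipartition: F = 2r|g|^2 - P', so over [R, 2R] the energy is twice the
    integral of r|g|^2 up to boundary values of \<open>P\<close>, which stay bounded by
    \<open>MF\<close>.\<close>
  have avg: "2/3 * h \<le> 2 * (integral {R..2*R} (\<lambda>r. r * (norm (g r))\<^sup>2) / R) + (2 * M / sqrt K) / R" if R: "R \<ge> s" for R
  proof -
    have R0: "R > 0" using pos[OF R] by simp
    have cg: "continuous_on {R..2*R} g" and cW: "continuous_on {R..2*R} W"
      using has_vector_derivative_continuous[OF dg] has_vector_derivative_continuous[OF dW] pos(2) R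
      by (auto intro!: continuous_at_imp_continuous_on)
    have iF: "F integrable_on {R..2*R}" unfolding F_def[abs_def]
      by (intro integrable_continuous_interval continuous_intros cg cW)
    have ig: "(\<lambda>r. r * (norm (g r))\<^sup>2) integrable_on {R..2*R}"
      by (intro integrable_continuous_interval continuous_intros cg)
    have iP: "((\<lambda>r. r * (g r \<bullet> g r - K * (W r \<bullet> W r))) has_integral P (2*R) - P R) {R..2*R}"
      using R R0 by (intro fundamental_theorem_of_calculus)
        (auto simp: has_real_derivative_iff_has_vector_derivative[symmetric] intro!: has_field_derivative_at_within dP)
    have "R * (2/3 * h) = integral {R..2*R} (\<lambda>_. 2/3 * h)" using R0 by simp
    also have "\<dots> \<le> integral {R..2*R} F"
      by (rule integral_le) (use iF hF R in auto)
    also have "\<dots> = integral {R..2*R} (\<lambda>r. 2 * (r * (norm (g r))\<^sup>2) - r * (g r \<bullet> g r - K * (W r \<bullet> W r)))"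
      by (rule integral_cong) (simp add: F_def power2_norm_eq_inner algebra_simps)
    also have "\<dots> = 2 * integral {R..2*R} (\<lambda>r. r * (norm (g r))\<^sup>2) - (P (2*R) - P R)"
      using integral_diff[OF integrable_on_cmult_left[OF ig, of 2] has_integral_integrable[OF iP]] integral_unique[OF iP]
      by simp
    also have "\<dots> \<le> 2 * integral {R..2*R} (\<lambda>r. r * (norm (g r))\<^sup>2) + 2 * M / sqrt K"
    proof -
      have "\<bar>P r\<bar> \<le> M / sqrt K" if "r \<ge> s" for r
        using PF[OF that] divide_right_mono[OF MF[OF that], of "2 * sqrt K"] K by simp
      from this[of R] this[of "2*R"] show ?thesis using R R0 by simp
    qed
    finally show ?thesis using R0 by (simp add: field_simps)
  qed
  have "((\<lambda>R. 2 * (integral {R..2*R} (\<lambda>r. r * (norm (g r))\<^sup>2) / R) + (2 * M / sqrt K) / R) \<longlongrightarrow> 2 * 0 + 0) at_top"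
    by (intro tendsto_add tendsto_mult tendsto_const decay tendsto_divide_0[OF tendsto_const] filterlim_at_top_imp_at_infinity filterlim_ident)
  moreover have "\<forall>\<^sub>F R in at_top. 2/3 * h \<le> 2 * (integral {R..2*R} (\<lambda>r. r * (norm (g r))\<^sup>2) / R) + (2 * M / sqrt K) / R"
    using eventually_ge_at_top[of s] by eventually_elim (rule avg)
  ultimately have "2/3 * h \<le> 2 * 0 + 0" by (rule tendsto_lowerbound) simp
  then have "H s \<le> 0" by (simp add: h_def mult_le_0_iff)
  then have "F s \<le> 0" using HF(1)[of s] by simp
  then have "g s \<bullet> g s + K * (W s \<bullet> W s) \<le> 0" using s0 by (simp add: F_def mult_le_0_iff)
  moreover have "0 \<le> g s \<bullet> g s" "0 \<le> K * (W s \<bullet> W s)" using K by auto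
  ultimately have "K * (W s \<bullet> W s) = 0" by linarith
  then show ?thesis using K by simp
qed

section \<open>Fourier coefficients on circles\<close>

definition ray :: "real \<Rightarrow> real^2" where
  "ray \<theta> = (\<chi> i. if i = 1 then cos \<theta> else sin \<theta>)"

lemma ray_component [simp]: "ray \<theta> $ 1 = cos \<theta>" "ray \<theta> $ 2 = sin \<theta>"
  by (auto simp: ray_def)

lemma norm_ray [simp]: "norm (ray \<theta>) = 1"
  by (simp add: norm_vec_def L2_set_def sum_2)

lemma ray_derivative:
  "(ray has_vector_derivative (\<chi> i. if i = 1 then - sin \<theta> else cos \<theta>)) (at \<theta> within A)"
proof -
  have "ray = (\<lambda>\<theta>. cos \<theta> *\<^sub>R axis 1 1 + sin \<theta> *\<^sub>R axis 2 1)"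
    by (auto simp: fun_eq_iff vec_eq_iff ray_def forall_2 axis_def)
  moreover have "(\<chi> i. if i = 1 then - sin \<theta> else cos \<theta>) = - sin \<theta> *\<^sub>R axis 1 1 + cos \<theta> *\<^sub>R axis (2::2) (1::real)"
    by (auto simp: vec_eq_iff forall_2 axis_def)
  moreover have "((\<lambda>\<theta>. cos \<theta> *\<^sub>R axis 1 1 + sin \<theta> *\<^sub>R axis 2 1) has_vector_derivative
      - sin \<theta> *\<^sub>R axis 1 1 + cos \<theta> *\<^sub>R axis (2::2) (1::real)) (at \<theta> within A)"
    unfolding has_vector_derivative_def by (auto intro!: derivative_eq_intros simp: algebra_simps)
  ultimately show ?thesis by (simp only:)
qed

lemma continuous_ray: "continuous_on A ray"
  by (auto simp: continuous_on_eq_continuous_within intro: has_vector_derivative_continuous[OF ray_derivative])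

text \<open>The normalisation 1/(2\<pi>) is omitted: only vanishing, linear equations and upper
  bounds of coefficients occur.\<close>

definition fcoeff :: "int \<Rightarrow> real^2 \<Rightarrow> (real^2 \<Rightarrow> complex) \<Rightarrow> real \<Rightarrow> complex" where
  "fcoeff n a f r = integral {0..2*pi} (\<lambda>\<theta>. f (a + r *\<^sub>R ray \<theta>) * cis (- of_int n * \<theta>))"

lemma fcoeff_cmult: "fcoeff n a (\<lambda>x. c * f x) r = c * fcoeff n a f r"
  unfolding fcoeff_def mult.assoc by (rule integral_mult_right)

lemma continuous_cis_scaled: "continuous_on A (\<lambda>\<theta>. cis (c * \<theta>))"
  by (intro continuous_intros)

lemma cis_scaled_derivative:
  "((\<lambda>\<theta>. cis (c * \<theta>)) has_vector_derivative (\<i> * of_real c * cis (c * \<theta>))) (at \<theta> within A)"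
proof -
  have "((\<lambda>\<theta>. c * \<theta>) has_derivative (\<lambda>h. c * h)) (at \<theta> within A)" by (auto intro!: derivative_eq_intros)
  from has_derivative_cis[OF this] show ?thesis
    unfolding has_vector_derivative_def
    by (rule has_derivative_eq_rhs) (simp add: fun_eq_iff scaleR_conv_of_real algebra_simps)
qed

text \<open>Pure algebra behind the polar form of the operators, with C, S for cos \<theta>, sin
  \<theta>, d1, d2 for the partials and z for the exponential factor.\<close>

lemma polar_dbar:
  fixes r :: complex
  assumes "r \<noteq> 0"
  shows "(C * d1 + S * d2) * z + \<i> / r * ((r * (- S * d1 + C * d2)) * z) = (d1 + \<i> * d2) * ((C - \<i> * S) * z)"
  using assms by (simp add: field_simps)

lemma polar_d:
  fixes r :: complex
  assumes "r \<noteq> 0"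
  shows "(C * d1 + S * d2) * z + - \<i> / r * ((r * (- S * d1 + C * d2)) * z) = (d1 - \<i> * d2) * ((C + \<i> * S) * z)"
  using assms by (simp add: field_simps)

context
  fixes E :: "(real^2) set" and a :: "real^2" and r1 r2 :: real
  assumes annulus: "\<And>r \<theta>. r1 < r \<Longrightarrow> r < r2 \<Longrightarrow> a + r *\<^sub>R ray \<theta> \<in> E" and r1: "0 \<le> r1"
begin

lemma circle_continuous:
  assumes "continuous_on E f" "r1 < r" "r < r2"
  shows "continuous_on A (\<lambda>\<theta>. f (a + r *\<^sub>R ray \<theta>))"
  by (rule continuous_on_compose2[OF assms(1)])
    (use annulus[OF assms(2,3)] in \<open>auto intro!: continuous_intros continuous_ray\<close>)

lemma fcoeff_integrable:
  assumes "continuous_on E f" "r1 < r" "r < r2"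
  shows "(\<lambda>\<theta>. f (a + r *\<^sub>R ray \<theta>) * cis (- of_int n * \<theta>)) integrable_on {0..2*pi}"
  by (intro integrable_continuous_interval continuous_on_mult circle_continuous[OF assms] continuous_cis_scaled)

lemma fcoeff_diff:
  assumes "continuous_on E f" "continuous_on E g" "r1 < r" "r < r2"
  shows "fcoeff n a (\<lambda>x. f x - g x) r = fcoeff n a f r - fcoeff n a g r"
  unfolding fcoeff_def left_diff_distrib
  by (intro integral_diff fcoeff_integrable assms)

context
  fixes f :: "real^2 \<Rightarrow> complex"
  assumes f: "C1_on E f"
begin

lemma radial_derivative:
  assumes "r1 < r" "r < r2"
  shows "((\<lambda>r. f (a + r *\<^sub>R ray \<theta>)) has_vector_derivative
    of_real (cos \<theta>) * partial 1 f (a + r *\<^sub>R ray \<theta>) + of_real (sin \<theta>) * partial 2 f (a + r *\<^sub>R ray \<theta>)) (at r)"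
proof -
  have D: "((\<lambda>r. a + r *\<^sub>R ray \<theta>) has_derivative (\<lambda>h. h *\<^sub>R ray \<theta>)) (at r)"
    by (auto intro!: derivative_eq_intros)
  from has_derivative_compose[OF D differentiable_partial[OF C1_on_differentiable[OF f annulus[OF assms]]]]
  show ?thesis
    unfolding has_vector_derivative_def
    by (rule has_derivative_eq_rhs) (simp add: fun_eq_iff sum_2 scaleR_conv_of_real[where 'a=complex] algebra_simps)
qed

lemma angular_derivative:
  assumes "r1 < r" "r < r2"
  shows "((\<lambda>\<theta>. f (a + r *\<^sub>R ray \<theta>)) has_vector_derivative
    of_real r * (- of_real (sin \<theta>) * partial 1 f (a + r *\<^sub>R ray \<theta>) + of_real (cos \<theta>) * partial 2 f (a + r *\<^sub>R ray \<theta>)))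
    (at \<theta> within A)"
proof -
  have D: "((\<lambda>\<theta>. a + r *\<^sub>R ray \<theta>) has_derivative (\<lambda>h. r *\<^sub>R h *\<^sub>R (\<chi> i. if i = 1 then - sin \<theta> else cos \<theta>))) (at \<theta> within A)"
    using ray_derivative[of \<theta> A] unfolding has_vector_derivative_def
    by (auto intro!: derivative_eq_intros)
  from has_derivative_compose[OF D differentiable_partial[OF C1_on_differentiable[OF f annulus[OF assms]]]]
  show ?thesis
    unfolding has_vector_derivative_def
    by (rule has_derivative_eq_rhs) (simp add: fun_eq_iff sum_2 scaleR_conv_of_real[where 'a=complex] algebra_simps)
qed

definition radial_part :: "int \<Rightarrow> real \<Rightarrow> complex" where
  "radial_part n r = integral {0..2*pi} (\<lambda>\<theta>. (of_real (cos \<theta>) * partial 1 f (a + r *\<^sub>R ray \<theta>)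
     + of_real (sin \<theta>) * partial 2 f (a + r *\<^sub>R ray \<theta>)) * cis (- of_int n * \<theta>))"

lemma continuous_radial_integrand:
  "continuous_on ({r1<..<r2} \<times> cbox 0 (2*pi)) (\<lambda>(r, \<theta>). (of_real (cos \<theta>) * partial 1 f (a + r *\<^sub>R ray \<theta>)
     + of_real (sin \<theta>) * partial 2 f (a + r *\<^sub>R ray \<theta>)) * cis (- of_int n * \<theta>))"
proof -
  have c: "continuous_on ({r1<..<r2} \<times> cbox 0 (2*pi)) (\<lambda>z. partial j f (a + fst z *\<^sub>R ray (snd z)))" for j
    by (rule continuous_on_compose2[OF C1_on_partial[OF f, of j]])
      (use annulus in \<open>auto intro!: continuous_intros continuous_on_compose2[OF continuous_ray]\<close>)
  show ?thesis
    unfolding split_beta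
    by (intro continuous_on_mult continuous_on_add continuous_on_of_real continuous_on_cos continuous_on_sin
        continuous_on_snd continuous_on_id c continuous_on_compose2[OF continuous_cis_scaled[of UNIV]]) auto
qed

lemma fcoeff_derivative:
  assumes r: "r1 < r" "r < r2"
  shows "(fcoeff n a f has_vector_derivative radial_part n r) (at r)"
proof -
  let ?fx = "\<lambda>r \<theta>. (of_real (cos \<theta>) * partial 1 f (a + r *\<^sub>R ray \<theta>)
     + of_real (sin \<theta>) * partial 2 f (a + r *\<^sub>R ray \<theta>)) * cis (- of_int n * \<theta>)"
  have "((\<lambda>r. integral (cbox 0 (2*pi)) (\<lambda>\<theta>. f (a + r *\<^sub>R ray \<theta>) * cis (- of_int n * \<theta>))) has_vector_derivative
    integral (cbox 0 (2*pi)) (?fx r)) (at r within {r1<..<r2})"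
  proof (rule leibniz_rule_vector_derivative)
    show "((\<lambda>r. f (a + r *\<^sub>R ray \<theta>) * cis (- of_int n * \<theta>)) has_vector_derivative ?fx r \<theta>) (at r within {r1<..<r2})"
      if "r \<in> {r1<..<r2}" for r \<theta>
      using has_vector_derivative_mult_left[OF has_vector_derivative_at_within[OF radial_derivative]] that by auto
    show "(\<lambda>\<theta>. f (a + r *\<^sub>R ray \<theta>) * cis (- of_int n * \<theta>)) integrable_on cbox 0 (2*pi)" if "r \<in> {r1<..<r2}" for r
      using fcoeff_integrable[OF C1_on_continuous[OF f]] that by simp
    show "continuous_on ({r1<..<r2} \<times> cbox 0 (2*pi)) (\<lambda>(r, \<theta>). ?fx r \<theta>)"
      by (rule continuous_radial_integrand)
  qed (use r in auto)
  then show ?thesis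
    using r by (simp add: fcoeff_def[abs_def] radial_part_def at_within_open[of r "{r1<..<r2}"])
qed

text \<open>Integration by parts in \<theta>; the boundary terms cancel because the index is an
  integer.\<close>

lemma fcoeff_angular:
  assumes r: "r1 < r" "r < r2"
  shows "((\<lambda>\<theta>. (of_real r * (- of_real (sin \<theta>) * partial 1 f (a + r *\<^sub>R ray \<theta>) + of_real (cos \<theta>) * partial 2 f (a + r *\<^sub>R ray \<theta>)))
      * cis (- of_int n * \<theta>)) has_integral (\<i> * of_int n * fcoeff n a f r)) {0..2*pi}"
proof -
  let ?ang = "\<lambda>\<theta>. of_real r * (- of_real (sin \<theta>) * partial 1 f (a + r *\<^sub>R ray \<theta>) + of_real (cos \<theta>) * partial 2 f (a + r *\<^sub>R ray \<theta>))"
  let ?\<Phi> = "\<lambda>\<theta>. f (a + r *\<^sub>R ray \<theta>) * cis (- of_int n * \<theta>)"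
  have "((\<lambda>\<theta>. f (a + r *\<^sub>R ray \<theta>) * (\<i> * of_real (- of_int n) * cis (- of_int n * \<theta>)) + ?ang \<theta> * cis (- of_int n * \<theta>)) has_integral ?\<Phi> (2*pi) - ?\<Phi> 0) {0..2*pi}"
    by (rule fundamental_theorem_of_calculus)
      (simp, rule has_vector_derivative_mult[OF angular_derivative[OF r] cis_scaled_derivative])
  moreover have "?\<Phi> (2*pi) - ?\<Phi> 0 = 0"
  proof -
    have "cis (- (real_of_int n * (2 * pi))) = 1"
      using cis_multiple_2pi[of "- of_int n"] by (simp add: mult_ac)
    moreover have "ray (2*pi) = ray 0" by (simp add: vec_eq_iff forall_2)
    ultimately show ?thesis by (simp add: mult_ac)
  qed
  ultimately have A: "((\<lambda>\<theta>. f (a + r *\<^sub>R ray \<theta>) * (\<i> * of_real (- of_int n) * cis (- of_int n * \<theta>)) + ?ang \<theta> * cis (- of_int n * \<theta>)) has_integral 0) {0..2*pi}"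
    by simp
  have "(?\<Phi> has_integral fcoeff n a f r) {0..2*pi}"
    unfolding fcoeff_def by (intro integrable_integral fcoeff_integrable C1_on_continuous[OF f] r)
  from has_integral_add[OF A has_integral_mult_right[OF this, of "\<i> * of_int n"]]
  show ?thesis by (rule has_integral_eq_rhs[rotated, THEN has_integral_eq[rotated], rotated]) (simp_all add: algebra_simps)
qed

lemma fcoeff_radial:
  assumes r: "r1 < r" "r < r2"
  shows "((\<lambda>\<theta>. (of_real (cos \<theta>) * partial 1 f (a + r *\<^sub>R ray \<theta>)
     + of_real (sin \<theta>) * partial 2 f (a + r *\<^sub>R ray \<theta>)) * cis (- of_int n * \<theta>)) has_integral radial_part n r) {0..2*pi}"
  unfolding radial_part_def
  by (intro integrable_integral integrable_continuous_interval continuous_on_mult continuous_on_add continuous_on_of_real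
      continuous_on_cos continuous_on_sin continuous_on_id circle_continuous C1_on_partial f r continuous_cis_scaled)

text \<open>In polar coordinates \<open>\<partial>\<^sub>1 \<pm> i \<partial>\<^sub>2 = e\<^sup>(\<pm>i\<theta>) (\<partial>\<^sub>r \<pm> (i/r) \<partial>\<^sub>\<theta>)\<close>, so these operators shift the Fourier index by one.\<close>

lemma fcoeff_dbar:
  assumes g: "\<And>x. x \<in> E \<Longrightarrow> g x = partial 1 f x + \<i> * partial 2 f x" and r: "r1 < r" "r < r2"
  shows "(fcoeff n a f has_vector_derivative (fcoeff (n + 1) a g r + of_real (of_int n / r) * fcoeff n a f r)) (at r)"
proof -
  have r0: "r \<noteq> 0" using r r1 by auto
  have "((\<lambda>\<theta>. g (a + r *\<^sub>R ray \<theta>) * cis (- of_int (n + 1) * \<theta>)) has_integral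
    (radial_part n r + (\<i> / of_real r) * (\<i> * of_int n * fcoeff n a f r))) {0..2*pi}"
  proof (rule has_integral_eq[OF _ has_integral_add[OF fcoeff_radial[OF r, of n] has_integral_mult_right[OF fcoeff_angular[OF r, of n], of "\<i> / of_real r"]]])
    fix \<theta>
    have "cis (- of_int (n + 1) * \<theta>) = cis (- \<theta>) * cis (- of_int n * \<theta>)"
      by (simp add: cis_mult algebra_simps)
    also have "cis (- \<theta>) = of_real (cos \<theta>) - \<i> * of_real (sin \<theta>)" by (simp add: complex_eq_iff)
    finally have e: "cis (- of_int (n + 1) * \<theta>) = (of_real (cos \<theta>) - \<i> * of_real (sin \<theta>)) * cis (- of_int n * \<theta>)" .
    show "(of_real (cos \<theta>) * partial 1 f (a + r *\<^sub>R ray \<theta>)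
     + of_real (sin \<theta>) * partial 2 f (a + r *\<^sub>R ray \<theta>)) * cis (- of_int n * \<theta>) +
      \<i> / of_real r * ((of_real r * (- of_real (sin \<theta>) * partial 1 f (a + r *\<^sub>R ray \<theta>) + of_real (cos \<theta>) * partial 2 f (a + r *\<^sub>R ray \<theta>)))
      * cis (- of_int n * \<theta>)) = g (a + r *\<^sub>R ray \<theta>) * cis (- of_int (n + 1) * \<theta>)"
      unfolding g[OF annulus[OF r]] e by (rule polar_dbar) (use r0 in simp)
  qed
  then have "fcoeff (n + 1) a g r = radial_part n r + (\<i> / of_real r) * (\<i> * of_int n * fcoeff n a f r)"
    unfolding fcoeff_def by (rule integral_unique)
  then have "radial_part n r = fcoeff (n + 1) a g r + of_real (of_int n / r) * fcoeff n a f r"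
    using r0 by (simp add: field_simps)
  then show ?thesis using fcoeff_derivative[OF r, of n] by simp
qed

lemma fcoeff_d:
  assumes g: "\<And>x. x \<in> E \<Longrightarrow> g x = partial 1 f x - \<i> * partial 2 f x" and r: "r1 < r" "r < r2"
  shows "(fcoeff n a f has_vector_derivative (fcoeff (n - 1) a g r - of_real (of_int n / r) * fcoeff n a f r)) (at r)"
proof -
  have r0: "r \<noteq> 0" using r r1 by auto
  have "((\<lambda>\<theta>. g (a + r *\<^sub>R ray \<theta>) * cis (- of_int (n - 1) * \<theta>)) has_integral
    (radial_part n r + (- \<i> / of_real r) * (\<i> * of_int n * fcoeff n a f r))) {0..2*pi}"
  proof (rule has_integral_eq[OF _ has_integral_add[OF fcoeff_radial[OF r, of n] has_integral_mult_right[OF fcoeff_angular[OF r, of n], of "- \<i> / of_real r"]]])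
    fix \<theta>
    have "cis (- of_int (n - 1) * \<theta>) = cis \<theta> * cis (- of_int n * \<theta>)"
      by (simp add: cis_mult algebra_simps)
    also have "cis \<theta> = of_real (cos \<theta>) + \<i> * of_real (sin \<theta>)" by (simp add: complex_eq_iff)
    finally have e: "cis (- of_int (n - 1) * \<theta>) = (of_real (cos \<theta>) + \<i> * of_real (sin \<theta>)) * cis (- of_int n * \<theta>)" .
    show "(of_real (cos \<theta>) * partial 1 f (a + r *\<^sub>R ray \<theta>)
     + of_real (sin \<theta>) * partial 2 f (a + r *\<^sub>R ray \<theta>)) * cis (- of_int n * \<theta>) +
      - \<i> / of_real r * ((of_real r * (- of_real (sin \<theta>) * partial 1 f (a + r *\<^sub>R ray \<theta>) + of_real (cos \<theta>) * partial 2 f (a + r *\<^sub>R ray \<theta>)))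
      * cis (- of_int n * \<theta>)) = g (a + r *\<^sub>R ray \<theta>) * cis (- of_int (n - 1) * \<theta>)"
      unfolding g[OF annulus[OF r]] e by (rule polar_d) (use r0 in simp)
  qed
  then have "fcoeff (n - 1) a g r = radial_part n r + (- \<i> / of_real r) * (\<i> * of_int n * fcoeff n a f r)"
    unfolding fcoeff_def by (rule integral_unique)
  then have "radial_part n r = fcoeff (n - 1) a g r - of_real (of_int n / r) * fcoeff n a f r"
    using r0 by (simp add: field_simps)
  then show ?thesis using fcoeff_derivative[OF r, of n] by simp
qed

end

end

section \<open>Completeness of the exponentials on the circle\<close>

lemma sphere_point_ray:
  assumes "norm \<nu> = 1"
  obtains \<theta> where "\<theta> \<in> {0..2*pi}" "\<nu> = ray \<theta>"
proof -
  have "(\<nu> $ 1)\<^sup>2 + (\<nu> $ 2)\<^sup>2 = 1"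
    using assms by (simp add: norm_vec_def L2_set_def sum_2)
  then obtain \<theta> where "0 \<le> \<theta>" "\<theta> < 2*pi" "\<nu> $ 1 = cos \<theta>" "\<nu> $ 2 = sin \<theta>"
    by (rule sincos_total_2pi)
  then show thesis by (intro that[of \<theta>]) (auto simp: vec_eq_iff forall_2)
qed

text \<open>Requiring orthogonality to all exponentials, not just to the constant, makes this set
  stable under multiplication by cos and sin, so that starting from 1 it contains every polynomial
  on the circle.\<close>

definition orthogonal_multipliers :: "(real^2 \<Rightarrow> complex) \<Rightarrow> (real \<Rightarrow> complex) set" where
  "orthogonal_multipliers H = {\<phi>. continuous_on UNIV \<phi> \<and>
     (\<forall>n. integral {0..2*pi} (\<lambda>\<theta>. H (ray \<theta>) * \<phi> \<theta> * cis (- of_int n * \<theta>)) = 0)}"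

context
  fixes H :: "real^2 \<Rightarrow> complex"
  assumes H: "continuous_on (sphere 0 1) H"
begin

lemma continuous_H_ray: "continuous_on A (\<lambda>\<theta>. H (ray \<theta>))"
  by (rule continuous_on_compose2[OF H continuous_ray]) auto

lemma multiplier_integrable:
  assumes "continuous_on UNIV \<phi>"
  shows "(\<lambda>\<theta>. H (ray \<theta>) * \<phi> \<theta> * cis (- of_int n * \<theta>)) integrable_on {0..2*pi}"
  by (intro integrable_continuous_interval continuous_on_mult continuous_H_ray continuous_cis_scaled
      continuous_on_subset[OF assms]) auto

lemma multiplier_add:
  assumes "\<phi> \<in> orthogonal_multipliers H" "\<psi> \<in> orthogonal_multipliers H"
  shows "(\<lambda>\<theta>. \<phi> \<theta> + \<psi> \<theta>) \<in> orthogonal_multipliers H"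
proof -
  have c: "continuous_on UNIV \<phi>" "continuous_on UNIV \<psi>" using assms by (auto simp: orthogonal_multipliers_def)
  have "integral {0..2*pi} (\<lambda>\<theta>. H (ray \<theta>) * (\<phi> \<theta> + \<psi> \<theta>) * cis (- of_int n * \<theta>)) = 0" for n
    using integral_add[OF multiplier_integrable[OF c(1)] multiplier_integrable[OF c(2)], of n n] assms
    by (simp add: orthogonal_multipliers_def algebra_simps)
  then show ?thesis using c by (auto simp: orthogonal_multipliers_def intro: continuous_intros)
qed

lemma multiplier_cmult:
  assumes "\<phi> \<in> orthogonal_multipliers H"
  shows "(\<lambda>\<theta>. c * \<phi> \<theta>) \<in> orthogonal_multipliers H"
proof -
  have "integral {0..2*pi} (\<lambda>\<theta>. H (ray \<theta>) * (c * \<phi> \<theta>) * cis (- of_int n * \<theta>)) = 0" for n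
    using integral_mult_right[of "{0..2*pi}" c "\<lambda>\<theta>. H (ray \<theta>) * \<phi> \<theta> * cis (- of_int n * \<theta>)"] assms
    by (simp add: orthogonal_multipliers_def mult_ac)
  then show ?thesis using assms by (auto simp: orthogonal_multipliers_def intro: continuous_intros)
qed

lemma multiplier_cis:
  assumes "\<phi> \<in> orthogonal_multipliers H"
  shows "(\<lambda>\<theta>. cis (of_int m * \<theta>) * \<phi> \<theta>) \<in> orthogonal_multipliers H"
proof -
  have "integral {0..2*pi} (\<lambda>\<theta>. H (ray \<theta>) * (cis (of_int m * \<theta>) * \<phi> \<theta>) * cis (- of_int n * \<theta>)) = 0" for n
  proof -
    have "cis (of_int m * \<theta>) * cis (- of_int n * \<theta>) = cis (- of_int (n - m) * \<theta>)" for \<theta>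
      by (simp add: cis_mult algebra_simps)
    then have "H (ray \<theta>) * (cis (of_int m * \<theta>) * \<phi> \<theta>) * cis (- of_int n * \<theta>)
       = H (ray \<theta>) * \<phi> \<theta> * cis (- of_int (n - m) * \<theta>)" for \<theta>
      by (metis mult.assoc mult.commute)
    then show ?thesis using assms by (simp only: orthogonal_multipliers_def mem_Collect_eq)
  qed
  then show ?thesis using assms by (auto simp: orthogonal_multipliers_def intro!: continuous_intros)
qed

lemma multiplier_cos_sin:
  assumes "\<phi> \<in> orthogonal_multipliers H"
  shows "(\<lambda>\<theta>. of_real (cos \<theta>) * \<phi> \<theta>) \<in> orthogonal_multipliers H"
    and "(\<lambda>\<theta>. of_real (sin \<theta>) * \<phi> \<theta>) \<in> orthogonal_multipliers H"
proof -
  have c: "of_real (cos \<theta>) = (1/2) * cis (of_int 1 * \<theta>) + (1/2) * cis (of_int (-1) * \<theta>)"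
    and s: "of_real (sin \<theta>) = (- \<i>/2) * cis (of_int 1 * \<theta>) + (\<i>/2) * cis (of_int (-1) * \<theta>)" for \<theta>
    by (auto simp: complex_eq_iff)
  show "(\<lambda>\<theta>. of_real (cos \<theta>) * \<phi> \<theta>) \<in> orthogonal_multipliers H"
    unfolding c distrib_right mult.assoc
    by (intro multiplier_add multiplier_cmult multiplier_cis assms)
  show "(\<lambda>\<theta>. of_real (sin \<theta>) * \<phi> \<theta>) \<in> orthogonal_multipliers H"
    unfolding s distrib_right mult.assoc
    by (intro multiplier_add multiplier_cmult multiplier_cis assms)
qed

text \<open>The induction must hold for every multiplier: in the product case the hypothesis for
  \<open>f\<close> is applied to \<open>g\<close> times \<phi>.\<close>

lemma multiplier_polynomial:
  assumes "real_polynomial_function q" "\<phi> \<in> orthogonal_multipliers H"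
  shows "(\<lambda>\<theta>. of_real (q (ray \<theta>)) * \<phi> \<theta>) \<in> orthogonal_multipliers H"
  using assms
proof (induction arbitrary: \<phi> rule: real_polynomial_function.induct)
  case (linear q)
  have "ray \<theta> = cos \<theta> *\<^sub>R axis 1 1 + sin \<theta> *\<^sub>R axis 2 1" for \<theta>
    by (auto simp: vec_eq_iff forall_2 axis_def)
  then have q: "q (ray \<theta>) = cos \<theta> * q (axis 1 1) + sin \<theta> * q (axis 2 1)" for \<theta>
    using linear_add[OF bounded_linear.linear[OF linear(1)]] linear_scale[OF bounded_linear.linear[OF linear(1)]] by simp
  have "(\<lambda>\<theta>. of_real (q (axis 1 1)) * (of_real (cos \<theta>) * \<phi> \<theta>) + of_real (q (axis 2 1)) * (of_real (sin \<theta>) * \<phi> \<theta>)) \<in> orthogonal_multipliers H"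
    by (intro multiplier_add multiplier_cmult multiplier_cos_sin linear)
  then show ?case by (simp add: q algebra_simps)
next
  case (const c)
  then show ?case by (rule multiplier_cmult)
next
  case (add f g)
  show ?case using multiplier_add[OF add.IH(1)[OF add.prems] add.IH(2)[OF add.prems]] by (simp add: algebra_simps)
next
  case (mult f g)
  show ?case using mult.IH(1)[OF mult.IH(2)[OF mult.prems]] by (simp add: mult_ac)
qed

text \<open>If Q approximates the conjugate of H uniformly within 2e, then H Q has integral 0 and
  the integral of |H|^2 equals that of H (cnj H - Q), which is at most 2e times the integral of
  |H|.\<close>

lemma all_fcoeff_zero:
  assumes z: "\<And>n. integral {0..2*pi} (\<lambda>\<theta>. H (ray \<theta>) * cis (- of_int n * \<theta>)) = 0" and \<nu>: "norm \<nu> = 1"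
  shows "H \<nu> = 0"
proof -
  define I where "I = integral {0..2*pi} (\<lambda>\<theta>. cmod (H (ray \<theta>)))"
  define J where "J = integral {0..2*pi} (\<lambda>\<theta>. (cmod (H (ray \<theta>)))\<^sup>2)"
  have one: "(\<lambda>_. 1) \<in> orthogonal_multipliers H" using z by (simp add: orthogonal_multipliers_def)
  have I0: "I \<ge> 0" unfolding I_def by (intro integral_nonneg integrable_continuous_interval continuous_intros continuous_H_ray) auto
  have le: "J \<le> 2 * e * I" if e: "e > 0" for e
  proof -
    obtain q1 where q1: "real_polynomial_function q1" "\<And>x. x \<in> sphere 0 1 \<Longrightarrow> \<bar>Re (H x) - q1 x\<bar> < e"
      by (rule Stone_Weierstrass_real_polynomial_function[OF compact_sphere _ e, of 0 1 "\<lambda>x. Re (H x)"])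
        (auto intro: continuous_intros H)
    obtain q2 where q2: "real_polynomial_function q2" "\<And>x. x \<in> sphere 0 1 \<Longrightarrow> \<bar>Im (H x) - q2 x\<bar> < e"
      by (rule Stone_Weierstrass_real_polynomial_function[OF compact_sphere _ e, of 0 1 "\<lambda>x. Im (H x)"])
        (auto intro: continuous_intros H)
    \<comment> \<open>Real and imaginary part are approximated separately by real polynomials; the
      minus sign turns the approximation of H into one of its conjugate.\<close>
    let ?Q = "\<lambda>\<theta>. of_real (q1 (ray \<theta>)) * 1 + (- \<i>) * (of_real (q2 (ray \<theta>)) * 1)"
    have Q: "?Q \<in> orthogonal_multipliers H"
      by (intro multiplier_add multiplier_cmult multiplier_polynomial q1 q2 one)
    have "integral {0..2*pi} (\<lambda>\<theta>. H (ray \<theta>) * ?Q \<theta> * cis (- of_int 0 * \<theta>)) = 0"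
      using Q unfolding orthogonal_multipliers_def mem_Collect_eq by blast
    then have Q0: "integral {0..2*pi} (\<lambda>\<theta>. H (ray \<theta>) * ?Q \<theta>) = 0" by simp
    have cQ: "continuous_on UNIV ?Q" using Q by (simp add: orthogonal_multipliers_def)
    have iQ: "(\<lambda>\<theta>. H (ray \<theta>) * ?Q \<theta>) integrable_on {0..2*pi}"
      by (intro integrable_continuous_interval continuous_on_mult continuous_H_ray continuous_on_subset[OF cQ]) auto
    have iH: "(\<lambda>\<theta>. H (ray \<theta>) * cnj (H (ray \<theta>))) integrable_on {0..2*pi}"
      by (intro integrable_continuous_interval continuous_intros continuous_H_ray)
    have "of_real J = integral {0..2*pi} (\<lambda>\<theta>. H (ray \<theta>) * cnj (H (ray \<theta>)))"
    proof -
      have "((\<lambda>\<theta>. (cmod (H (ray \<theta>)))\<^sup>2) has_integral J) {0..2*pi}"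
        unfolding J_def by (intro integrable_integral integrable_continuous_interval continuous_intros continuous_H_ray)
      from has_integral_linear[OF this bounded_linear_of_real[where 'a=complex]]
      have "((\<lambda>\<theta>. H (ray \<theta>) * cnj (H (ray \<theta>))) has_integral of_real J) {0..2*pi}"
        by (simp only: o_def complex_norm_square)
      then show ?thesis by (simp add: integral_unique)
    qed
    also have "\<dots> = integral {0..2*pi} (\<lambda>\<theta>. H (ray \<theta>) * cnj (H (ray \<theta>)) - H (ray \<theta>) * ?Q \<theta>)"
      using integral_diff[OF iH iQ] Q0 by simp
    finally have J: "of_real J = integral {0..2*pi} (\<lambda>\<theta>. H (ray \<theta>) * cnj (H (ray \<theta>)) - H (ray \<theta>) * ?Q \<theta>)" .
    have "cmod (of_real J) \<le> integral {0..2*pi} (\<lambda>\<theta>. 2 * e * cmod (H (ray \<theta>)))"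
      unfolding J
    proof (rule integral_norm_bound_integral[OF integrable_diff[OF iH iQ]])
      show "(\<lambda>\<theta>. 2 * e * cmod (H (ray \<theta>))) integrable_on {0..2*pi}"
        by (intro integrable_continuous_interval continuous_intros continuous_H_ray)
      fix \<theta>
      have "cnj (H (ray \<theta>)) - ?Q \<theta> = of_real (Re (H (ray \<theta>)) - q1 (ray \<theta>)) - \<i> * of_real (Im (H (ray \<theta>)) - q2 (ray \<theta>))"
        by (simp add: complex_eq_iff)
      also have "cmod \<dots> \<le> cmod (of_real (Re (H (ray \<theta>)) - q1 (ray \<theta>))) + cmod (\<i> * of_real (Im (H (ray \<theta>)) - q2 (ray \<theta>)))"
        by (rule norm_triangle_ineq4)
      also have "\<dots> = \<bar>Re (H (ray \<theta>)) - q1 (ray \<theta>)\<bar> + \<bar>Im (H (ray \<theta>)) - q2 (ray \<theta>)\<bar>"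
        by (simp only: norm_mult norm_of_real norm_ii mult_1)
      also have "\<dots> \<le> 2 * e" using q1(2)[of "ray \<theta>"] q2(2)[of "ray \<theta>"] by simp
      finally have "cmod (H (ray \<theta>)) * cmod (cnj (H (ray \<theta>)) - ?Q \<theta>) \<le> cmod (H (ray \<theta>)) * (2 * e)"
        by (intro mult_left_mono) auto
      then show "cmod (H (ray \<theta>) * cnj (H (ray \<theta>)) - H (ray \<theta>) * ?Q \<theta>) \<le> 2 * e * cmod (H (ray \<theta>))"
        unfolding right_diff_distrib[symmetric] norm_mult by (simp only: mult_ac)
    qed
    also have "\<dots> = 2 * e * I" unfolding I_def by (rule integral_mult_right)
    finally show ?thesis by simp
  qed
  have "J \<le> 0"
  proof (rule field_le_epsilon)
    fix d :: real assume "d > 0"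
    \<comment> \<open>The 1 added to \<open>I\<close> guards against \<open>I = 0\<close>.\<close>
    then have "J \<le> 2 * (d / (2 * (I + 1))) * I" using I0 by (intro le) auto
    also have "\<dots> \<le> d" using I0 \<open>d > 0\<close> by (simp add: divide_simps mult_left_mono)
    finally show "J \<le> 0 + d" by simp
  qed
  moreover have "J \<ge> 0" unfolding J_def by (intro integral_nonneg integrable_continuous_interval continuous_intros continuous_H_ray) auto
  ultimately have J0: "J = 0" by simp
  have "\<forall>\<theta>\<in>{0..2*pi}. (cmod (H (ray \<theta>)))\<^sup>2 = 0"
    using J0 unfolding J_def
    by (subst (asm) integral_eq_0_iff) (auto intro!: continuous_intros continuous_H_ray)
  moreover obtain \<theta> where "\<theta> \<in> {0..2*pi}" "\<nu> = ray \<theta>" using sphere_point_ray[OF \<nu>] .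
  ultimately show ?thesis by simp
qed

end

lemma fcoeff_bound:
  assumes c: "continuous_on {0..2*pi} (\<lambda>\<theta>. f (a + r *\<^sub>R ray \<theta>))"
  shows "(cmod (fcoeff n a f r))\<^sup>2 \<le> 2 * pi * integral {0..2*pi} (\<lambda>\<theta>. (cmod (f (a + r *\<^sub>R ray \<theta>)))\<^sup>2)"
proof -
  let ?F = "\<lambda>\<theta>. cmod (f (a + r *\<^sub>R ray \<theta>))"
  define I where "I = integral {0..2*pi} ?F"
  have i1: "?F integrable_on {0..2*pi}" and i2: "(\<lambda>\<theta>. (?F \<theta>)\<^sup>2) integrable_on {0..2*pi}"
    by (intro integrable_continuous_interval continuous_intros c)+
  have I: "cmod (fcoeff n a f r) \<le> I"
    unfolding fcoeff_def I_def
  proof (rule integral_norm_bound_integral[OF _ i1])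
    show "(\<lambda>\<theta>. f (a + r *\<^sub>R ray \<theta>) * cis (- of_int n * \<theta>)) integrable_on {0..2*pi}"
      by (intro integrable_continuous_interval continuous_on_mult c continuous_cis_scaled)
  qed (simp add: norm_mult)
  \<comment> \<open>The mean of the modulus; nonnegativity of the variance about it is the
    Cauchy-Schwarz inequality.\<close>
  define t where "t = I / (2 * pi)"
  have "0 \<le> integral {0..2*pi} (\<lambda>\<theta>. (?F \<theta> - t)\<^sup>2)"
    by (intro integral_nonneg integrable_continuous_interval continuous_intros c) auto
  also have "\<dots> = integral {0..2*pi} (\<lambda>\<theta>. ((?F \<theta>)\<^sup>2 - 2 * t * ?F \<theta>) + t\<^sup>2)"
    by (rule integral_cong) (simp add: power2_eq_square algebra_simps)
  also have "\<dots> = (integral {0..2*pi} (\<lambda>\<theta>. (?F \<theta>)\<^sup>2) - 2 * t * I) + 2 * pi * t\<^sup>2"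
  proof -
    have i3: "(\<lambda>\<theta>. 2 * t * ?F \<theta>) integrable_on {0..2*pi}" by (intro integrable_continuous_interval continuous_intros c)
    have "integral {0..2*pi} (\<lambda>\<theta>. ((?F \<theta>)\<^sup>2 - 2 * t * ?F \<theta>) + t\<^sup>2)
       = integral {0..2*pi} (\<lambda>\<theta>. (?F \<theta>)\<^sup>2 - 2 * t * ?F \<theta>) + integral {0..2*pi} (\<lambda>_. t\<^sup>2)"
      by (rule integral_add[OF integrable_diff[OF i2 i3]]) (rule integrable_const_ivl)
    also have "integral {0..2*pi} (\<lambda>\<theta>. (?F \<theta>)\<^sup>2 - 2 * t * ?F \<theta>) = integral {0..2*pi} (\<lambda>\<theta>. (?F \<theta>)\<^sup>2) - integral {0..2*pi} (\<lambda>\<theta>. 2 * t * ?F \<theta>)"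
      by (rule integral_diff[OF i2 i3])
    also have "integral {0..2*pi} (\<lambda>\<theta>. 2 * t * ?F \<theta>) = 2 * t * I" unfolding I_def by (rule integral_mult_right)
    finally show ?thesis by simp
  qed
  also have "\<dots> = integral {0..2*pi} (\<lambda>\<theta>. (?F \<theta>)\<^sup>2) - I\<^sup>2 / (2 * pi)"
    by (simp add: t_def power2_eq_square field_simps)
  finally have "I\<^sup>2 \<le> 2 * pi * integral {0..2*pi} (\<lambda>\<theta>. (?F \<theta>)\<^sup>2)"
    using pi_gt_zero by (simp add: field_simps)
  moreover have "(cmod (fcoeff n a f r))\<^sup>2 \<le> I\<^sup>2" using I by (intro power_mono) auto
  ultimately show ?thesis by linarith
qed

section \<open>Integration in polar coordinates\<close>

lemma iterated_integral_plane:
  fixes F :: "real^2 \<Rightarrow> real"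
  assumes F: "continuous_on (cbox l u) F"
  shows "integral (cbox l u) F = integral {l$1..u$1} (\<lambda>x. integral {l$2..u$2} (\<lambda>y. F (\<chi> i. if i = 1 then x else y)))"
proof -
  \<comment> \<open>\<open>g\<close> and \<open>h\<close> identify pairs of reals with
    \<open>real^2\<close>. They map boxes to boxes of equal content, which transfers Fubini's
    theorem.\<close>
  define g :: "real \<times> real \<Rightarrow> real^2" where "g z = (\<chi> i. if i = 1 then fst z else snd z)" for z
  define h :: "real^2 \<Rightarrow> real \<times> real" where "h x = (x $ 1, x $ 2)" for x
  have hg: "h (g z) = z" and gh: "g (h x) = x" for z x by (auto simp: h_def g_def vec_eq_iff forall_2)
  have img: "g ` cbox a b = cbox (g a) (g b)" for a b
  proof -
    have "g ` cbox a b = {x. h x \<in> cbox a b}" using hg gh by (auto simp: image_iff) metis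
    also have "\<dots> = cbox (g a) (g b)"
      by (cases a; cases b) (auto simp: h_def g_def mem_box_cart forall_2 cbox_Pair_eq)
    finally show ?thesis .
  qed
  have imh: "h ` cbox a b = cbox (h a) (h b)" for a b
    using img[of "h a" "h b"] hg gh by (simp add: gh) (metis (no_types, lifting) hg image_cong image_ident image_image)
  have cg: "continuous_on UNIV g"
    unfolding g_def[abs_def]
  proof (rule continuous_on_vec_lambda)
    show "continuous_on UNIV (\<lambda>z::real \<times> real. if i = 1 then fst z else snd z)" for i :: 2
      by (cases "i = 1") (auto intro: continuous_intros)
  qed
  have "(F has_integral integral (cbox l u) F) (cbox l u)"
    using F by (intro integrable_integral integrable_continuous)
  then have "((\<lambda>z. F (g z)) has_integral (1 / 1) *\<^sub>R integral (cbox l u) F) (h ` cbox l u)"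
  proof (rule has_integral_twiddle[rotated -1])
    show "measure lborel (g ` cbox a b) = 1 * measure lborel (cbox a b)" for a b
    proof -
      obtain a1 a2 b1 b2 where ab: "a = (a1, a2)" "b = (b1, b2)" by (meson surj_pair)
      have ex2: "(\<exists>i::2. P i) \<longleftrightarrow> P 1 \<or> P 2" for P by (metis exhaust_2)
      have "measure lborel (cbox (g a) (g b)) = measure lborel (cbox a1 b1) * measure lborel (cbox a2 b2)"
        by (auto simp: content_cbox_if_cart g_def ab UNIV_2 interval_ne_empty_cart interval_eq_empty_cart content_real_if forall_2 ex2)
      then show ?thesis by (simp add: img ab content_Pair)
    qed
    show "\<exists>w z. g ` cbox a b = cbox w z" for a b using img by blast
    show "\<exists>w z. h ` cbox a b = cbox w z" for a b using imh by blast
    show "continuous (at z) g" for z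
      using cg continuous_on_eq_continuous_at[OF open_UNIV] by blast
  qed (simp_all add: hg gh)
  then have "integral (cbox (h l) (h u)) (\<lambda>z. F (g z)) = integral (cbox l u) F"
    by (simp add: imh integral_unique)
  moreover have "continuous_on (cbox (l$1, l$2) (u$1, u$2)) (\<lambda>z. F (g z))"
  proof (rule continuous_on_compose2[OF F continuous_on_subset[OF cg]])
    show "g ` cbox (l$1, l$2) (u$1, u$2) \<subseteq> cbox l u"
      using img[of "h l" "h u"] gh by (simp add: h_def)
  qed auto
  moreover have geq: "g (x, y) = (\<chi> i. if i = 1 then x else y)" for x y
    by (auto simp: g_def vec_eq_iff)
  ultimately show ?thesis
    using integral_prod_continuous[of "l$1" "l$2" "u$1" "u$2" "\<lambda>z. F (g z)"]
    by (simp add: h_def geq)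
qed

text \<open>Restricting the angle to a half circle makes the polar map injective on a closed box,
  cosine separating the angles; the compact change of variables then applies. The image lies in the
  annulus and the integrand is nonnegative, whence the inequality.\<close>

lemma polar_half_plane:
  fixes h :: "real^2 \<Rightarrow> real"
  assumes R: "0 < R" "R \<le> R'" and \<alpha>: "\<alpha> = 0 \<or> \<alpha> = pi"
    and h: "continuous_on {x. R \<le> norm x \<and> norm x \<le> R'} h" "\<And>x. h x \<ge> 0"
  shows "integral {R..R'} (\<lambda>r. integral {\<alpha>..\<alpha>+pi} (\<lambda>\<theta>. r * h (r *\<^sub>R ray \<theta>)))
    \<le> integral {x. R \<le> norm x \<and> norm x \<le> R'} h"
proof -
  define A where "A = {x::real^2. R \<le> norm x \<and> norm x \<le> R'}"
  define S :: "(real^2) set" where "S = cbox (\<chi> i. if i = 1 then R else \<alpha>) (\<chi> i. if i = 1 then R' else \<alpha> + pi)"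
  have memS: "z \<in> S \<longleftrightarrow> R \<le> z$1 \<and> z$1 \<le> R' \<and> \<alpha> \<le> z$2 \<and> z$2 \<le> \<alpha> + pi" for z
    by (auto simp: S_def mem_box_cart forall_2)
  define g :: "real^2 \<Rightarrow> real^2" where "g z = z$1 *\<^sub>R ray (z$2)" for z
  define g' :: "real^2 \<Rightarrow> real^2 \<Rightarrow> real^2" where
    "g' z k = z$1 *\<^sub>R (k$2 *\<^sub>R (\<chi> i. if i = 1 then - sin (z$2) else cos (z$2))) + k$1 *\<^sub>R ray (z$2)" for z k
  have dg: "(g has_derivative g' z) (at z within S)" for z
  proof -
    have d: "((\<lambda>z::real^2. z$i) has_derivative (\<lambda>k. k$i)) (at z within S)" for i
      by (rule bounded_linear_imp_has_derivative[OF bounded_linear_vec_nth])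
    have "((\<lambda>z::real^2. ray (z$2)) has_derivative (\<lambda>k. k$2 *\<^sub>R (\<chi> i. if i = 1 then - sin (z$2) else cos (z$2)))) (at z within S)"
      using has_derivative_compose[OF d ray_derivative[of "z$2" UNIV, unfolded has_vector_derivative_def]] .
    from has_derivative_scaleR[OF d[of 1] this] show ?thesis
      unfolding g_def[abs_def] g'_def[abs_def] .
  qed
  have detg: "det (matrix (g' z)) = z$1" for z
  proof -
    have "z$1 * (cos (z$2) * cos (z$2)) + z$1 * (sin (z$2) * sin (z$2)) = z$1 * ((cos (z$2))\<^sup>2 + (sin (z$2))\<^sup>2)"
      by (simp only: power2_eq_square distrib_left)
    also have "\<dots> = z$1" by simp
    finally show ?thesis
      unfolding det_2 by (simp add: matrix_def g'_def axis_def algebra_simps)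
  qed
  have inj: "inj_on g S"
  proof (rule inj_onI)
    fix z w assume zw: "z \<in> S" "w \<in> S" "g z = g w"
    have pz: "z$1 > 0" "w$1 > 0" using zw R by (auto simp: memS)
    have "norm (g z) = z$1" "norm (g w) = w$1" using pz by (auto simp: g_def)
    then have 1: "z$1 = w$1" using zw by simp
    then have "ray (z$2) = ray (w$2)" using zw(3) pz by (simp add: g_def)
    from arg_cong[OF this, of "\<lambda>v. v$1"] have c: "cos (z$2) = cos (w$2)" by simp
    have "z$2 = w$2"
      using \<alpha>
    proof
      assume a: "\<alpha> = 0"
      show ?thesis by (rule cos_inj_pi) (use zw(1,2) a c in \<open>simp_all add: memS\<close>)
    next
      assume a: "\<alpha> = pi"
      \<comment> \<open>Reflection carries the lower half circle into [0, \<pi>], where cosine is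
        injective.\<close>
      have "2*pi - z$2 = 2*pi - w$2"
        by (rule cos_inj_pi) (use zw(1,2) a c in \<open>simp_all add: memS cos_diff\<close>)
      then show ?thesis by simp
    qed
    with 1 show "z = w" by (simp add: vec_eq_iff forall_2)
  qed
  have gS: "g ` S \<subseteq> A" using R by (auto simp: memS g_def A_def)
  have cg: "continuous_on S g"
    using dg has_derivative_continuous continuous_on_eq_continuous_within by blast
  have ch: "continuous_on S (\<lambda>z. h (g z))"
    by (rule continuous_on_compose2[OF h(1) cg]) (use gS in \<open>simp add: A_def\<close>)
  \<comment> \<open>The scalar integrand is wrapped into \<open>real^1\<close> to match the
    vector-valued change of variables formula.\<close>
  let ?f = "\<lambda>x. vec (h x) :: real^1"
  let ?D = "\<lambda>z. \<bar>det (matrix (g' z))\<bar> *\<^sub>R ?f (g z)"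
  have cD: "continuous_on S ?D"
    unfolding detg
    by (intro continuous_intros continuous_on_vec_lambda[of S "\<lambda>i z. h (g z)", folded vec_def] ch)
  have "?D absolutely_integrable_on S \<and> integral S ?D = integral S ?D"
    using absolutely_integrable_continuous cD unfolding S_def by blast
  then have f: "?f absolutely_integrable_on g ` S" "integral (g ` S) ?f = integral S ?D"
    using has_absolute_integral_change_of_variables_compact[of S g g' ?f "integral S ?D"] dg inj
    by (auto simp: S_def)
  have comp: "integral X h' = integral X (\<lambda>x. vec (h' x) :: real^1) $ 1" "h' integrable_on X"
    if "(\<lambda>x. vec (h' x) :: real^1) integrable_on X" for X :: "(real^2) set" and h'
    using integral_linear[OF that bounded_linear_vec_nth[of 1]] integrable_linear[OF that bounded_linear_vec_nth[of 1]]
    by (auto simp: o_def)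
  have "?D = (\<lambda>z. vec (\<bar>z$1\<bar> * h (g z)))" by (simp add: fun_eq_iff detg vec_eq_iff)
  then have iD: "integral S (\<lambda>z. \<bar>z$1\<bar> * h (g z)) = integral S ?D $ 1"
    using comp(1)[of "\<lambda>z. \<bar>z$1\<bar> * h (g z)" S] cD integrable_continuous[of _ _ ?D] unfolding S_def by simp
  have fi: "?f integrable_on g ` S" using f(1) set_lebesgue_integral_eq_integral(1) by blast
  have "integral {R..R'} (\<lambda>r. integral {\<alpha>..\<alpha>+pi} (\<lambda>\<theta>. \<bar>r\<bar> * h (r *\<^sub>R ray \<theta>))) = integral S (\<lambda>z. \<bar>z$1\<bar> * h (g z))"
    unfolding S_def
    by (subst iterated_integral_plane) (auto simp: g_def S_def[symmetric] intro!: continuous_intros ch[unfolded g_def])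
  moreover have "integral {R..R'} (\<lambda>r. integral {\<alpha>..\<alpha>+pi} (\<lambda>\<theta>. \<bar>r\<bar> * h (r *\<^sub>R ray \<theta>)))
      = integral {R..R'} (\<lambda>r. integral {\<alpha>..\<alpha>+pi} (\<lambda>\<theta>. r * h (r *\<^sub>R ray \<theta>)))"
    using R by (intro integral_cong) auto
  ultimately have "integral {R..R'} (\<lambda>r. integral {\<alpha>..\<alpha>+pi} (\<lambda>\<theta>. r * h (r *\<^sub>R ray \<theta>))) = integral (g ` S) h"
    using iD comp(1)[OF fi] f(2) by simp
  also have "\<dots> \<le> integral A h"
  proof (rule integral_subset_le[OF gS comp(2)[OF fi]])
    have "A = cball 0 R' - ball 0 R" by (auto simp: A_def)
    then have cA: "compact A" by (simp add: compact_diff)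
    have "set_integrable lborel A h"
      unfolding set_integrable_def by (rule borel_integrable_compact[OF cA h(1)[folded A_def]])
    then show "h integrable_on A" by (rule set_borel_integral_eq_integral(1))
  qed (use h in auto)
  finally show ?thesis by (simp add: A_def)
qed

text \<open>Each half circle is estimated by the whole annulus, which explains the factor 2; for a
  decay estimate the constant is irrelevant.\<close>

lemma polar_annulus:
  fixes h :: "real^2 \<Rightarrow> real"
  assumes R: "0 < R" "R \<le> R'"
    and h: "continuous_on {x. R \<le> norm x \<and> norm x \<le> R'} h" "\<And>x. h x \<ge> 0"
  shows "integral {R..R'} (\<lambda>r. r * integral {0..2*pi} (\<lambda>\<theta>. h (r *\<^sub>R ray \<theta>)))
    \<le> 2 * integral {x. R \<le> norm x \<and> norm x \<le> R'} h"
proof -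
  have c2: "continuous_on ({R..R'} \<times> T) (\<lambda>(r, \<theta>). r * h (r *\<^sub>R ray \<theta>))" for T
    unfolding split_beta
    by (intro continuous_intros continuous_on_compose2[OF h(1)] continuous_on_compose2[OF continuous_ray[of UNIV]])
      (use R in auto)
  have ii: "(\<lambda>r. integral {\<alpha>..\<beta>} (\<lambda>\<theta>. r * h (r *\<^sub>R ray \<theta>))) integrable_on {R..R'}" for \<alpha> \<beta>
    using integral_continuous_on_param[of "{R..R'}" \<alpha> \<beta> "\<lambda>r \<theta>. r * h (r *\<^sub>R ray \<theta>)"] c2[of "cbox \<alpha> \<beta>"]
    by (intro integrable_continuous_interval) simp
  have ch: "continuous_on T (\<lambda>\<theta>. r * h (r *\<^sub>R ray \<theta>))" if "r \<in> {R..R'}" for r T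
    by (intro continuous_intros continuous_on_compose2[OF h(1)] continuous_ray) (use that R in auto)
  have "integral {R..R'} (\<lambda>r. r * integral {0..2*pi} (\<lambda>\<theta>. h (r *\<^sub>R ray \<theta>)))
     = integral {R..R'} (\<lambda>r. integral {0..0+pi} (\<lambda>\<theta>. r * h (r *\<^sub>R ray \<theta>)) + integral {pi..pi+pi} (\<lambda>\<theta>. r * h (r *\<^sub>R ray \<theta>)))"
  proof (rule integral_cong)
    fix r assume r: "r \<in> {R..R'}"
    have pp: "(0::real) \<le> pi" "pi \<le> 2*pi" "0 + pi = pi" "pi + pi = 2*pi" by auto
    have "integral {0..pi} (\<lambda>\<theta>. r * h (r *\<^sub>R ray \<theta>)) + integral {pi..2*pi} (\<lambda>\<theta>. r * h (r *\<^sub>R ray \<theta>)) = integral {0..2*pi} (\<lambda>\<theta>. r * h (r *\<^sub>R ray \<theta>))"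
      by (rule Henstock_Kurzweil_Integration.integral_combine[OF pp(1,2) integrable_continuous_interval[OF ch[OF r]]])
    also have "\<dots> = r * integral {0..2*pi} (\<lambda>\<theta>. h (r *\<^sub>R ray \<theta>))" by (rule integral_mult_right)
    finally show "r * integral {0..2*pi} (\<lambda>\<theta>. h (r *\<^sub>R ray \<theta>)) = integral {0..0+pi} (\<lambda>\<theta>. r * h (r *\<^sub>R ray \<theta>)) + integral {pi..pi+pi} (\<lambda>\<theta>. r * h (r *\<^sub>R ray \<theta>))"
      by (simp only: pp(3,4))
  qed
  also have "\<dots> = integral {R..R'} (\<lambda>r. integral {0..0+pi} (\<lambda>\<theta>. r * h (r *\<^sub>R ray \<theta>))) + integral {R..R'} (\<lambda>r. integral {pi..pi+pi} (\<lambda>\<theta>. r * h (r *\<^sub>R ray \<theta>)))"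
    by (rule integral_add[OF ii ii])
  also have "\<dots> \<le> integral {x. R \<le> norm x \<and> norm x \<le> R'} h + integral {x. R \<le> norm x \<and> norm x \<le> R'} h"
    by (intro add_mono polar_half_plane R h) auto
  finally show ?thesis by simp
qed

section \<open>Vorticity\<close>

context stokes_flow
begin

definition vort :: "real^2 \<Rightarrow> complex" where
  "vort x = du 2 1 x - du 1 2 x"

text \<open>For solenoidal \<open>u\<close> the Laplacian is the vorticity gradient turned by a
  right angle. Pairing \<open>p\<close> with the vorticity times i or -i therefore merges grad p -
  \<Delta>u into a single Wirtinger derivative.\<close>

definition "u_plus x = u x $ 1 + \<i> * u x $ 2"
definition "u_minus x = u x $ 1 - \<i> * u x $ 2"
definition "p_minus x = p x - \<i> * vort x"
definition "p_plus x = p x + \<i> * vort x"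

lemma C1_vort: "C1_on E vort"
  unfolding vort_def[abs_def] by (intro C1_on_diff C1_du)

lemma C1_wirtinger: "C1_on E u_plus" "C1_on E u_minus" "C1_on E p_plus" "C1_on E p_minus"
  unfolding u_plus_def[abs_def] u_minus_def[abs_def] p_plus_def[abs_def] p_minus_def[abs_def]
  by (intro C1_on_add C1_on_diff C1_on_mult C1_on_const C1_component C1_p C1_vort)+

lemma partial_i_mult:
  "f differentiable (at x) \<Longrightarrow> partial j (\<lambda>x. \<i> * f x) x = \<i> * partial j f x"
  by (rule partial_bounded_linear[OF _ bounded_linear_mult_right])

lemma differentiable_i_mult:
  fixes f :: "real^2 \<Rightarrow> complex"
  shows "f differentiable (at x) \<Longrightarrow> (\<lambda>x. \<i> * f x) differentiable (at x)"
  by (intro differentiable_mult differentiable_const)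

lemma partial_wirtinger:
  assumes "x \<in> E"
  shows "partial j u_plus x = du 1 j x + \<i> * du 2 j x"
    and "partial j u_minus x = du 1 j x - \<i> * du 2 j x"
    and "partial j p_plus x = partial j p x + \<i> * (partial j (du 2 1) x - partial j (du 1 2) x)"
    and "partial j p_minus x = partial j p x - \<i> * (partial j (du 2 1) x - partial j (du 1 2) x)"
  using assms unfolding u_plus_def[abs_def] u_minus_def[abs_def] p_plus_def[abs_def] p_minus_def[abs_def]
  by (simp_all add: partial_add partial_diff partial_i_mult differentiable_i_mult differentiable_component differentiable_p
      C1_on_differentiable[OF C1_vort] du_def) (simp_all add: vort_def[abs_def] partial_diff differentiable_du flip: du_def)

text \<open>The Stokes system in Wirtinger form; only first derivatives of \<open>p\<close> and of the vorticity occur,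
  so that no interior regularity theory is needed.\<close>

lemma stokes_wirtinger:
  assumes x: "x \<in> E"
  shows "\<i> * vort x = partial 1 u_plus x - \<i> * partial 2 u_plus x"
    and "\<kappa> * u_plus x = partial 1 p_minus x + \<i> * partial 2 p_minus x"
    and "\<kappa> * u_minus x = partial 1 p_plus x - \<i> * partial 2 p_plus x"
    and "(- \<i>) * vort x = partial 1 u_minus x + \<i> * partial 2 u_minus x"
proof -
  have d: "du 1 1 x = - du 2 2 x" using div_free_du[OF x] by (simp add: add_eq_0_iff2)
  have c: "partial 1 (du 2 2) x = partial 2 (du 2 1) x" "partial 2 (du 1 1) x = partial 1 (du 1 2) x"
    by (rule partial_du_commute[OF x])+
  have e: "partial 1 (du 1 1) x = - partial 2 (du 2 1) x" "partial 2 (du 2 2) x = - partial 1 (du 1 2) x"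
    using partial_div_du[OF x, of 1] partial_div_du[OF x, of 2] unfolding c by (auto simp: add_eq_0_iff)
  have m: "partial 1 p x = \<kappa> * u x $ 1 + (partial 2 (du 1 2) x - partial 2 (du 2 1) x)"
    "partial 2 p x = \<kappa> * u x $ 2 + (partial 1 (du 2 1) x - partial 1 (du 1 2) x)"
    using momentum_du[OF x, of 1] momentum_du[OF x, of 2] unfolding e by (auto simp: algebra_simps)
  show "\<i> * vort x = partial 1 u_plus x - \<i> * partial 2 u_plus x"
    by (simp add: partial_wirtinger x vort_def d algebra_simps)
  show "(- \<i>) * vort x = partial 1 u_minus x + \<i> * partial 2 u_minus x"
    by (simp add: partial_wirtinger x vort_def d algebra_simps)
  show "\<kappa> * u_plus x = partial 1 p_minus x + \<i> * partial 2 p_minus x"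
    by (simp add: partial_wirtinger x m u_plus_def algebra_simps)
  show "\<kappa> * u_minus x = partial 1 p_plus x - \<i> * partial 2 p_plus x"
    by (simp add: partial_wirtinger x m u_minus_def algebra_simps)
qed

end

section \<open>Ordinary differential equations of the Fourier modes\<close>

text \<open>The system satisfied by the Fourier modes \<open>A = (p - i\<omega>)\<^sub>n\<close>, \<open>X = (u\<^sub>1 + i u\<^sub>2)\<^sub>n\<^sub>+\<^sub>1\<close>, \<open>B = (p + i\<omega>)\<^sub>n\<close>,
  \<open>Y = (u\<^sub>1 - i u\<^sub>2)\<^sub>n\<^sub>-\<^sub>1\<close>. It is symmetric under \<open>n \<mapsto> -n\<close>, \<open>(A, X) \<leftrightarrow> (B, Y)\<close>. The variable \<open>q\<close> is the
  part of \<open>\<kappa> X\<close> that comes from the harmonic pressure, and \<open>W = (i\<omega>)\<^sub>n\<close> solves Bessel's equation.\<close>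

locale modal_system =
  fixes r1 :: real and r2 :: ereal and n :: real and \<kappa> :: complex and A B X Y :: "real \<Rightarrow> complex"
  assumes r1: "0 \<le> r1"
    and dA: "\<And>r. r1 < r \<Longrightarrow> ereal r < r2 \<Longrightarrow> (A has_vector_derivative (\<kappa> * X r + of_real (n / r) * A r)) (at r)"
    and dX: "\<And>r. r1 < r \<Longrightarrow> ereal r < r2 \<Longrightarrow> (X has_vector_derivative ((B r - A r) / 2 - of_real ((n + 1) / r) * X r)) (at r)"
    and dB: "\<And>r. r1 < r \<Longrightarrow> ereal r < r2 \<Longrightarrow> (B has_vector_derivative (\<kappa> * Y r - of_real (n / r) * B r)) (at r)"
    and dY: "\<And>r. r1 < r \<Longrightarrow> ereal r < r2 \<Longrightarrow> (Y has_vector_derivative ((A r - B r) / 2 + of_real ((n - 1) / r) * Y r)) (at r)"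
begin

definition "W r = (B r - A r) / 2"
definition "q r = \<kappa> * (X r + Y r) / 2 - of_real (n / r) * B r"
text \<open>Chosen so that \<open>W\<close> and \<open>g\<close> form a closed system. Eliminating
  \<open>g\<close> gives W'' + W'/r + (\<kappa> - n^2/r^2) W = 0, but the first-order form is all
  that the estimates use.\<close>

definition "g r = q r - \<kappa> * X r"

lemma r_pos: "r1 < r \<Longrightarrow> 0 < r"
  using r1 by simp

lemma dW:
  assumes r: "r1 < r" "ereal r < r2"
  shows "(W has_vector_derivative ((n / r) *\<^sub>R W r + g r)) (at r)"
proof -
  have "(W has_vector_derivative (((\<kappa> * Y r - of_real (n / r) * B r) - (\<kappa> * X r + of_real (n / r) * A r)) / 2)) (at r)"
    unfolding W_def[abs_def] by (intro has_vector_derivative_divide has_vector_derivative_diff dA dB r)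
  moreover have "((\<kappa> * Y r - of_real (n / r) * B r) - (\<kappa> * X r + of_real (n / r) * A r)) / 2 = (n / r) *\<^sub>R W r + g r"
    by (simp add: W_def g_def q_def scaleR_conv_of_real add_divide_distrib diff_divide_distrib algebra_simps)
  ultimately show ?thesis by (simp only:)
qed

text \<open>With p_n = (A + B)/2 one has q = p_n' - (n/r) p_n, which is the mode of index n + 1 of
  (d1 + i d2) p. Harmonicity of p makes that function antiholomorphic, so the mode is a multiple of
  r^-(n+1).\<close>

lemma dq:
  assumes r: "r1 < r" "ereal r < r2"
  shows "(q has_vector_derivative (- ((n + 1) / r) *\<^sub>R q r)) (at r)"
proof -
  have r0: "r > 0" using r_pos[OF r(1)] .
  have d: "((\<lambda>r. complex_of_real (n / r)) has_vector_derivative of_real (- (n / r\<^sup>2))) (at r)"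
  proof -
    have "((\<lambda>r. n / r) has_real_derivative - (n / r\<^sup>2)) (at r)"
      using r0 by (auto intro!: derivative_eq_intros simp: power2_eq_square)
    then show ?thesis by (rule has_vector_derivative_of_real)
  qed
  have "(q has_vector_derivative ((\<kappa> * (((B r - A r) / 2 - of_real ((n + 1) / r) * X r) + ((A r - B r) / 2 + of_real ((n - 1) / r) * Y r)) / 2)
     - (of_real (n / r) * (\<kappa> * Y r - of_real (n / r) * B r) + of_real (- (n / r\<^sup>2)) * B r))) (at r)"
    unfolding q_def[abs_def]
    by (intro has_vector_derivative_diff has_vector_derivative_divide has_vector_derivative_mult_right has_vector_derivative_add
        has_vector_derivative_mult d dX dY dB r)
  moreover have "(\<kappa> * (((B r - A r) / 2 - of_real ((n + 1) / r) * X r) + ((A r - B r) / 2 + of_real ((n - 1) / r) * Y r)) / 2)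
     - (of_real (n / r) * (\<kappa> * Y r - of_real (n / r) * B r) + of_real (- (n / r\<^sup>2)) * B r) = - ((n + 1) / r) *\<^sub>R q r"
    using r0 by (simp add: q_def scaleR_conv_of_real field_simps power2_eq_square)
  ultimately show ?thesis by (simp only:)
qed

lemma dg:
  assumes r: "r1 < r" "ereal r < r2"
  shows "(g has_vector_derivative (- ((n + 1) / r) *\<^sub>R g r - \<kappa> * W r)) (at r)"
proof -
  have "(g has_vector_derivative (- ((n + 1) / r) *\<^sub>R q r - \<kappa> * ((B r - A r) / 2 - of_real ((n + 1) / r) * X r))) (at r)"
    unfolding g_def[abs_def] by (intro has_vector_derivative_diff has_vector_derivative_mult_right dX dq r)
  moreover have "- ((n + 1) / r) *\<^sub>R q r - \<kappa> * ((B r - A r) / 2 - of_real ((n + 1) / r) * X r) = - ((n + 1) / r) *\<^sub>R g r - \<kappa> * W r"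
    by (simp add: g_def W_def scaleR_conv_of_real algebra_simps)
  ultimately show ?thesis by (simp only:)
qed

lemma derivative_bounds:
  assumes a0: "a > 0" and r: "a \<le> r"
  shows "norm ((n / r) *\<^sub>R W r + g r) \<le> ((\<bar>n\<bar> + 1) / a + 1 + cmod \<kappa>) * (norm (W r) + norm (g r))" (is "_ \<le> ?C * _")
    and "norm (- ((n + 1) / r) *\<^sub>R g r - \<kappa> * W r) \<le> ((\<bar>n\<bar> + 1) / a + 1 + cmod \<kappa>) * (norm (W r) + norm (g r))"
proof -
  have "\<bar>n / r\<bar> \<le> (\<bar>n\<bar> + 1) / a" "\<bar>- ((n + 1) / r)\<bar> \<le> (\<bar>n\<bar> + 1) / a"
    using a0 r by (auto simp: abs_mult abs_divide intro!: frac_le)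
  moreover have "cmod \<kappa> \<ge> 0" "(\<bar>n\<bar> + 1) / a \<ge> 0" using a0 by auto
  ultimately have c: "\<bar>n / r\<bar> \<le> ?C" "\<bar>- ((n + 1) / r)\<bar> \<le> ?C" "1 \<le> ?C" "cmod \<kappa> \<le> ?C"
    by linarith+
  have "norm ((n / r) *\<^sub>R W r + g r) \<le> \<bar>n / r\<bar> * norm (W r) + 1 * norm (g r)"
    using norm_triangle_ineq[of "(n / r) *\<^sub>R W r" "g r"] by simp
  also have "\<dots> \<le> ?C * norm (W r) + ?C * norm (g r)" by (intro add_mono mult_right_mono c) auto
  finally show "norm ((n / r) *\<^sub>R W r + g r) \<le> ?C * (norm (W r) + norm (g r))" by (simp only: distrib_left)
  have "norm (- ((n + 1) / r) *\<^sub>R g r - \<kappa> * W r) \<le> \<bar>- ((n + 1) / r)\<bar> * norm (g r) + cmod \<kappa> * norm (W r)"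
    using norm_triangle_ineq4[of "- ((n + 1) / r) *\<^sub>R g r" "\<kappa> * W r"] by (simp add: norm_mult)
  also have "\<dots> \<le> ?C * norm (g r) + ?C * norm (W r)" by (intro add_mono mult_right_mono c) auto
  finally show "norm (- ((n + 1) / r) *\<^sub>R g r - \<kappa> * W r) \<le> ?C * (norm (W r) + norm (g r))"
    by (simp only: distrib_left add.commute)
qed

text \<open>Where \<open>W\<close> vanishes on an interval so does W', hence \<open>g\<close>; both
  Cauchy data are 0 at an interior point \<open>a\<close> and Gronwall's lemma carries this outward.
  Since a > 0, the singularity at the origin is avoided.\<close>

lemma unique_continuation:
  assumes s: "r1 < s" "\<And>r. r1 < r \<Longrightarrow> r < s \<Longrightarrow> W r = 0"
    and t: "r1 < t" "ereal t < r2"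
  shows "W t = 0"
proof (cases "t < s")
  case True
  then show ?thesis using s t by blast
next
  case False
  obtain a where a: "r1 < a" "a < s"
    using dense[OF s(1)] by blast
  have a0: "a > 0" using r_pos[OF a(1)] .
  have at: "a \<le> t" using a False by simp
  have dom: "r1 < r" "ereal r < r2" if "a \<le> r" "r \<le> t" for r
    using a t that order_le_less_trans[of "ereal r" "ereal t" r2] by auto
  have "(W has_vector_derivative 0) (at a)"
  proof -
    show ?thesis
      by (rule has_vector_derivative_transform_within_open[of "\<lambda>_. 0" _ _ "{r1<..<s}"])
        (use a s in auto)
  qed
  then have "(n / a) *\<^sub>R W a + g a = 0"
    using dW[OF dom[OF order_refl at]] vector_derivative_unique_at by blast
  moreover have Wa: "W a = 0" using s a by blast
  ultimately have ga: "g a = 0" by simp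
  define C where "C = (\<bar>n\<bar> + 1) / a + 1 + cmod \<kappa>"
  have C: "C \<ge> 0" unfolding C_def using a0 by (intro add_nonneg_nonneg) auto
  show ?thesis
  proof (rule gronwall_zero[where W=W and g=g and a=a and b=t and C=C])
    fix r assume r: "a \<le> r" "r \<le> t"
    show "(W has_vector_derivative ((n / r) *\<^sub>R W r + g r)) (at r)" by (rule dW[OF dom[OF r]])
    show "(g has_vector_derivative (- ((n + 1) / r) *\<^sub>R g r - \<kappa> * W r)) (at r)" by (rule dg[OF dom[OF r]])
    show "norm ((n / r) *\<^sub>R W r + g r) \<le> C * (norm (W r) + norm (g r))"
      "norm (- ((n + 1) / r) *\<^sub>R g r - \<kappa> * W r) \<le> C * (norm (W r) + norm (g r))"
      using derivative_bounds[OF a0 r(1)] by (simp_all only: C_def)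
  qed (use C Wa ga at in auto)
qed

text \<open>The same argument run towards the centre, through the reflection r -> -r.\<close>

lemma vanishing_backward:
  assumes r2: "r2 = \<infinity>" and s: "\<And>r. s \<le> r \<Longrightarrow> W r = 0" and t: "r1 < t"
  shows "W t = 0"
proof (cases "s \<le> t")
  case True
  then show ?thesis by (rule s)
next
  case False
  define b where "b = s + 1"
  have b: "t \<le> b" "s < b" using False by (auto simp: b_def)
  have dom: "r1 < r" "ereal r < r2" if "t \<le> r" for r using that t by (auto simp: r2)
  have t0: "t > 0" using r_pos[OF t] .
  have "(W has_vector_derivative 0) (at b)"
    by (rule has_vector_derivative_transform_within_open[of "\<lambda>_. 0" _ _ "{s<..}"]) (use b s in auto)
  then have "(n / b) *\<^sub>R W b + g b = 0"
    using dW[OF dom[OF b(1)]] vector_derivative_unique_at by blast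
  moreover have Wb: "W b = 0" using s b by auto
  ultimately have gb: "g b = 0" by simp
  define C where "C = (\<bar>n\<bar> + 1) / t + 1 + cmod \<kappa>"
  have C: "C \<ge> 0" unfolding C_def using t0 by (intro add_nonneg_nonneg) auto
  have refl: "((\<lambda>r. f (- r)) has_vector_derivative - f') (at (- r))" if "(f has_vector_derivative f') (at r)"
    for f :: "real \<Rightarrow> complex" and f' r
  proof -
    have "((\<lambda>r. - r :: real) has_vector_derivative - 1) (at (- r))"
      by (rule has_vector_derivative_minus[OF has_vector_derivative_id])
    from vector_diff_chain_at[OF this, of f f'] show ?thesis using that by (simp add: o_def)
  qed
  have "W (- (- t)) = 0"
  proof (rule gronwall_zero[where W="\<lambda>r. W (- r)" and g="\<lambda>r. g (- r)" and a="- b" and b="- t" and C=C])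
    fix r' assume "- b \<le> r'" "r' \<le> - t"
    then obtain r where r: "r' = - r" "t \<le> r" "r \<le> b" by (metis minus_le_iff minus_minus neg_le_iff_le)
    show "((\<lambda>r. W (- r)) has_vector_derivative - ((n / (- r')) *\<^sub>R W (- r') + g (- r'))) (at r')"
      using refl[OF dW[OF dom[OF r(2)]]] by (simp only: r minus_minus)
    show "((\<lambda>r. g (- r)) has_vector_derivative - (- ((n + 1) / (- r')) *\<^sub>R g (- r') - \<kappa> * W (- r'))) (at r')"
      using refl[OF dg[OF dom[OF r(2)]]] by (simp only: r minus_minus)
    note c = derivative_bounds[OF t0 r(2), folded C_def]
    show "norm (- ((n / (- r')) *\<^sub>R W (- r') + g (- r'))) \<le> C * (norm (W (- r')) + norm (g (- r')))"
      using c(1) by (simp only: r minus_minus norm_minus_cancel)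
    show "norm (- (- ((n + 1) / (- r')) *\<^sub>R g (- r') - \<kappa> * W (- r'))) \<le> C * (norm (W (- r')) + norm (g (- r')))"
      using c(2) by (simp only: r minus_minus norm_minus_cancel)
  qed (use C Wb gb b in auto)
  then show ?thesis by simp
qed

text \<open>\<open>g\<close> differs from -\<kappa> X by \<open>q\<close>, and r|q|^2 = O(1/r) has
  bounded integrals over [R, 2R]. So the mean decay of X passes to \<open>g\<close>, and the
  pressure part does no harm when n \<ge> 0.\<close>

lemma rellich:
  assumes r2: "r2 = \<infinity>" and n: "n \<ge> 0" and K: "\<kappa> = of_real K" "K > 0"
    and decay: "((\<lambda>R. integral {R..2*R} (\<lambda>r. r * (cmod (X r))\<^sup>2) / R) \<longlongrightarrow> 0) at_top"
    and t: "r1 < t"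
  shows "W t = 0"
proof -
  have dom: "r1 < r" "ereal r < r2" if "r > r1" for r using that by (auto simp: r2)
  define s where "s = r1 + 1"
  \<comment> \<open>r^2 |q|^2 has derivative -2 n r |q|^2, so its value at \<open>s\<close> bounds
    it from there on.\<close>
  define Q where "Q = s\<^sup>2 * (q s \<bullet> q s)"
  have Qle: "r\<^sup>2 * (q r \<bullet> q r) \<le> Q" if r: "r \<ge> s" for r
    unfolding Q_def
  proof (rule DERIV_nonpos_imp_nonincreasing[OF r])
    fix t assume t: "s \<le> t" "t \<le> r"
    have t0: "t > r1" "t > 0" using t r1 by (auto simp: s_def)
    note D = DERIV_inner[OF dq[OF dom[OF t0(1)]] dq[OF dom[OF t0(1)]]]
    have "((\<lambda>t. t\<^sup>2) has_real_derivative 2 * t) (at t)" by (auto intro!: derivative_eq_intros)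
    from DERIV_mult[OF this D]
    have "((\<lambda>t. t\<^sup>2 * (q t \<bullet> q t)) has_real_derivative - (2 * n * t * (q t \<bullet> q t))) (at t)"
      by (rule DERIV_cong) (use t0 in \<open>simp add: power2_eq_square field_simps\<close>)
    moreover have "- (2 * n * t * (q t \<bullet> q t)) \<le> 0" using n t0 by simp
    ultimately show "\<exists>y. ((\<lambda>t. t\<^sup>2 * (q t \<bullet> q t)) has_real_derivative y) (at t) \<and> y \<le> 0" by blast
  qed
  have Q0: "Q \<ge> 0" by (simp add: Q_def)
  have le: "integral {R..2*R} (\<lambda>r. r * (norm (g r))\<^sup>2) / R \<le> 2 * Q / R + 2 * K\<^sup>2 * (integral {R..2*R} (\<lambda>r. r * (cmod (X r))\<^sup>2) / R)"
    if R: "R \<ge> max s 1" for R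
  proof -
    have R0: "R > 0" "R \<ge> 1" "R > r1" using R by (auto simp: s_def)
    have cX: "continuous_on {R..2*R} X" and cg: "continuous_on {R..2*R} g"
      using has_vector_derivative_continuous[OF dX] has_vector_derivative_continuous[OF dg] dom R0
      by (auto intro!: continuous_at_imp_continuous_on)
    have iX: "(\<lambda>r. r * (cmod (X r))\<^sup>2) integrable_on {R..2*R}"
      by (intro integrable_continuous_interval continuous_intros cX)
    have "integral {R..2*R} (\<lambda>r. r * (norm (g r))\<^sup>2) \<le> integral {R..2*R} (\<lambda>r. 2 * Q / R + 2 * K\<^sup>2 * (r * (cmod (X r))\<^sup>2))"
    proof (rule integral_le)
      show "(\<lambda>r. r * (norm (g r))\<^sup>2) integrable_on {R..2*R}"
        by (intro integrable_continuous_interval continuous_intros cg)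
      show "(\<lambda>r. 2 * Q / R + 2 * K\<^sup>2 * (r * (cmod (X r))\<^sup>2)) integrable_on {R..2*R}"
        by (intro integrable_continuous_interval continuous_intros cX) (use R0 in auto)
      fix r assume "r \<in> {R..2*R}"
      then have r: "R \<le> r" "r \<ge> s" "r > 0" using R R0 by auto
      have "norm (g r) \<le> norm (q r) + K * cmod (X r)"
        unfolding g_def using norm_triangle_ineq4[of "q r" "\<kappa> * X r"] K by (simp add: norm_mult)
      then have "(norm (g r))\<^sup>2 \<le> (norm (q r) + K * cmod (X r))\<^sup>2" by (intro power_mono) auto
      also have "\<dots> \<le> 2 * (norm (q r))\<^sup>2 + 2 * (K * cmod (X r))\<^sup>2"
        using zero_le_power2[of "norm (q r) - K * cmod (X r)"] by (simp add: power2_eq_square algebra_simps)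
      finally have "r * (norm (g r))\<^sup>2 \<le> r * (2 * (norm (q r))\<^sup>2 + 2 * (K * cmod (X r))\<^sup>2)"
        using r by (intro mult_left_mono) auto
      also have "\<dots> = 2 * (r\<^sup>2 * (q r \<bullet> q r)) / r + 2 * K\<^sup>2 * (r * (cmod (X r))\<^sup>2)"
        using r by (simp add: power2_norm_eq_inner power_mult_distrib power2_eq_square[of r] algebra_simps)
      also have "2 * (r\<^sup>2 * (q r \<bullet> q r)) / r \<le> 2 * Q / R"
        using Qle[OF r(2)] Q0 r R0 by (intro frac_le) auto
      finally show "r * (norm (g r))\<^sup>2 \<le> 2 * Q / R + 2 * K\<^sup>2 * (r * (cmod (X r))\<^sup>2)" by simp
    qed
    also have "\<dots> = integral {R..2*R} (\<lambda>r. 2 * Q / R) + integral {R..2*R} (\<lambda>r. 2 * K\<^sup>2 * (r * (cmod (X r))\<^sup>2))"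
      by (intro integral_add integrable_continuous_interval continuous_intros cX) (use R0 in auto)
    also have "\<dots> = 2 * Q + 2 * K\<^sup>2 * integral {R..2*R} (\<lambda>r. r * (cmod (X r))\<^sup>2)"
      using R0 by simp
    finally have "integral {R..2*R} (\<lambda>r. r * (norm (g r))\<^sup>2) / R
        \<le> (2 * Q + 2 * K\<^sup>2 * integral {R..2*R} (\<lambda>r. r * (cmod (X r))\<^sup>2)) / R"
      using R0 by (intro divide_right_mono) auto
    then show ?thesis by (simp add: add_divide_distrib)
  qed
  have lim: "((\<lambda>R. 2 * Q / R + 2 * K\<^sup>2 * (integral {R..2*R} (\<lambda>r. r * (cmod (X r))\<^sup>2) / R)) \<longlongrightarrow> 0 + 2 * K\<^sup>2 * 0) at_top"
    by (intro tendsto_add tendsto_mult tendsto_const decay tendsto_divide_0[OF tendsto_const] filterlim_at_top_imp_at_infinity filterlim_ident)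
  have dec: "((\<lambda>R. integral {R..2*R} (\<lambda>r. r * (norm (g r))\<^sup>2) / R) \<longlongrightarrow> 0) at_top"
  proof (rule tendsto_sandwich[OF _ _ tendsto_const])
    show "\<forall>\<^sub>F R in at_top. 0 \<le> integral {R..2*R} (\<lambda>r. r * (norm (g r))\<^sup>2) / R"
      using eventually_ge_at_top[of "max s 1"]
    proof eventually_elim
      case (elim R)
      then have R0: "R > 0" "R > r1" by (auto simp: s_def)
      have "continuous_on {R..2*R} g"
        using has_vector_derivative_continuous[OF dg] dom R0 by (auto intro!: continuous_at_imp_continuous_on)
      then show ?case using R0
        by (intro divide_nonneg_nonneg integral_nonneg integrable_continuous_interval continuous_intros) auto
    qed
    show "\<forall>\<^sub>F R in at_top. integral {R..2*R} (\<lambda>r. r * (norm (g r))\<^sup>2) / R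
        \<le> 2 * Q / R + 2 * K\<^sup>2 * (integral {R..2*R} (\<lambda>r. r * (cmod (X r))\<^sup>2) / R)"
      using eventually_ge_at_top[of "max s 1"] by eventually_elim (rule le)
    show "((\<lambda>R. 2 * Q / R + 2 * K\<^sup>2 * (integral {R..2*R} (\<lambda>r. r * (cmod (X r))\<^sup>2) / R)) \<longlongrightarrow> 0) at_top"
      using lim by simp
  qed
  \<comment> \<open>\<open>bessel_rellich\<close> reaches only radii beyond (2n+1)/sqrt K, a bound
    that grows with n; backward uniqueness extends the vanishing to all r > r1.\<close>
  show ?thesis
  proof (rule vanishing_backward[OF r2 _ t, of "max (r1 + 1) ((2 * n + 1) / sqrt K)"])
    fix r assume r: "max (r1 + 1) ((2 * n + 1) / sqrt K) \<le> r"
    show "W r = 0"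
    proof (rule bessel_rellich[where ?r1.0=r1 and n=n and K=K and g=g])
      show "(W has_vector_derivative ((n / r) *\<^sub>R W r + g r)) (at r)" if "r1 < r" for r
        by (rule dW[OF dom[OF that]])
      show "(g has_vector_derivative (- ((n + 1) / r) *\<^sub>R g r - K *\<^sub>R W r)) (at r)" if "r1 < r" for r
        using dg[OF dom[OF that]] by (simp add: K scaleR_conv_of_real)
    qed (use r n K dec r1 in auto)
  qed
qed

end

section \<open>From the modes back to the vorticity\<close>

context stokes_flow
begin

text \<open>The mirrored system serves negative indices, for which the first one would have a
  growing pressure part. In the two systems \<open>W\<close> is i, respectively -i, times the mode
  of the vorticity.\<close>

lemma modal_systems:
  assumes ann: "\<And>r \<theta>. r1 < r \<Longrightarrow> ereal r < r2 \<Longrightarrow> a + r *\<^sub>R ray \<theta> \<in> E" and r1: "0 \<le> r1"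
  shows "modal_system r1 r2 (of_int n) \<kappa> (fcoeff n a p_minus) (fcoeff n a p_plus) (fcoeff (n + 1) a u_plus) (fcoeff (n - 1) a u_minus)"
    and "modal_system r1 r2 (- of_int n) \<kappa> (fcoeff n a p_plus) (fcoeff n a p_minus) (fcoeff (n - 1) a u_minus) (fcoeff (n + 1) a u_plus)"
    and "\<And>r. r1 < r \<Longrightarrow> ereal r < r2 \<Longrightarrow> (fcoeff n a p_plus r - fcoeff n a p_minus r) / 2 = \<i> * fcoeff n a vort r"
proof -
  have D: "(fcoeff n a p_plus r - fcoeff n a p_minus r) / 2 = \<i> * fcoeff n a vort r \<and>
    (fcoeff n a p_minus has_vector_derivative (\<kappa> * fcoeff (n + 1) a u_plus r + of_real (of_int n / r) * fcoeff n a p_minus r)) (at r) \<and>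
    (fcoeff (n + 1) a u_plus has_vector_derivative (\<i> * fcoeff n a vort r - of_real ((of_int n + 1) / r) * fcoeff (n + 1) a u_plus r)) (at r) \<and>
    (fcoeff n a p_plus has_vector_derivative (\<kappa> * fcoeff (n - 1) a u_minus r - of_real (of_int n / r) * fcoeff n a p_plus r)) (at r) \<and>
    (fcoeff (n - 1) a u_minus has_vector_derivative (- \<i> * fcoeff n a vort r + of_real ((of_int n - 1) / r) * fcoeff (n - 1) a u_minus r)) (at r)"
    if r: "r1 < r" "ereal r < r2" for r
  proof -
    \<comment> \<open>The coefficient lemmas work on annuli with a real outer radius, whereas
      \<open>r2\<close> may be infinite; a finite radius beyond r suffices locally.\<close>
    obtain b where b: "ereal r < ereal b" "ereal b < r2" using ereal_dense2[OF r(2)] by blast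
    have annb: "a + r *\<^sub>R ray \<theta> \<in> E" if "r1 < r" "r < b" for r \<theta>
      using that b by (intro ann) (auto intro: order_less_trans[of _ "ereal b"])
    have rb: "r < b" using b by simp
    note c = C1_on_continuous[OF C1_wirtinger(3)] C1_on_continuous[OF C1_wirtinger(4)]
    have "fcoeff n a (\<lambda>x. p_plus x - p_minus x) r = fcoeff n a p_plus r - fcoeff n a p_minus r"
      by (rule fcoeff_diff[where E=E and ?r1.0=r1 and ?r2.0=b]) (use annb r1 c r(1) rb in auto)
    moreover have "(\<lambda>x. p_plus x - p_minus x) = (\<lambda>x. 2 * \<i> * vort x)"
      by (simp add: fun_eq_iff p_plus_def p_minus_def)
    ultimately have 0: "(fcoeff n a p_plus r - fcoeff n a p_minus r) / 2 = \<i> * fcoeff n a vort r"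
      using fcoeff_cmult[of n a "2 * \<i>" vort r] by (simp add: mult_ac)
    note d = fcoeff_d[where E=E and a=a and ?r1.0=r1 and ?r2.0=b, OF annb r1 _ _ r(1) rb]
    note db = fcoeff_dbar[where E=E and a=a and ?r1.0=r1 and ?r2.0=b, OF annb r1 _ _ r(1) rb]
    note e = db[OF _ _ C1_wirtinger(4) stokes_wirtinger(2), of n] d[OF _ _ C1_wirtinger(1) stokes_wirtinger(1), of "n + 1"]
      d[OF _ _ C1_wirtinger(3) stokes_wirtinger(3), of n] db[OF _ _ C1_wirtinger(2) stokes_wirtinger(4), of "n - 1"]
    show ?thesis using 0 e[unfolded fcoeff_cmult] by simp
  qed
  then show "\<And>r. r1 < r \<Longrightarrow> ereal r < r2 \<Longrightarrow> (fcoeff n a p_plus r - fcoeff n a p_minus r) / 2 = \<i> * fcoeff n a vort r"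
    by blast
  have i: "(fcoeff n a p_plus r - fcoeff n a p_minus r) / 2 = \<i> * fcoeff n a vort r"
    "(fcoeff n a p_minus r - fcoeff n a p_plus r) / 2 = - \<i> * fcoeff n a vort r" if "r1 < r" "ereal r < r2" for r
    using D[OF that] by (auto simp: field_simps)
  show "modal_system r1 r2 (of_int n) \<kappa> (fcoeff n a p_minus) (fcoeff n a p_plus) (fcoeff (n + 1) a u_plus) (fcoeff (n - 1) a u_minus)"
  proof
    show "0 \<le> r1" by (rule r1)
    fix r assume r: "r1 < r" "ereal r < r2"
    show "(fcoeff n a p_minus has_vector_derivative (\<kappa> * fcoeff (n + 1) a u_plus r + of_real (of_int n / r) * fcoeff n a p_minus r)) (at r)"
      "(fcoeff n a p_plus has_vector_derivative (\<kappa> * fcoeff (n - 1) a u_minus r - of_real (of_int n / r) * fcoeff n a p_plus r)) (at r)"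
      using D[OF r] by blast+
    show "(fcoeff (n + 1) a u_plus has_vector_derivative ((fcoeff n a p_plus r - fcoeff n a p_minus r) / 2 - of_real ((of_int n + 1) / r) * fcoeff (n + 1) a u_plus r)) (at r)"
      unfolding i(1)[OF r] using D[OF r] by blast
    show "(fcoeff (n - 1) a u_minus has_vector_derivative ((fcoeff n a p_minus r - fcoeff n a p_plus r) / 2 + of_real ((of_int n - 1) / r) * fcoeff (n - 1) a u_minus r)) (at r)"
      unfolding i(2)[OF r] using D[OF r] by blast
  qed
  show "modal_system r1 r2 (- of_int n) \<kappa> (fcoeff n a p_plus) (fcoeff n a p_minus) (fcoeff (n - 1) a u_minus) (fcoeff (n + 1) a u_plus)"
  proof
    show "0 \<le> r1" by (rule r1)
    fix r assume r: "r1 < r" "ereal r < r2"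
    have m: "- real_of_int n / r = - (of_int n / r)" "(- real_of_int n + 1) / r = - ((of_int n - 1) / r)"
      "(- real_of_int n - 1) / r = - ((of_int n + 1) / r)"
      by (simp_all add: diff_divide_distrib add_divide_distrib)
    note s = m of_real_minus mult_minus_left add_uminus_conv_diff diff_minus_eq_add
    show "(fcoeff n a p_plus has_vector_derivative (\<kappa> * fcoeff (n - 1) a u_minus r + of_real (- of_int n / r) * fcoeff n a p_plus r)) (at r)"
      "(fcoeff n a p_minus has_vector_derivative (\<kappa> * fcoeff (n + 1) a u_plus r - of_real (- of_int n / r) * fcoeff n a p_minus r)) (at r)"
      unfolding s using D[OF r] by blast+
    show "(fcoeff (n - 1) a u_minus has_vector_derivative ((fcoeff n a p_minus r - fcoeff n a p_plus r) / 2 - of_real ((- of_int n + 1) / r) * fcoeff (n - 1) a u_minus r)) (at r)"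
      unfolding i(2)[OF r] s using D[OF r] unfolding s by blast
    show "(fcoeff (n + 1) a u_plus has_vector_derivative ((fcoeff n a p_plus r - fcoeff n a p_minus r) / 2 + of_real ((- of_int n - 1) / r) * fcoeff (n + 1) a u_plus r)) (at r)"
      unfolding i(1)[OF r] s using D[OF r] by blast
  qed
qed

lemma vort_zero_of_modes:
  assumes circle: "\<And>\<theta>. a + r *\<^sub>R ray \<theta> \<in> E" and z: "\<And>n. fcoeff n a vort r = 0" and \<nu>: "norm \<nu> = 1"
  shows "vort (a + r *\<^sub>R \<nu>) = 0"
proof -
  have "a + r *\<^sub>R x \<in> E" if "x \<in> sphere 0 1" for x
    using circle sphere_point_ray[of x] that by (metis mem_sphere_0)
  then have "continuous_on (sphere 0 1) (\<lambda>x. vort (a + r *\<^sub>R x))"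
    by (intro continuous_on_compose2[OF C1_on_continuous[OF C1_vort]] continuous_intros) auto
  from all_fcoeff_zero[OF this _ \<nu>] z show ?thesis by (simp add: fcoeff_def)
qed

text \<open>Expanded about the centre of the ball, every mode of the vorticity vanishes for small
  radii, hence for all radii up to the boundary sphere; completeness recovers the function on each
  circle.\<close>

lemma vort_unique_continuation_ball:
  assumes ball: "ball a \<rho> \<subseteq> E" and s: "s > 0" and z: "\<And>x. x \<in> ball a s \<Longrightarrow> vort x = 0" and x: "x \<in> ball a \<rho>"
  shows "vort x = 0"
proof (cases "x = a")
  case True
  then show ?thesis using z s by simp
next
  case False
  have ann: "a + r *\<^sub>R ray \<theta> \<in> E" if "0 < r" "ereal r < ereal \<rho>" for r \<theta>
    using that ball by (auto simp: subset_iff dist_norm)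
  define r where "r = norm (x - a)"
  have r: "0 < r" "r < \<rho>" using False x by (auto simp: r_def dist_norm norm_minus_commute)
  have "fcoeff n a vort r = 0" for n
  proof -
    interpret M: modal_system 0 "ereal \<rho>" "of_int n" \<kappa> "fcoeff n a p_minus" "fcoeff n a p_plus" "fcoeff (n + 1) a u_plus" "fcoeff (n - 1) a u_minus"
      by (rule modal_systems(1)[OF ann order_refl])
    have W: "M.W t = \<i> * fcoeff n a vort t" if "0 < t" "t < \<rho>" for t
      using modal_systems(3)[OF ann order_refl, where n=n and r=t and ?r2.0="ereal \<rho>"] that by (simp add: M.W_def)
    have "M.W r = 0"
    proof (rule M.unique_continuation[of "min s \<rho>"])
      fix t assume t: "0 < t" "t < min s \<rho>"
      have "fcoeff n a vort t = integral {0..2*pi} (\<lambda>\<theta>. 0)"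
        unfolding fcoeff_def by (rule integral_cong) (use t z in \<open>simp add: dist_norm\<close>)
      then show "M.W t = 0" using W[of t] t by simp
    qed (use r s in auto)
    then show ?thesis using W[OF r] by simp
  qed
  then have "vort (a + r *\<^sub>R ((x - a) /\<^sub>R r)) = 0"
    using ann r by (intro vort_zero_of_modes) (auto simp: r_def)
  then show ?thesis using r by simp
qed

lemma vort_unique_continuation:
  assumes conn: "connected E" and a: "a \<in> E" "d > 0" "\<And>y. y \<in> ball a d \<Longrightarrow> vort y = 0" and x: "x \<in> E"
  shows "vort x = 0"
proof -
  \<comment> \<open>Vanishing near a point is an open condition; the ball lemma makes it locally
    constant, which connectedness turns into a global statement.\<close>
  define Z where "Z x \<longleftrightarrow> (\<exists>e>0. \<forall>y\<in>ball x e. vort y = 0)" for x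
  have "Z x"
  proof (rule connected_induction_simple[OF conn a(1) x])
    show "Z a" using a unfolding Z_def by blast
    fix z assume "z \<in> E"
    then obtain \<rho> where \<rho>: "\<rho> > 0" "ball z \<rho> \<subseteq> E" using open_E openE by blast
    show "\<exists>T. openin (top_of_set E) T \<and> z \<in> T \<and> (\<forall>x\<in>T. \<forall>y\<in>T. Z x \<longrightarrow> Z y)"
    proof (intro exI conjI ballI impI)
      have "ball z (\<rho>/3) \<subseteq> ball z \<rho>" using \<rho>(1) by (intro subset_ball) simp
      then show "openin (top_of_set E) (ball z (\<rho>/3))"
        using \<rho>(2) by (intro open_subset) auto
      show "z \<in> ball z (\<rho>/3)" using \<rho> by simp
      fix v w assume v: "v \<in> ball z (\<rho>/3)" and w: "w \<in> ball z (\<rho>/3)" and Z: "Z v"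
      from Z obtain e where e: "e > 0" "\<And>y. y \<in> ball v e \<Longrightarrow> vort y = 0" unfolding Z_def by blast
      \<comment> \<open>Thirds suffice: the ball of radius 2\<rho>/3 about \<open>v\<close> stays
        within \<rho> of \<open>z\<close> and still contains every \<open>w\<close> closer than
        \<rho>/3 to \<open>z\<close>.\<close>
      have sub: "ball v (2*\<rho>/3) \<subseteq> E"
      proof -
        have "ball v (2*\<rho>/3) \<subseteq> ball z \<rho>"
        proof
          fix y assume "y \<in> ball v (2*\<rho>/3)"
          then show "y \<in> ball z \<rho>" using v dist_triangle[of z y v] by simp
        qed
        then show ?thesis using \<rho> by blast
      qed
      have wv: "w \<in> ball v (2*\<rho>/3)" using v w dist_triangle[of v w z] by (simp add: dist_commute)
      then obtain e' where e': "e' > 0" "ball w e' \<subseteq> ball v (2*\<rho>/3)" using open_ball openE by blast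
      show "Z w" unfolding Z_def
        using e' vort_unique_continuation_ball[OF sub e] by blast
    qed
  qed
  then show ?thesis unfolding Z_def using centre_in_ball by blast
qed

text \<open>Cauchy-Schwarz bounds each mode by the integral of |u|^2 over its circle, polar
  coordinates turn these into an integral over the annulus, and |x| \<ge> R there supplies the
  weight of \<open>radiating_decay\<close> at the price of 1/R.\<close>

lemma mode_decay:
  fixes f :: "real^2 \<Rightarrow> complex"
  assumes far: "\<And>x. norm x > \<rho> \<Longrightarrow> x \<in> E" and \<rho>: "\<rho> \<ge> 0"
    and cf: "continuous_on E f" and le: "\<And>x. (cmod (f x))\<^sup>2 \<le> 2 * (norm (u x))\<^sup>2"
    and decay: "((\<lambda>R. (\<integral>x. indicator (supp_u \<inter> cball 0 R) x * (norm x * (norm (u x))\<^sup>2) \<partial>lborel) / R\<^sup>2) \<longlongrightarrow> 0) at_top"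
  shows "((\<lambda>R. integral {R..2*R} (\<lambda>r. r * (cmod (fcoeff n 0 f r))\<^sup>2) / R) \<longlongrightarrow> 0) at_top"
proof -
  let ?I = "\<lambda>R. \<integral>x. indicator (supp_u \<inter> cball 0 R) x * (norm x * (norm (u x))\<^sup>2) \<partial>lborel"
  have bound: "integral {R..2*R} (\<lambda>r. r * (cmod (fcoeff n 0 f r))\<^sup>2) / R \<le> 32 * pi * (?I (2*R) / (2*R)\<^sup>2)"
    and nonneg: "0 \<le> integral {R..2*R} (\<lambda>r. r * (cmod (fcoeff n 0 f r))\<^sup>2) / R" if R: "R > \<rho>" for R
  proof -
    have R0: "R > 0" using R \<rho> by simp
    define A where "A = {x::real^2. R \<le> norm x \<and> norm x \<le> 2*R}"
    have AE: "A \<subseteq> E" using far R by (auto simp: A_def)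
    have cA: "compact A"
    proof -
      have "A = cball 0 (2*R) - ball 0 R" by (auto simp: A_def)
      then show ?thesis by (simp add: compact_diff)
    qed
    have cu: "continuous_on A u" using cont_u_E AE continuous_on_subset by blast
    have pt: "r *\<^sub>R ray \<theta> \<in> A" if "r \<in> {R..2*R}" for r \<theta> using that R0 by (simp add: A_def)
    have cc: "continuous_on ({R..2*R} \<times> T) (\<lambda>z. fst z *\<^sub>R ray (snd z))" for T
      by (intro continuous_intros continuous_on_compose2[OF continuous_ray[of UNIV]]) auto
    have "continuous_on {R..2*R} (\<lambda>r. integral (cbox 0 (2*pi)) (\<lambda>\<theta>. f (0 + r *\<^sub>R ray \<theta>) * cis (- of_int n * \<theta>)))"
    proof (rule integral_continuous_on_param)
      show "continuous_on ({R..2*R} \<times> cbox 0 (2*pi)) (\<lambda>(r, \<theta>). f (0 + r *\<^sub>R ray \<theta>) * cis (- of_int n * \<theta>))"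
        unfolding split_beta
        by (intro continuous_on_mult continuous_on_compose2[OF cf] continuous_on_add continuous_on_const cc
            continuous_on_compose2[OF continuous_cis_scaled[of UNIV]] continuous_on_snd continuous_on_id)
          (use pt AE in auto)
    qed
    then have c1: "continuous_on {R..2*R} (fcoeff n 0 f)" by (simp add: fcoeff_def[abs_def])
    have "continuous_on {R..2*R} (\<lambda>r. integral (cbox 0 (2*pi)) (\<lambda>\<theta>. (norm (u (r *\<^sub>R ray \<theta>)))\<^sup>2))"
    proof (rule integral_continuous_on_param)
      show "continuous_on ({R..2*R} \<times> cbox 0 (2*pi)) (\<lambda>(r, \<theta>). (norm (u (r *\<^sub>R ray \<theta>)))\<^sup>2)"
        unfolding split_beta
        by (intro continuous_on_power continuous_on_norm continuous_on_compose2[OF cu] cc) (use pt in auto)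
    qed
    then have c2: "continuous_on {R..2*R} (\<lambda>r. integral {0..2*pi} (\<lambda>\<theta>. (norm (u (r *\<^sub>R ray \<theta>)))\<^sup>2))" by simp
    have i1: "(\<lambda>r. r * (cmod (fcoeff n 0 f r))\<^sup>2) integrable_on {R..2*R}"
      by (intro integrable_continuous_interval continuous_intros c1)
    have i2: "(\<lambda>r. r * integral {0..2*pi} (\<lambda>\<theta>. (norm (u (r *\<^sub>R ray \<theta>)))\<^sup>2)) integrable_on {R..2*R}"
      by (intro integrable_continuous_interval continuous_intros c2)
    show "0 \<le> integral {R..2*R} (\<lambda>r. r * (cmod (fcoeff n 0 f r))\<^sup>2) / R"
      using R0 by (intro divide_nonneg_nonneg integral_nonneg i1) auto
    have "integral {R..2*R} (\<lambda>r. r * (cmod (fcoeff n 0 f r))\<^sup>2)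
      \<le> integral {R..2*R} (\<lambda>r. 4 * pi * (r * integral {0..2*pi} (\<lambda>\<theta>. (norm (u (r *\<^sub>R ray \<theta>)))\<^sup>2)))"
    proof (rule integral_le[OF i1])
      show "(\<lambda>r. 4 * pi * (r * integral {0..2*pi} (\<lambda>\<theta>. (norm (u (r *\<^sub>R ray \<theta>)))\<^sup>2))) integrable_on {R..2*R}"
        by (intro integrable_continuous_interval continuous_intros c2)
      fix r assume r: "r \<in> {R..2*R}"
      have c: "continuous_on {0..2*pi} (\<lambda>\<theta>. f (0 + r *\<^sub>R ray \<theta>))"
        by (rule continuous_on_compose2[OF cf]) (use pt[OF r] AE in \<open>auto intro!: continuous_intros continuous_ray\<close>)
      have cu': "continuous_on {0..2*pi} (\<lambda>\<theta>. (norm (u (r *\<^sub>R ray \<theta>)))\<^sup>2)"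
        by (intro continuous_on_power continuous_on_norm continuous_on_compose2[OF cu] continuous_intros continuous_ray) (use pt[OF r] in auto)
      have "(cmod (fcoeff n 0 f r))\<^sup>2 \<le> 2 * pi * integral {0..2*pi} (\<lambda>\<theta>. (cmod (f (0 + r *\<^sub>R ray \<theta>)))\<^sup>2)"
        by (rule fcoeff_bound[OF c])
      also have "\<dots> \<le> 2 * pi * integral {0..2*pi} (\<lambda>\<theta>. 2 * (norm (u (r *\<^sub>R ray \<theta>)))\<^sup>2)"
        by (intro mult_left_mono integral_le integrable_continuous_interval continuous_on_mult continuous_on_const cu'
            continuous_on_power continuous_on_norm c) (use le in auto)
      also have "integral {0..2*pi} (\<lambda>\<theta>. 2 * (norm (u (r *\<^sub>R ray \<theta>)))\<^sup>2) = 2 * integral {0..2*pi} (\<lambda>\<theta>. (norm (u (r *\<^sub>R ray \<theta>)))\<^sup>2)"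
        by (rule integral_mult_right)
      finally have "r * (cmod (fcoeff n 0 f r))\<^sup>2 \<le> r * (2 * pi * (2 * integral {0..2*pi} (\<lambda>\<theta>. (norm (u (r *\<^sub>R ray \<theta>)))\<^sup>2)))"
        using r R0 by (intro mult_left_mono) auto
      then show "r * (cmod (fcoeff n 0 f r))\<^sup>2 \<le> 4 * pi * (r * integral {0..2*pi} (\<lambda>\<theta>. (norm (u (r *\<^sub>R ray \<theta>)))\<^sup>2))"
        by (simp add: mult_ac)
    qed
    also have "\<dots> = 4 * pi * integral {R..2*R} (\<lambda>r. r * integral {0..2*pi} (\<lambda>\<theta>. (norm (u (r *\<^sub>R ray \<theta>)))\<^sup>2))"
      by (rule integral_mult_right)
    also have "\<dots> \<le> 4 * pi * (2 * integral A (\<lambda>x. (norm (u x))\<^sup>2))"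
      unfolding A_def
      by (intro mult_left_mono polar_annulus) (use R0 cu in \<open>auto simp: A_def[symmetric] intro!: continuous_intros\<close>)
    also have "integral A (\<lambda>x. (norm (u x))\<^sup>2) \<le> ?I (2*R) / R"
    proof -
      have si: "set_integrable lborel A (\<lambda>x. (norm (u x))\<^sup>2)"
        unfolding set_integrable_def
        by (rule borel_integrable_compact[OF cA]) (intro continuous_intros cu)
      have "integral A (\<lambda>x. (norm (u x))\<^sup>2) = (\<integral>x. indicator A x *\<^sub>R (norm (u x))\<^sup>2 \<partial>lborel)"
        using set_borel_integral_eq_integral(2)[OF si] by (simp add: set_lebesgue_integral_def)
      also have "\<dots> \<le> (\<integral>x. (1 / R) * (indicator (supp_u \<inter> cball 0 (2*R)) x * (norm x * (norm (u x))\<^sup>2)) \<partial>lborel)"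
      proof (rule integral_mono)
        show "integrable lborel (\<lambda>x. indicator A x *\<^sub>R (norm (u x))\<^sup>2)" using si by (simp add: set_integrable_def)
        show "integrable lborel (\<lambda>x. (1 / R) * (indicator (supp_u \<inter> cball 0 (2*R)) x * (norm x * (norm (u x))\<^sup>2)))"
          by (intro integrable_mult_right supp_cball_integrable continuous_intros)
        fix x
        show "indicator A x *\<^sub>R (norm (u x))\<^sup>2 \<le> (1 / R) * (indicator (supp_u \<inter> cball 0 (2*R)) x * (norm x * (norm (u x))\<^sup>2))"
        proof (cases "x \<in> A \<and> u x \<noteq> 0")
          case True
          then have "x \<in> supp_u \<inter> cball 0 (2*R)" using AE by (auto simp: supp_u_def A_def)
          moreover have "R * (norm (u x))\<^sup>2 \<le> norm x * (norm (u x))\<^sup>2"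
            using True by (intro mult_right_mono) (auto simp: A_def)
          ultimately show ?thesis using True R0 by (simp add: le_divide_eq mult.commute)
        next
          case False
          then have "indicator A x *\<^sub>R (norm (u x))\<^sup>2 = 0" by auto
          moreover have "0 \<le> (1 / R) * (indicator (supp_u \<inter> cball 0 (2*R)) x * (norm x * (norm (u x))\<^sup>2))"
            using R0 by (intro mult_nonneg_nonneg) auto
          ultimately show ?thesis by (rule ord_eq_le_trans)
        qed
      qed
      finally show ?thesis by simp
    qed
    finally have "integral {R..2*R} (\<lambda>r. r * (cmod (fcoeff n 0 f r))\<^sup>2) \<le> 4 * pi * (2 * (?I (2*R) / R))" by simp
    then have "integral {R..2*R} (\<lambda>r. r * (cmod (fcoeff n 0 f r))\<^sup>2) / R \<le> 4 * pi * (2 * (?I (2*R) / R)) / R"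
      using R0 by (intro divide_right_mono) auto
    \<comment> \<open>The factor 4 over 8\<pi> comes from writing R^2 as (2R)^2 / 4, to match the
      decay hypothesis at radius 2R.\<close>
    also have "\<dots> = 32 * pi * (?I (2*R) / (2*R)\<^sup>2)" by (simp add: power2_eq_square)
    finally show "integral {R..2*R} (\<lambda>r. r * (cmod (fcoeff n 0 f r))\<^sup>2) / R \<le> 32 * pi * (?I (2*R) / (2*R)\<^sup>2)" .
  qed
  have "filterlim (\<lambda>R::real. 2 * R) at_top at_top"
    by (rule filterlim_tendsto_pos_mult_at_top[OF tendsto_const _ filterlim_ident]) simp
  from tendsto_mult[OF tendsto_const filterlim_compose[OF decay this], of "32 * pi"]
  have lim: "((\<lambda>R. 32 * pi * (?I (2*R) / (2*R)\<^sup>2)) \<longlongrightarrow> 0) at_top" by simp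
  show ?thesis
  proof (rule tendsto_sandwich[OF _ _ tendsto_const lim])
    show "\<forall>\<^sub>F R in at_top. 0 \<le> integral {R..2*R} (\<lambda>r. r * (cmod (fcoeff n 0 f r))\<^sup>2) / R"
      using eventually_gt_at_top[of \<rho>] by eventually_elim (rule nonneg)
    show "\<forall>\<^sub>F R in at_top. integral {R..2*R} (\<lambda>r. r * (cmod (fcoeff n 0 f r))\<^sup>2) / R \<le> 32 * pi * (?I (2*R) / (2*R)\<^sup>2)"
      using eventually_gt_at_top[of \<rho>] by eventually_elim (rule bound)
  qed
qed

lemma wirtinger_norm_le:
  "(cmod (u_plus x))\<^sup>2 \<le> 2 * (norm (u x))\<^sup>2" "(cmod (u_minus x))\<^sup>2 \<le> 2 * (norm (u x))\<^sup>2"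
proof -
  have *: "(cmod z)\<^sup>2 \<le> 2 * ((cmod a)\<^sup>2 + (cmod b)\<^sup>2)" if "cmod z \<le> cmod a + cmod b" for z a b :: complex
  proof -
    have "(cmod z)\<^sup>2 \<le> (cmod a + cmod b)\<^sup>2" using that by (intro power_mono) auto
    also have "\<dots> \<le> 2 * ((cmod a)\<^sup>2 + (cmod b)\<^sup>2)"
      using zero_le_power2[of "cmod a - cmod b"] by (simp add: power2_eq_square algebra_simps)
    finally show ?thesis .
  qed
  show "(cmod (u_plus x))\<^sup>2 \<le> 2 * (norm (u x))\<^sup>2"
    unfolding norm_u_sq u_plus_def
    using norm_triangle_ineq[of "u x $ 1" "\<i> * u x $ 2"] by (intro *) (simp add: norm_mult)
  show "(cmod (u_minus x))\<^sup>2 \<le> 2 * (norm (u x))\<^sup>2"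
    unfolding norm_u_sq u_minus_def
    using norm_triangle_ineq4[of "u x $ 1" "\<i> * u x $ 2"] by (intro *) (simp add: norm_mult)
qed

text \<open>\<open>rellich\<close> demands nonnegative order, so \<open>u_plus\<close> handles n
  \<ge> 0 and \<open>u_minus\<close>, through the mirrored system, handles n < 0.\<close>

lemma far_vort_zero:
  assumes far: "\<And>x. norm x > \<rho> \<Longrightarrow> x \<in> E" and \<rho>: "\<rho> \<ge> 0"
    and K: "\<kappa> = of_real K" "K > 0"
    and decay: "((\<lambda>R. (\<integral>x. indicator (supp_u \<inter> cball 0 R) x * (norm x * (norm (u x))\<^sup>2) \<partial>lborel) / R\<^sup>2) \<longlongrightarrow> 0) at_top"
    and x: "norm x > \<rho>"
  shows "vort x = 0"
proof -
  have ann: "0 + r *\<^sub>R ray \<theta> \<in> E" if "\<rho> < r" for r \<theta>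
    using that \<rho> by (intro far) simp
  define r where "r = norm x"
  have r: "r > \<rho>" "r > 0" using x \<rho> by (auto simp: r_def)
  have "fcoeff n 0 vort r = 0" for n
  proof (cases "n \<ge> 0")
    case True
    interpret M: modal_system \<rho> \<infinity> "of_int n" \<kappa> "fcoeff n 0 p_minus" "fcoeff n 0 p_plus" "fcoeff (n + 1) 0 u_plus" "fcoeff (n - 1) 0 u_minus"
      by (rule modal_systems(1)[OF ann \<rho>])
    have "M.W r = 0"
      by (rule M.rellich[OF refl _ K mode_decay[OF far \<rho> C1_on_continuous[OF C1_wirtinger(1)] wirtinger_norm_le(1) decay] r(1)])
        (use True in auto)
    then show ?thesis using modal_systems(3)[OF ann \<rho> r(1), of \<infinity> n] by (simp add: M.W_def)
  next
    case False
    interpret M: modal_system \<rho> \<infinity> "- of_int n" \<kappa> "fcoeff n 0 p_plus" "fcoeff n 0 p_minus" "fcoeff (n - 1) 0 u_minus" "fcoeff (n + 1) 0 u_plus"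
      by (rule modal_systems(2)[OF ann \<rho>])
    have "M.W r = 0"
      by (rule M.rellich[OF refl _ K mode_decay[OF far \<rho> C1_on_continuous[OF C1_wirtinger(2)] wirtinger_norm_le(2) decay] r(1)])
        (use False in auto)
    then show ?thesis using modal_systems(3)[OF ann \<rho> r(1), of \<infinity> n] by (simp add: M.W_def)
  qed
  then have "vort (0 + r *\<^sub>R (x /\<^sub>R r)) = 0"
    using r by (intro vort_zero_of_modes ann) (auto simp: r_def)
  then show ?thesis using r by simp
qed

section \<open>Potential flow and the conclusion for real k\<close>

lemma irrotational_harmonic:
  assumes v: "\<And>x. x \<in> E \<Longrightarrow> vort x = 0" and x: "x \<in> E"
  shows "laplacian u x = 0"
proof -
  have "partial j vort x = partial j (\<lambda>_. 0) x" for j by (rule partial_cong[OF open_E x v])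
  then have z: "partial j vort x = 0" for j
    using has_derivative_partial[OF has_derivative_const[of 0 "at x"]] by simp
  have z': "partial j (du 2 1) x = partial j (du 1 2) x" for j
    using z[of j] x by (simp add: vort_def[abs_def] partial_diff differentiable_du)
  have "partial 1 (du 1 1) x + partial 2 (du 1 2) x = 0"
    using partial_div_du[OF x, of 1] partial_du_commute[OF x, of 1 2 2] z'[of 2] by simp
  moreover have "partial 1 (du 2 1) x + partial 2 (du 2 2) x = 0"
    using partial_div_du[OF x, of 2] partial_du_commute[OF x, of 2 1 1] z'[of 1] by simp
  moreover have "laplacian u x $ i = partial 1 (du i 1) x + partial 2 (du i 2) x" for i
    unfolding laplacian_def du_def
    by (simp add: sum_2 partial_partial_bounded_linear[OF open_E C2_u bounded_linear_component x, of _ _ i])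
  ultimately show ?thesis by (simp add: vec_eq_iff forall_2)
qed

text \<open>Once the vorticity vanishes, the same velocity solves the homogeneous Stokes system with
  constant pressure, so the original \<open>p\<close>, about whose growth at infinity nothing is
  known, drops out of the final energy estimate.\<close>

lemma radiating_real_zero:
  assumes conn: "connected E" and far: "\<And>x. norm x > \<rho> \<Longrightarrow> x \<in> E"
    and k: "\<kappa> = k\<^sup>2" "Im k = 0" "k \<noteq> 0" and rad: "radiating k u p"
  shows "supp_u = {}"
proof -
  let ?I = "\<lambda>R. \<integral>x. indicator (supp_u \<inter> cball 0 R) x * (norm x * (norm (u x))\<^sup>2) \<partial>lborel"
  let ?D = "\<lambda>R. \<integral>x. indicator (supp_u \<inter> cball 0 R) x * (norm (u x))\<^sup>2 \<partial>lborel"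
  define \<rho>' where "\<rho>' = max \<rho> 0"
  have far': "x \<in> E" if "norm x > \<rho>'" for x using that far by (simp add: \<rho>'_def)
  have \<rho>': "\<rho>' \<ge> 0" by (simp add: \<rho>'_def)
  note decay = radiating_decay[OF k rad]
  have K: "\<kappa> = of_real ((Re k)\<^sup>2)" using k by (simp add: complex_eq_iff power2_eq_square)
  have K': "(Re k)\<^sup>2 > 0" using k by (simp add: complex_eq_iff)
  note far0 = far_vort_zero[OF far' \<rho>' K K' decay]
  have vort0: "vort x = 0" if x: "x \<in> E" for x
  proof (rule vort_unique_continuation[OF conn _ _ _ x])
    \<comment> \<open>The unit ball about a point at distance \<rho>' + 2 lies beyond radius
      \<rho>', where all modes are known to vanish; it is the seed for unique continuation.\<close>
    let ?a = "(\<rho>' + 2) *\<^sub>R axis 1 1 :: real^2"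
    show "?a \<in> E" using \<rho>' by (intro far') simp
    show "vort y = 0" if "y \<in> ball ?a 1" for y
    proof (rule far0)
      have "norm ?a \<le> norm y + norm (?a - y)" using norm_triangle_ineq[of y "?a - y"] by simp
      then show "norm y > \<rho>'" using that \<rho>' by (simp add: dist_norm)
    qed
  qed simp
  \<comment> \<open>The boundary values and the velocity are unchanged, so the energy theory applies
    again with zero pressure and zero mass term.\<close>
  interpret H: stokes_flow E u "\<lambda>_. 0" 0
  proof unfold_locales
    show "C1_on E (\<lambda>_. 0)" by (rule C1_on_const)
    show "- laplacian u x + grad (\<lambda>_. 0) x = 0 *s u x" if "x \<in> E" for x
      using irrotational_harmonic[OF vort0 that] has_derivative_partial[OF has_derivative_const[of "0 :: complex" "at x"]]
      by (simp add: grad_def vec_eq_iff)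
  qed (use open_E C2_u cont_u div_free dirichlet in auto)
  have int: "integrable lborel (\<lambda>x. indicator (supp_u \<inter> cball 0 R) x * (norm (u x))\<^sup>2)" for R
    using supp_cball_integrable[of "\<lambda>_. 1"] by simp
  \<comment> \<open>Removes the weight |x| from the decay: it is at least 1 off the unit disc, and
    the disc contributes a constant that R^2 swamps.\<close>
  have le: "?D R / R\<^sup>2 \<le> ?I R / R\<^sup>2 + ?D 1 / R\<^sup>2" for R
  proof -
    have iI: "integrable lborel (\<lambda>x. indicator (supp_u \<inter> cball 0 R) x * (norm x * (norm (u x))\<^sup>2))"
      by (intro supp_cball_integrable continuous_intros)
    have "?D R \<le> (\<integral>x. indicator (supp_u \<inter> cball 0 R) x * (norm x * (norm (u x))\<^sup>2) + indicator (supp_u \<inter> cball 0 1) x * (norm (u x))\<^sup>2 \<partial>lborel)"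
    proof (rule integral_mono[OF int Bochner_Integration.integrable_add[OF iI int]])
      fix x
      show "indicator (supp_u \<inter> cball 0 R) x * (norm (u x))\<^sup>2
        \<le> indicator (supp_u \<inter> cball 0 R) x * (norm x * (norm (u x))\<^sup>2) + indicator (supp_u \<inter> cball 0 1) x * (norm (u x))\<^sup>2"
      proof (cases "norm x \<le> 1")
        case True
        then show ?thesis by (auto simp: indicator_def)
      next
        case False
        then have "1 * (norm (u x))\<^sup>2 \<le> norm x * (norm (u x))\<^sup>2" by (intro mult_right_mono) auto
        then show ?thesis by (auto simp: indicator_def)
      qed
    qed
    also have "\<dots> = ?I R + ?D 1" by (rule Bochner_Integration.integral_add[OF iI int])
    finally have "?D R / R\<^sup>2 \<le> (?I R + ?D 1) / R\<^sup>2" by (rule divide_right_mono) simp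
    then show ?thesis by (simp add: add_divide_distrib)
  qed
  have lim: "((\<lambda>R. ?I R / R\<^sup>2 + ?D 1 / R\<^sup>2) \<longlongrightarrow> 0 + 0) at_top"
    by (intro tendsto_add decay tendsto_divide_0[OF tendsto_const] filterlim_at_top_imp_at_infinity filterlim_pow_at_top filterlim_ident) auto
  have "((\<lambda>R. ?D R / R\<^sup>2) \<longlongrightarrow> 0) at_top"
  proof (rule tendsto_sandwich[OF _ _ tendsto_const])
    show "\<forall>\<^sub>F R in at_top. 0 \<le> ?D R / R\<^sup>2"
      by (intro always_eventually allI divide_nonneg_nonneg integral_nonneg_AE AE_I2) auto
    show "\<forall>\<^sub>F R in at_top. ?D R / R\<^sup>2 \<le> ?I R / R\<^sup>2 + ?D 1 / R\<^sup>2" using le by (intro always_eventually allI)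
    show "((\<lambda>R. ?I R / R\<^sup>2 + ?D 1 / R\<^sup>2) \<longlongrightarrow> 0) at_top" using lim by simp
  qed
  then show ?thesis
    using H.potential_flow_zero[OF conn, of "\<rho>' + 1"] far' by auto
qed

end

text \<open>Connectedness excludes bounded components of the complement, on which a Stokes
  eigenfunction, extended by 0, would be a counterexample for suitable real k. For k = 0 the
  exterior of a disc carries the flows of Stokes' paradox, which grow like log r while their
  traction decays like 1/r.\<close>

theorem theorem5:
  fixes \<Omega> :: "nat \<Rightarrow> (real^2) set" and m :: nat and E \<Gamma> :: "(real^2) set"
    and k :: complex and u :: "real^2 \<Rightarrow> complex^2" and p :: "real^2 \<Rightarrow> complex"
  assumes "\<And>i. i \<in> {1..m} \<Longrightarrow> open (\<Omega> i) \<and> connected (\<Omega> i) \<and> \<Omega> i \<noteq> {} \<and> bounded (\<Omega> i)"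
    and "E = exterior \<Omega> m" and "connected E" and "\<Gamma> = frontier E"
    and "k \<noteq> 0" and "Im k \<ge> 0"
    and "oscillatory_stokes k E u p" and "radiating k u p"
    and "\<forall>x\<in>\<Gamma>. u x = 0"
  shows "\<forall>x\<in>E. u x = 0"
proof -
  interpret stokes_flow E u p "k\<^sup>2"
    using assms(4,7,9)
    by unfold_locales (auto simp: oscillatory_stokes_def solution_space_def assms(2) exterior_def)
  have "bounded (closure (\<Union>i\<in>{1..m}. \<Omega> i))"
    using assms(1) by (intro bounded_closure bounded_UN) auto
  then obtain \<rho> where "\<forall>x\<in>closure (\<Union>i\<in>{1..m}. \<Omega> i). norm x \<le> \<rho>" unfolding bounded_iff by blast
  then have far: "x \<in> E" if "norm x > \<rho>" for x
    using that unfolding assms(2) exterior_def by (metis ComplI not_le)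
  have "supp_u = {}"
  proof (cases "Im k > 0")
    case True
    then show ?thesis using radiating_dissipative_zero[OF refl] assms(8) by blast
  next
    case False
    then show ?thesis using radiating_real_zero[OF assms(3) far refl] assms(5,6,8) by simp
  qed
  then show ?thesis by (auto simp: supp_u_def)
qed

end
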